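(* Let $\alpha\in(0,1]$ and $1<p<q<\infty$ satisfy $q\le p+\alpha\max\left(1,\frac pd\right)$. Let $\psi:\overline\Omega\times\mathbb R^+\to\mathbb R^+$ satisfy the structural conditions (A1)--(A5) with exponents $p,q$ and the continuity condition (Cont), and let $\mathcal H(u,\Omega)=\int_\Omega\psi(x,|\nabla u(x)|)\,dx$. Then for all $u_0\in W^{1,q}(\Omega)$ $$\inf_{u\in u_0+W^{1,p}_0(\Omega)}\mathcal H(u,\Omega)=\inf_{u\in u_0+W^{1,q}_0(\Omega)}\mathcal H(u,\Omega)=\inf_{u\in u_0+C_c^\infty(\Omega)}\mathcal H(u,\Omega).$$ Moreover, $C_c^\infty(\Omega)$ is dense in the Musielak--Orlicz--Sobolev space $W^{1,\psi}_0(\Omega)$.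
   Context: $\mathbb R^+=[0,\infty)$; $\Omega\subset\mathbb R^d$ is a bounded Lipschitz domain; $B_\gamma(x)$ is the open ball of radius $\gamma$ and center $x$; functions $u$ are real-valued. The map $x\mapsto\psi(x,\xi)$ is measurable for each $\xi$. Structural conditions (for all $x$): (A1) $\psi(x,\xi)=0$ if and only if $\xi=0$; (A2) $\xi\mapsto\psi(x,\xi)$ is convex on $\mathbb R^+$; (A3) there is a strictly increasing continuous $m_\psi:\mathbb R^+\to\mathbb R^+$ with $m_\psi(0)=0$, $m_\psi(\xi)\le\psi(x,\xi)$ for all $\xi \geq 0$, and $m_\psi(\xi)/\xi\to\infty$ as $\xi\to\infty$; (A4) there are $\xi_0\ge1$ and constants $C_1,C_2>0$ such that $C_1\xi^p\le\psi(x,\xi)$ for $\xi\ge\xi_0$, and $\psi(x,\xi)\le C_2(1+\xi^q)$ for all $\xi\ge0$; (A5) there is a constant $C_4$ such that $\psi(x,2\xi)\le C_4\psi(x,\xi)$ for all $\xi\ge0$. (Cont): for all $D>1$ there are constants $M=M(p,q,D)$ and $N=N(p,q,D)$ such that $\psi(z,\xi)\le M\psi(y,\xi)+N$ for all balls $B_\gamma(x)$, all $y,z\in\overline{B_\gamma(x)}\cap\overline\Omega$, all $\xi\in[0,D\gamma^{-\min(1,d/p)}]$ and all $\gamma\in(0,\frac12)$ (so $M,N$ do not depend on $x,y,z,\xi,\gamma$). Spaces: $\|f\|_\psi=\inf\{\lambda>0:\int_\Omega\psi(x,|f(x)|/\lambda)\,dx\le1\}$; $W^{1,\psi}(\Omega)=\{w\in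 W^{1,1}(\Omega):\|\nabla w\|_\psi<\infty\}$; $W^{1,\psi}_0(\Omega)=W^{1,1}_0(\Omega)\cap W^{1,\psi}(\Omega)$; norm $\|u\|_{1,\psi}=\|u\|_{L^1(\Omega)}+\|\nabla u\|_\psi$. *)

theory Defs
  imports "HOL-Analysis.Analysis"
begin

text \<open>
  The space \<open>\<real>\<^sup>d\<close> is a type of class \<open>euclidean_space\<close>, with \<open>d = DIM('a)\<close>.  Functions on a domain
  are total functions of which only the restriction to the domain matters, up to null sets.
\<close>

text \<open>Near each boundary point, \<open>\<Omega>\<close> is the strict epigraph, in some direction \<open>e\<close>, of a Lipschitz
  function on the hyperplane orthogonal to \<open>e\<close>.\<close>

definition bounded_lipschitz_domain :: "'a::euclidean_space set \<Rightarrow> bool" where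
  "bounded_lipschitz_domain \<Omega> \<longleftrightarrow>
     open \<Omega> \<and> connected \<Omega> \<and> \<Omega> \<noteq> {} \<and> bounded \<Omega> \<and>
     (\<forall>x0\<in>frontier \<Omega>. \<exists>r>0. \<exists>e. \<exists>L. \<exists>g::'a \<Rightarrow> real.
        norm e = 1 \<and> L-lipschitz_on {y. y \<bullet> e = 0} g \<and>
        \<Omega> \<inter> ball x0 r = {x \<in> ball x0 r. g (x - (x \<bullet> e) *\<^sub>R e) < x \<bullet> e})"

primrec continuously_differentiable :: "nat \<Rightarrow> ('a::euclidean_space \<Rightarrow> real) \<Rightarrow> bool" where
  "continuously_differentiable 0 f \<longleftrightarrow> continuous_on UNIV f"
| "continuously_differentiable (Suc k) f \<longleftrightarrow>
     (\<forall>x. f differentiable (at x)) \<and>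
     (\<forall>v. continuously_differentiable k (\<lambda>x. frechet_derivative f (at x) v))"

definition Cc_infinity :: "'a::euclidean_space set \<Rightarrow> ('a \<Rightarrow> real) set" where
  "Cc_infinity \<Omega> =
     {\<phi>. (\<forall>k. continuously_differentiable k \<phi>) \<and>
         compact (closure {x. \<phi> x \<noteq> 0}) \<and> closure {x. \<phi> x \<noteq> 0} \<subseteq> \<Omega>}"

definition locally_integrable ::
  "'a::euclidean_space set \<Rightarrow> ('a \<Rightarrow> 'b::euclidean_space) \<Rightarrow> bool" where
  "locally_integrable \<Omega> f \<longleftrightarrow> (\<forall>K. compact K \<and> K \<subseteq> \<Omega> \<longrightarrow> integrable (lebesgue_on K) f)"

definition is_weak_gradient ::
  "'a::euclidean_space set \<Rightarrow> ('a \<Rightarrow> real) \<Rightarrow> ('a \<Rightarrow> 'a) \<Rightarrow> bool" where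
  "is_weak_gradient \<Omega> u g \<longleftrightarrow>
     locally_integrable \<Omega> u \<and> locally_integrable \<Omega> g \<and>
     (\<forall>\<phi>\<in>Cc_infinity \<Omega>. \<forall>b\<in>Basis.
        (LINT x|lebesgue_on \<Omega>. u x * frechet_derivative \<phi> (at x) b) =
        - (LINT x|lebesgue_on \<Omega>. (g x \<bullet> b) * \<phi> x))"

text \<open>A representative of the weak gradient, which is unique almost everywhere in \<open>\<Omega>\<close>; the value is
  meaningful only if a weak gradient exists, as it does for all Sobolev functions.\<close>

definition weak_gradient :: "'a::euclidean_space set \<Rightarrow> ('a \<Rightarrow> real) \<Rightarrow> 'a \<Rightarrow> 'a" where
  "weak_gradient \<Omega> u = (SOME g. is_weak_gradient \<Omega> u g)"

definition Lp_space ::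
  "'a::euclidean_space set \<Rightarrow> real \<Rightarrow> ('a \<Rightarrow> 'b::euclidean_space) set" where
  "Lp_space \<Omega> p =
     {f. f \<in> borel_measurable (lebesgue_on \<Omega>) \<and>
         integrable (lebesgue_on \<Omega>) (\<lambda>x. norm (f x) powr p)}"

definition Lp_norm ::
  "'a::euclidean_space set \<Rightarrow> real \<Rightarrow> ('a \<Rightarrow> 'b::euclidean_space) \<Rightarrow> real" where
  "Lp_norm \<Omega> p f = (LINT x|lebesgue_on \<Omega>. norm (f x) powr p) powr (1 / p)"

definition W1p :: "'a::euclidean_space set \<Rightarrow> real \<Rightarrow> ('a \<Rightarrow> real) set" where
  "W1p \<Omega> p =
     {u \<in> Lp_space \<Omega> p. \<exists>g. is_weak_gradient \<Omega> u g \<and> g \<in> Lp_space \<Omega> p}"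

definition W1p_norm :: "'a::euclidean_space set \<Rightarrow> real \<Rightarrow> ('a \<Rightarrow> real) \<Rightarrow> real" where
  "W1p_norm \<Omega> p u = Lp_norm \<Omega> p u + Lp_norm \<Omega> p (weak_gradient \<Omega> u)"

text \<open>The closure of the test functions in \<open>W\<^sup>1\<^sup>,\<^sup>p(\<Omega>)\<close>.\<close>

definition W1p0 :: "'a::euclidean_space set \<Rightarrow> real \<Rightarrow> ('a \<Rightarrow> real) set" where
  "W1p0 \<Omega> p =
     {u \<in> W1p \<Omega> p. \<forall>\<epsilon>>0. \<exists>\<phi>\<in>Cc_infinity \<Omega>. W1p_norm \<Omega> p (\<lambda>x. u x - \<phi> x) < \<epsilon>}"

text \<open>An integrand \<open>\<psi>\<close> is relevant only at points of \<open>closure \<Omega>\<close> and arguments \<open>\<xi> \<ge> 0\<close>.\<close>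

definition musielak_norm ::
  "'a::euclidean_space set \<Rightarrow> ('a \<Rightarrow> real \<Rightarrow> real) \<Rightarrow> ('a \<Rightarrow> 'b::euclidean_space) \<Rightarrow> ennreal" where
  "musielak_norm \<Omega> \<psi> f =
     Inf {ennreal l |l. l > 0 \<and> (\<integral>\<^sup>+x. ennreal (\<psi> x (norm (f x) / l)) \<partial>lebesgue_on \<Omega>) \<le> 1}"

definition W1psi ::
  "'a::euclidean_space set \<Rightarrow> ('a \<Rightarrow> real \<Rightarrow> real) \<Rightarrow> ('a \<Rightarrow> real) set" where
  "W1psi \<Omega> \<psi> = {w \<in> W1p \<Omega> 1. musielak_norm \<Omega> \<psi> (weak_gradient \<Omega> w) < \<infinity>}"

definition W1psi0 ::
  "'a::euclidean_space set \<Rightarrow> ('a \<Rightarrow> real \<Rightarrow> real) \<Rightarrow> ('a \<Rightarrow> real) set" where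
  "W1psi0 \<Omega> \<psi> = W1p0 \<Omega> 1 \<inter> W1psi \<Omega> \<psi>"

definition W1psi_norm ::
  "'a::euclidean_space set \<Rightarrow> ('a \<Rightarrow> real \<Rightarrow> real) \<Rightarrow> ('a \<Rightarrow> real) \<Rightarrow> ennreal" where
  "W1psi_norm \<Omega> \<psi> u = ennreal (Lp_norm \<Omega> 1 u) + musielak_norm \<Omega> \<psi> (weak_gradient \<Omega> u)"

definition energy ::
  "'a::euclidean_space set \<Rightarrow> ('a \<Rightarrow> real \<Rightarrow> real) \<Rightarrow> ('a \<Rightarrow> real) \<Rightarrow> ennreal" where
  "energy \<Omega> \<psi> u = (\<integral>\<^sup>+x. ennreal (\<psi> x (norm (weak_gradient \<Omega> u x))) \<partial>lebesgue_on \<Omega>)"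

definition admissible_integrand ::
  "'a::euclidean_space set \<Rightarrow> ('a \<Rightarrow> real \<Rightarrow> real) \<Rightarrow> bool" where
  "admissible_integrand \<Omega> \<psi> \<longleftrightarrow>
     (\<forall>x\<in>closure \<Omega>. \<forall>\<xi>\<ge>0. \<psi> x \<xi> \<ge> 0) \<and>
     (\<forall>\<xi>\<ge>0. (\<lambda>x. \<psi> x \<xi>) \<in> borel_measurable (lebesgue_on (closure \<Omega>)))"

definition cond_A1 :: "'a::euclidean_space set \<Rightarrow> ('a \<Rightarrow> real \<Rightarrow> real) \<Rightarrow> bool" where
  "cond_A1 \<Omega> \<psi> \<longleftrightarrow> (\<forall>x\<in>closure \<Omega>. \<forall>\<xi>\<ge>0. \<psi> x \<xi> = 0 \<longleftrightarrow> \<xi> = 0)"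

definition cond_A2 :: "'a::euclidean_space set \<Rightarrow> ('a \<Rightarrow> real \<Rightarrow> real) \<Rightarrow> bool" where
  "cond_A2 \<Omega> \<psi> \<longleftrightarrow> (\<forall>x\<in>closure \<Omega>. convex_on {0..} (\<psi> x))"

definition cond_A3 :: "'a::euclidean_space set \<Rightarrow> ('a \<Rightarrow> real \<Rightarrow> real) \<Rightarrow> bool" where
  "cond_A3 \<Omega> \<psi> \<longleftrightarrow>
     (\<exists>m. strict_mono_on {0..} m \<and> continuous_on {0..} m \<and> m 0 = 0 \<and>
          (\<forall>x\<in>closure \<Omega>. \<forall>\<xi>\<ge>0. m \<xi> \<le> \<psi> x \<xi>) \<and>
          filterlim (\<lambda>\<xi>. m \<xi> / \<xi>) at_top at_top)"

definition cond_A4 ::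
  "'a::euclidean_space set \<Rightarrow> real \<Rightarrow> real \<Rightarrow> ('a \<Rightarrow> real \<Rightarrow> real) \<Rightarrow> bool" where
  "cond_A4 \<Omega> p q \<psi> \<longleftrightarrow>
     (\<exists>\<xi>0\<ge>1. \<exists>C1>0. \<exists>C2>0. \<forall>x\<in>closure \<Omega>.
        (\<forall>\<xi>\<ge>\<xi>0. C1 * \<xi> powr p \<le> \<psi> x \<xi>) \<and>
        (\<forall>\<xi>\<ge>0. \<psi> x \<xi> \<le> C2 * (1 + \<xi> powr q)))"

definition cond_A5 :: "'a::euclidean_space set \<Rightarrow> ('a \<Rightarrow> real \<Rightarrow> real) \<Rightarrow> bool" where
  "cond_A5 \<Omega> \<psi> \<longleftrightarrow> (\<exists>C4. \<forall>x\<in>closure \<Omega>. \<forall>\<xi>\<ge>0. \<psi> x (2 * \<xi>) \<le> C4 * \<psi> x \<xi>)"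

text \<open>The centre \<open>x\<close> ranges over the whole space; for \<open>\<gamma> > 0\<close>, \<open>cball x \<gamma>\<close> is the closure of the open
  ball.\<close>

definition cond_Cont ::
  "'a::euclidean_space set \<Rightarrow> real \<Rightarrow> ('a \<Rightarrow> real \<Rightarrow> real) \<Rightarrow> bool" where
  "cond_Cont \<Omega> p \<psi> \<longleftrightarrow>
     (\<forall>D>1. \<exists>M N. \<forall>\<gamma>\<in>{0<..<1/2}. \<forall>x.
        \<forall>y\<in>cball x \<gamma> \<inter> closure \<Omega>. \<forall>z\<in>cball x \<gamma> \<inter> closure \<Omega>.
        \<forall>\<xi>\<in>{0..D * \<gamma> powr (- min 1 (real DIM('a) / p))}. \<psi> z \<xi> \<le> M * \<psi> y \<xi> + N)"

end

theory Submission
  imports Defs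
begin

text \<open>
  A function \<open>v\<close> in \<open>W\<^sub>0\<^sup>1\<^sup>,\<^sup>1\<close> with finite modular is first truncated, so that it may be assumed bounded, and then
  split by a partition of unity into pieces living in charts of the Lipschitz boundary.  Each piece is mollified at
  scale \<open>\<gamma>\<close> with a kernel supported near an inward direction, which yields test functions.  Their gradients are
  of size \<open>O(\<gamma> powr - min 1 (d/p))\<close>: by the boundedness of \<open>v\<close> if \<open>p \<le> d\<close>, and by the \<open>L\<^sup>p\<close> bound on the gradient from
  (A4) if \<open>p > d\<close>.  Hence (Cont) and Jensen's inequality bound \<open>\<psi>\<close> of the mollified gradient by the mollification of
  \<open>\<psi>\<close> of the gradient, up to constants, and dominated convergence gives modular convergence.  By the doubling condition
  (A5), this is convergence in norm and also convergence of the energies.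
\<close>

subsection \<open>Smooth functions\<close>

text \<open>(Cont) compares \<open>\<psi>\<close> at neighbouring points only for arguments up to D
  \<gamma>^(-\<mu>). The mollified gradient stays in this range, but the gradient that is averaged
  does not, so Jensen's inequality cannot be applied to \<open>\<psi>\<close> with a frozen point.
  Jensen needs only an affine minorant, however. \<open>psi_line\<close> provides it at the height t
  of the mollified gradient: since \<psi>(z,t)/t increases in t, its slope is at most \<psi>(z,K)/K
  at the end K of the range, and there (Cont) still applies; the additive constant N then costs a
  term linear in the argument, which the p-growth absorbs. Truncation has two uses. It yields the
  gradient bound for p at most d, and it gives the product-rule terms v grad \<eta> of the
  localisation a finite modular. A function in W_0 extended by zero is an L^1 limit of C^1 functions
  on the whole space together with its gradient, so calculus is done there, on pairs (v, g), and the
  geometry of the boundary enters only through the support of the mollified functions. For the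
  energies a fixed constant in the triangle inequality would be too coarse; convexity and doubling
  give a factor 1 + \<eta> on the main term.\<close>

abbreviation cd :: "nat \<Rightarrow> ('a::euclidean_space \<Rightarrow> real) \<Rightarrow> bool" where
  "cd \<equiv> continuously_differentiable"

lemma cd_SucI:
  assumes "\<And>x. (f has_derivative D x) (at x)" and "\<And>v. cd k (\<lambda>x. D x v)"
  shows "cd (Suc k) f"
proof -
  have "frechet_derivative f (at x) = D x" for x
    using frechet_derivative_at[OF assms(1)] by metis
  then show ?thesis using assms by (auto simp: differentiable_def)
qed

lemma cd_Suc_has_derivative:
  "cd (Suc k) f \<Longrightarrow> (f has_derivative frechet_derivative f (at x)) (at x)"
  by (simp add: frechet_derivative_works[symmetric])

lemma cd_continuous: "cd k f \<Longrightarrow> continuous_on S f"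
proof -
  assume "cd k f"
  then have "continuous_on UNIV f"
    by (cases k) (auto intro!: differentiable_imp_continuous_on simp: differentiable_on_def)
  then show ?thesis by (rule continuous_on_subset) simp
qed

lemma cd_mono: "cd (Suc k) f \<Longrightarrow> cd k f"
proof (induction k arbitrary: f)
  case 0
  then show ?case using cd_continuous by fastforce
next
  case (Suc k)
  then show ?case by simp
qed

lemma cd_const [simp]: "cd k (\<lambda>x. c)"
proof (induction k arbitrary: c)
  case (Suc k)
  show ?case by (rule cd_SucI[where D="\<lambda>x v. 0"]) (auto simp: Suc)
qed simp

lemma cd_add: "cd k f \<Longrightarrow> cd k g \<Longrightarrow> cd k (\<lambda>x. f x + g x)"
proof (induction k arbitrary: f g)
  case 0
  then show ?case by (auto intro: continuous_intros)
next
  case (Suc k)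
  show ?case
    by (rule cd_SucI[OF has_derivative_add[OF cd_Suc_has_derivative cd_Suc_has_derivative, OF Suc.prems]])
      (use Suc in auto)
qed

lemma cd_mult: "cd k f \<Longrightarrow> cd k g \<Longrightarrow> cd k (\<lambda>x. f x * g x)"
proof (induction k arbitrary: f g)
  case 0
  then show ?case by (auto intro: continuous_intros)
next
  case (Suc k)
  show ?case
    by (rule cd_SucI[OF has_derivative_mult[OF cd_Suc_has_derivative cd_Suc_has_derivative, OF Suc.prems]])
      (use Suc cd_mono[OF Suc.prems(1)] cd_mono[OF Suc.prems(2)] in \<open>auto intro!: cd_add\<close>)
qed

lemma cd_inner: "cd k (\<lambda>x. x \<bullet> a)"
proof (cases k)
  case 0
  then show ?thesis by (auto intro: continuous_intros)
next
  case (Suc j)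
  show ?thesis unfolding Suc
    by (rule cd_SucI[where D="\<lambda>x v. v \<bullet> a"]) (auto intro!: derivative_eq_intros)
qed

lemma cd_affine: "cd k f \<Longrightarrow> cd k (\<lambda>x. f (a + c *\<^sub>R x))"
proof (induction k arbitrary: f)
  case 0
  then show ?case by (auto intro!: continuous_on_compose2[of UNIV f] continuous_intros)
next
  case (Suc k)
  have D: "((\<lambda>x. f (a + c *\<^sub>R x)) has_derivative
      (\<lambda>v. frechet_derivative f (at (a + c *\<^sub>R x)) (c *\<^sub>R v))) (at x)" for x
    by (rule has_derivative_compose[OF _ cd_Suc_has_derivative[OF Suc.prems]])
      (auto intro!: derivative_eq_intros)
  have lin: "frechet_derivative f (at y) (c *\<^sub>R v) = c * frechet_derivative f (at y) v" for y v
    using linear_frechet_derivative[of f "at y"] Suc.prems by (simp add: linear_cmul)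
  show ?case
    by (rule cd_SucI[OF D]) (use Suc in \<open>auto simp: lin intro!: cd_mult\<close>)
qed

text \<open>The derivative of \<open>t\<^sup>-\<^sup>n exp (-1/t)\<close> is a combination of functions of the same form, so this family
  is the seed of all smooth functions with compact support.\<close>

definition flat_exp :: "nat \<Rightarrow> real \<Rightarrow> real" where
  "flat_exp n t = (if t > 0 then (1/t)^n * exp (-(1/t)) else 0)"

lemma flat_exp_tendsto: "((\<lambda>t. flat_exp n t) \<longlongrightarrow> 0) (at 0)"
proof -
  have "((\<lambda>s::real. s^n / exp s) \<longlongrightarrow> 0) at_top" by (rule tendsto_power_div_exp_0)
  then have "((\<lambda>t::real. (inverse t)^n / exp (inverse t)) \<longlongrightarrow> 0) (at_right 0)"
    by (rule filterlim_compose[OF _ filterlim_inverse_at_top_right])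
  then have 1: "((\<lambda>t. flat_exp n t) \<longlongrightarrow> 0) (at_right 0)"
    by (rule Lim_transform_eventually)
      (auto simp: eventually_at_filter flat_exp_def exp_minus field_simps)
  have 2: "((\<lambda>t. flat_exp n t) \<longlongrightarrow> 0) (at_left 0)"
    by (rule Lim_transform_eventually[OF tendsto_const])
      (auto simp: eventually_at_filter flat_exp_def)
  show ?thesis using 1 2 by (simp add: filterlim_split_at)
qed

lemma flat_exp_has_derivative:
  "(flat_exp n has_real_derivative (flat_exp (n+2) t - n * flat_exp (n+1) t)) (at t)"
proof -
  consider "t > 0" | "t < 0" | "t = 0" by linarith
  then show ?thesis
  proof cases
    case 1
    have "((\<lambda>t. (1/t)^n * exp (-(1/t))) has_real_derivative (flat_exp (n+2) t - n * flat_exp (n+1) t)) (at t)"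
    proof -
      have "((\<lambda>t. (1/t)^n * exp (-(1/t))) has_real_derivative
          real n * (1/t)^(n-1) * (-1/t^2) * exp (-(1/t)) + (1/t)^n * (exp (-(1/t)) * (1/t^2))) (at t)"
      proof -
        have i: "((\<lambda>t. 1/t) has_real_derivative (-1/t^2)) (at t)"
          using 1 by (auto intro!: derivative_eq_intros simp: power2_eq_square)
        have "((\<lambda>t. (1/t)^n * exp (-(1/t))) has_real_derivative
          (real n * (-1/t^2 * (1/t)^(n - Suc 0))) * exp (-(1/t)) + (exp (-(1/t)) * (-(-1/t^2))) * (1/t)^n) (at t)"
          by (rule DERIV_mult[OF DERIV_power[OF i] DERIV_chain2[OF DERIV_exp DERIV_minus[OF i]]])
        then show ?thesis by (simp add: algebra_simps)
      qed
      moreover have "real n * (1/t)^(n-1) * (-1/t^2) * exp (-(1/t)) = - (real n * (1/t)^(n+1) * exp (-(1/t)))"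
        by (cases n) (simp_all add: power2_eq_square)
      moreover have "(1/t)^n * (exp (-(1/t)) * (1/t^2)) = (1/t)^(n+2) * exp (-(1/t))"
        by (simp add: power2_eq_square)
      ultimately show ?thesis
        using 1 by (elim DERIV_cong) (simp only: flat_exp_def, simp)
    qed
    then show ?thesis
      by (rule has_field_derivative_transform_within_open[of _ _ _ "{0<..}"])
        (use 1 in \<open>auto simp: flat_exp_def\<close>)
  next
    case 2
    have "((\<lambda>t. 0) has_real_derivative (flat_exp (n+2) t - n * flat_exp (n+1) t)) (at t)"
      using 2 by (auto intro!: derivative_eq_intros simp: flat_exp_def)
    then show ?thesis
      by (rule has_field_derivative_transform_within_open[of _ _ _ "{..<0}"])
        (use 2 in \<open>auto simp: flat_exp_def\<close>)
  next
    case 3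
    \<comment> \<open>For h > 0 the difference quotient of \<open>flat_exp n\<close> at 0 is
      \<open>flat_exp (Suc n) h\<close>, and for h < 0 both vanish, so the limit of the next member
      of the family is the derivative.\<close>
    have "((\<lambda>h. flat_exp (Suc n) h) \<longlongrightarrow> 0) (at 0)" by (rule flat_exp_tendsto)
    then have "((\<lambda>h. (flat_exp n h - flat_exp n 0) / h) \<longlongrightarrow> 0) (at 0)"
      by (rule Lim_transform_eventually)
        (auto simp: eventually_at_filter flat_exp_def field_simps)
    then show ?thesis using 3
      by (simp add: has_field_derivative_iff flat_exp_def)
  qed
qed

text \<open>Differentiation leaves the order n but not the family: the derivative in direction v
  combines the orders n + 1 and n + 2 with the linear factor x \<bullet> v. The induction on k
  therefore keeps n arbitrary.\<close>

lemma cd_bump: "cd k (\<lambda>x. flat_exp n (1 - x \<bullet> x))"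
proof (induction k arbitrary: n)
  case 0
  have "continuous_on UNIV (flat_exp n)"
    by (rule DERIV_continuous_on) (rule has_field_derivative_at_within[OF flat_exp_has_derivative])
  then show ?case
    by (auto intro!: continuous_on_compose2[of UNIV "flat_exp n" UNIV "\<lambda>x. 1 - x \<bullet> x"] continuous_on_diff continuous_on_inner continuous_on_const continuous_on_id)
next
  case (Suc k)
  have D: "((\<lambda>x. flat_exp n (1 - x \<bullet> x)) has_derivative
      (\<lambda>v. (flat_exp (n+2) (1 - x \<bullet> x) + (- real n) * flat_exp (n+1) (1 - x \<bullet> x)) * (- 2 * (x \<bullet> v)))) (at x)"
    for x :: 'a
  proof -
    have 1: "((\<lambda>x. 1 - x \<bullet> x) has_derivative (\<lambda>v. - 2 * (x \<bullet> v))) (at x)"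
      by (rule derivative_eq_intros refl)+ (auto simp: inner_commute)
    have 2: "(flat_exp n has_derivative (\<lambda>h. (flat_exp (n+2) t + (- real n) * flat_exp (n+1) t) * h)) (at t)" for t
      using flat_exp_has_derivative[of n t] by (simp add: has_field_derivative_def)
    show ?thesis using has_derivative_compose[OF 1 2[of "1 - x \<bullet> x"]] by simp
  qed
  show ?case
    by (rule cd_SucI[OF D]) (use Suc in \<open>intro cd_mult cd_add cd_const cd_inner\<close>)
qed

subsection \<open>Gradients\<close>

definition grad :: "('a::euclidean_space \<Rightarrow> real) \<Rightarrow> 'a \<Rightarrow> 'a" where
  "grad f x = (\<Sum>b\<in>Basis. frechet_derivative f (at x) b *\<^sub>R b)"

lemma gradI:
  assumes "(f has_derivative (\<lambda>v. G \<bullet> v)) (at x)"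
  shows "f differentiable (at x)" "grad f x = G"
proof -
  show "f differentiable (at x)" using assms by (auto simp: differentiable_def)
  have "frechet_derivative f (at x) = (\<lambda>v. G \<bullet> v)" using frechet_derivative_at[OF assms] by simp
  then show "grad f x = G" by (simp add: grad_def euclidean_representation)
qed

lemma frechet_derivative_grad:
  assumes "f differentiable (at x)"
  shows "frechet_derivative f (at x) v = grad f x \<bullet> v"
proof -
  have lin: "linear (frechet_derivative f (at x))" by (rule linear_frechet_derivative[OF assms])
  have "frechet_derivative f (at x) v = frechet_derivative f (at x) (\<Sum>b\<in>Basis. (v \<bullet> b) *\<^sub>R b)"
    by (simp add: euclidean_representation)
  also have "\<dots> = (\<Sum>b\<in>Basis. (v \<bullet> b) * frechet_derivative f (at x) b)"
    by (simp add: linear_sum[OF lin] linear_cmul[OF lin])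
  also have "\<dots> = grad f x \<bullet> v"
    by (simp add: grad_def inner_sum_left inner_commute[of v] mult.commute)
  finally show ?thesis .
qed

lemma has_derivative_grad:
  assumes "f differentiable (at x)"
  shows "(f has_derivative (\<lambda>v. grad f x \<bullet> v)) (at x)"
proof -
  have "frechet_derivative f (at x) = (\<lambda>v. grad f x \<bullet> v)"
    using frechet_derivative_grad[OF assms] by blast
  then show ?thesis using assms by (simp add: frechet_derivative_works)
qed

text \<open>Weaker than \<open>Cc_infinity UNIV\<close> on purpose. One continuous derivative is
  enough for integration by parts, and the class is stable under composition with C^1 functions
  vanishing at 0, which the reciprocal in the partition of unity and the truncation require.\<close>

definition C1c :: "('a::euclidean_space \<Rightarrow> real) \<Rightarrow> bool" where
  "C1c f \<longleftrightarrow> (\<forall>x. f differentiable (at x)) \<and> continuous_on UNIV (grad f) \<and> bounded {x. f x \<noteq> 0}"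

lemma C1cI:
  assumes "\<And>x. (f has_derivative (\<lambda>v. G x \<bullet> v)) (at x)" "continuous_on UNIV G" "bounded {x. f x \<noteq> 0}"
  shows "C1c f" "grad f = G"
proof -
  show "grad f = G" using gradI(2)[OF assms(1)] by blast
  then show "C1c f" using assms gradI(1)[OF assms(1)] by (auto simp: C1c_def)
qed

text \<open>The joint form lets each calculus rule below obtain membership and the gradient formula
  from a single derivative computation.\<close>

lemma C1cI_conj:
  assumes "\<And>x. (f has_derivative (\<lambda>v. G x \<bullet> v)) (at x)" "continuous_on UNIV G" "bounded {x. f x \<noteq> 0}"
  shows "C1c f \<and> grad f = G"
  using C1cI[OF assms] by simp

lemma C1c_has_derivative: "C1c f \<Longrightarrow> (f has_derivative (\<lambda>v. grad f x \<bullet> v)) (at x)"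
  by (rule has_derivative_grad) (auto simp: C1c_def)

lemma C1c_frechet: "C1c f \<Longrightarrow> frechet_derivative f (at x) v = grad f x \<bullet> v"
  by (rule frechet_derivative_grad) (auto simp: C1c_def)

lemma C1c_continuous: "C1c f \<Longrightarrow> continuous_on S f"
  by (rule has_derivative_continuous_on) (rule has_derivative_at_withinI[OF C1c_has_derivative])

lemma C1c_continuous_grad: "C1c f \<Longrightarrow> continuous_on S (grad f)"
  unfolding C1c_def using continuous_on_subset by blast

lemma grad_eq_on_open:
  assumes "open S" "x \<in> S" "\<And>y. y \<in> S \<Longrightarrow> f y = g y"
  shows "grad f x = grad g x"
proof -
  have "(f has_derivative D) (at x) \<longleftrightarrow> (g has_derivative D) (at x)" for D
    using assms by (metis has_derivative_transform_within_open)
  then show ?thesis by (simp add: grad_def frechet_derivative_def)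
qed

lemma grad_const [simp]: "grad (\<lambda>x. c) x = 0"
  by (rule gradI) (auto intro!: derivative_eq_intros)

lemma grad_zero_outside:
  assumes "closed K" "\<And>x. x \<notin> K \<Longrightarrow> f x = 0" "x \<notin> K"
  shows "grad f x = 0"
  using grad_eq_on_open[of "- K" x f "\<lambda>_. 0"] assms by auto

lemma C1c_support:
  assumes "C1c f"
  obtains R where "R > 0" "\<And>x. x \<notin> cball 0 R \<Longrightarrow> f x = 0" "\<And>x. x \<notin> cball 0 R \<Longrightarrow> grad f x = 0"
proof -
  have "bounded {x. f x \<noteq> 0}" using assms by (simp add: C1c_def)
  then obtain R where R: "R > 0" "\<And>x. f x \<noteq> 0 \<Longrightarrow> norm x \<le> R"
    unfolding bounded_pos by blast
  then have 1: "\<And>x. x \<notin> cball 0 R \<Longrightarrow> f x = 0" by auto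
  moreover have "\<And>x. x \<notin> cball 0 R \<Longrightarrow> grad f x = 0"
    by (rule grad_zero_outside[where K="cball 0 R" and f=f]) (auto intro: 1)
  ultimately show ?thesis using that R(1) by blast
qed

lemma integrable_continuous_compact_support:
  fixes f :: "'a::euclidean_space \<Rightarrow> 'b::euclidean_space"
  assumes "continuous_on UNIV f" "compact K" "\<And>x. x \<notin> K \<Longrightarrow> f x = 0"
  shows "integrable lborel f"
proof -
  have "integrable lborel (\<lambda>x. indicator K x *\<^sub>R f x)"
    using assms by (intro borel_integrable_compact) (auto intro: continuous_on_subset)
  also have "(\<lambda>x. indicator K x *\<^sub>R f x) = f"
    using assms(3) by (auto simp: indicator_def fun_eq_iff)
  finally show ?thesis .
qed

lemma bounded_continuous_compact_support:
  fixes f :: "'a::euclidean_space \<Rightarrow> 'b::euclidean_space"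
  assumes "continuous_on UNIV f" "compact K" "\<And>x. x \<notin> K \<Longrightarrow> f x = 0"
  obtains B where "B > 0" "\<And>x. norm (f x) \<le> B"
proof -
  have "bounded (f ` K)"
    using assms by (intro compact_imp_bounded compact_continuous_image) (auto intro: continuous_on_subset)
  then obtain B where "B > 0" "\<And>x. x \<in> K \<Longrightarrow> norm (f x) \<le> B" unfolding bounded_pos by auto
  then show ?thesis using assms(3) that[of B] by (metis less_eq_real_def norm_zero)
qed

lemma C1c_integrable: "C1c f \<Longrightarrow> integrable lborel f" "C1c f \<Longrightarrow> integrable lborel (grad f)"
proof -
  assume f: "C1c f"
  then obtain R where "R > 0" "\<And>x. x \<notin> cball 0 R \<Longrightarrow> f x = 0" "\<And>x. x \<notin> cball 0 R \<Longrightarrow> grad f x = 0"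
    using C1c_support by metis
  then show "integrable lborel f" "integrable lborel (grad f)"
    using C1c_continuous[OF f] C1c_continuous_grad[OF f]
    by (auto intro!: integrable_continuous_compact_support[where K="cball 0 R"])
qed

lemma C1c_bounded:
  assumes f: "C1c f"
  obtains B where "B > 0" "\<And>x. \<bar>f x\<bar> \<le> B" "\<And>x. norm (grad f x) \<le> B"
proof -
  obtain R where "R > 0" and R: "\<And>x. x \<notin> cball 0 R \<Longrightarrow> f x = 0" "\<And>x. x \<notin> cball 0 R \<Longrightarrow> grad f x = 0"
    using C1c_support[OF f] by metis
  obtain B1 where "B1 > 0" "\<And>x. norm (f x) \<le> B1"
    using bounded_continuous_compact_support[OF C1c_continuous[OF f] compact_cball R(1)] by blast
  moreover obtain B2 where "B2 > 0" "\<And>x. norm (grad f x) \<le> B2"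
    using bounded_continuous_compact_support[OF C1c_continuous_grad[OF f] compact_cball R(2)] by blast
  ultimately show ?thesis
    using that[of "max B1 B2"] by (auto simp: le_max_iff_disj)
qed

lemma C1c_measurable [measurable_dest]:
  "C1c f \<Longrightarrow> f \<in> borel_measurable borel" "C1c f \<Longrightarrow> grad f \<in> borel_measurable borel"
  by (auto intro: borel_measurable_continuous_onI C1c_continuous C1c_continuous_grad)

lemma C1c_mult:
  assumes f: "C1c f" and g: "C1c g"
  shows "C1c (\<lambda>x. f x * g x)" "grad (\<lambda>x. f x * g x) = (\<lambda>x. f x *\<^sub>R grad g x + g x *\<^sub>R grad f x)"
proof (atomize(full), rule C1cI_conj[where G="\<lambda>x. f x *\<^sub>R grad g x + g x *\<^sub>R grad f x"])
  show "((\<lambda>x. f x * g x) has_derivative (\<lambda>v. (f x *\<^sub>R grad g x + g x *\<^sub>R grad f x) \<bullet> v)) (at x)" for x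
    using has_derivative_mult[OF C1c_has_derivative[OF f] C1c_has_derivative[OF g], of x]
    by (simp add: inner_add_left mult.commute)
  have "bounded {x. f x \<noteq> 0}" using f by (simp add: C1c_def)
  then show "bounded {x. f x * g x \<noteq> 0}" by (rule bounded_subset) auto
qed (intro continuous_intros C1c_continuous C1c_continuous_grad f g)+

lemma C1c_compose:
  fixes \<tau> :: "real \<Rightarrow> real"
  assumes f: "C1c f" and \<tau>: "\<And>t. (\<tau> has_real_derivative \<tau>' t) (at t)" "continuous_on UNIV \<tau>'" "\<tau> 0 = 0"
  shows "C1c (\<lambda>x. \<tau> (f x))" "grad (\<lambda>x. \<tau> (f x)) = (\<lambda>x. \<tau>' (f x) *\<^sub>R grad f x)"
proof (atomize(full), rule C1cI_conj[where G="\<lambda>x. \<tau>' (f x) *\<^sub>R grad f x"])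
  show "((\<lambda>x. \<tau> (f x)) has_derivative (\<lambda>v. (\<tau>' (f x) *\<^sub>R grad f x) \<bullet> v)) (at x)" for x
    using has_derivative_compose[OF C1c_has_derivative[OF f] \<tau>(1)[unfolded has_field_derivative_def], of x]
    by simp
  have "bounded {x. f x \<noteq> 0}" using f by (simp add: C1c_def)
  then show "bounded {x. \<tau> (f x) \<noteq> 0}" by (rule bounded_subset) (auto simp: \<tau>)
qed (intro continuous_intros continuous_on_compose2[OF \<tau>(2)] C1c_continuous C1c_continuous_grad f subset_UNIV)+

lemma C1c_affine:
  assumes f: "C1c f" and c: "c \<noteq> 0"
  shows "C1c (\<lambda>x. f (a + c *\<^sub>R x))" "grad (\<lambda>x. f (a + c *\<^sub>R x)) = (\<lambda>x. c *\<^sub>R grad f (a + c *\<^sub>R x))"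
proof (atomize(full), rule C1cI_conj[where G="\<lambda>x. c *\<^sub>R grad f (a + c *\<^sub>R x)"])
  have 1: "((\<lambda>x. a + c *\<^sub>R x) has_derivative (\<lambda>v. c *\<^sub>R v)) (at x)" for x
    by (auto intro!: derivative_eq_intros)
  show "((\<lambda>x. f (a + c *\<^sub>R x)) has_derivative (\<lambda>v. (c *\<^sub>R grad f (a + c *\<^sub>R x)) \<bullet> v)) (at x)" for x
    using has_derivative_compose[OF 1 C1c_has_derivative[OF f], of x] by simp
  show "continuous_on UNIV (\<lambda>x. c *\<^sub>R grad f (a + c *\<^sub>R x))"
    by (intro continuous_on_scaleR continuous_on_const continuous_on_compose2[OF C1c_continuous_grad[OF f, of UNIV]]
        continuous_on_add continuous_on_id subset_UNIV)
  have "bounded {x. f x \<noteq> 0}" using f by (simp add: C1c_def)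
  then have "bounded ((\<lambda>y. (1/c) *\<^sub>R y) ` ((\<lambda>y. - a + y) ` {x. f x \<noteq> 0}))"
    by (intro bounded_scaling bounded_translation)
  then show "bounded {x. f (a + c *\<^sub>R x) \<noteq> 0}"
  proof (rule bounded_subset, intro subsetI)
    fix x assume "x \<in> {x. f (a + c *\<^sub>R x) \<noteq> 0}"
    moreover have "x = (1/c) *\<^sub>R (- a + (a + c *\<^sub>R x))" using c by simp
    ultimately show "x \<in> (\<lambda>y. (1/c) *\<^sub>R y) ` ((\<lambda>y. - a + y) ` {x. f x \<noteq> 0})" by blast
  qed
qed

text \<open>The gradient is uniformly continuous on \<open>cball 0 (R + 2)\<close>. If one of two
  points at distance below 1 leaves that ball, both lie outside \<open>cball 0 R\<close>, where the
  gradient vanishes; hence \<delta> is independent of x. This uniformity is what permits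
  differentiation under a convolution integral.\<close>

lemma C1c_uniform:
  assumes f: "C1c f" and "\<epsilon> > 0"
  obtains \<delta> where "\<delta> > 0" "\<And>x h. norm h < \<delta> \<Longrightarrow> \<bar>f (x + h) - f x - grad f x \<bullet> h\<bar> \<le> \<epsilon> * norm h"
proof -
  obtain R where "R > 0" "\<And>x. x \<notin> cball 0 R \<Longrightarrow> f x = 0" and R: "\<And>x. x \<notin> cball 0 R \<Longrightarrow> grad f x = 0"
    using C1c_support[OF f] by metis
  have "uniformly_continuous_on (cball 0 (R + 2)) (grad f)"
    by (intro compact_uniformly_continuous C1c_continuous_grad f compact_cball)
  then obtain d where d: "d > 0" "\<And>x y. x \<in> cball 0 (R+2) \<Longrightarrow> y \<in> cball 0 (R+2) \<Longrightarrow> dist x y < d \<Longrightarrow>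
      dist (grad f x) (grad f y) < \<epsilon>"
    using \<open>\<epsilon> > 0\<close> unfolding uniformly_continuous_on_def by metis
  have uc: "norm (grad f y - grad f x) \<le> \<epsilon>" if "dist x y < min d 1" for x y
  proof (cases "x \<in> cball 0 (R+2) \<and> y \<in> cball 0 (R+2)")
    case True
    then show ?thesis using d(2)[of y x] that by (auto simp: dist_norm norm_minus_commute)
  next
    case False
    have "\<bar>norm x - norm y\<bar> < 1" using that norm_triangle_ineq3[of x y] by (simp add: dist_norm)
    then have "x \<notin> cball 0 R" "y \<notin> cball 0 R" using False by auto
    then show ?thesis using R \<open>\<epsilon> > 0\<close> by simp
  qed
  show ?thesis
  proof
    show "min d 1 > 0" using d by simp
    fix x h :: 'a assume h: "norm h < min d 1"
    have "norm (f (x + h) - f x - (\<lambda>v. grad f x \<bullet> v) (x + h - x)) \<le> norm (x + h - x) * \<epsilon>"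
    proof (rule differentiable_bound_linearization[where S="cball x (norm h)" and f'="\<lambda>x v. grad f x \<bullet> v"])
      show "(f has_derivative (\<lambda>v. grad f y \<bullet> v)) (at y within cball x (norm h))" for y
        by (rule has_derivative_at_withinI[OF C1c_has_derivative[OF f]])
      show "x + t *\<^sub>R (x + h - x) \<in> cball x (norm h)" if "t \<in> {0..1}" for t :: real
        using that by (simp add: dist_norm mult_left_le_one_le)
      fix y assume y: "y \<in> cball x (norm h)"
      have n: "norm (grad f y - grad f x) \<le> \<epsilon>" by (rule uc) (use h y in simp)
      show "onorm ((\<lambda>v. grad f y \<bullet> v) - (\<lambda>v. grad f x \<bullet> v)) \<le> \<epsilon>"
      proof (rule onorm_le)
        fix v
        have "norm ((grad f y - grad f x) \<bullet> v) \<le> norm (grad f y - grad f x) * norm v"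
          by (simp add: Cauchy_Schwarz_ineq2)
        also have "\<dots> \<le> \<epsilon> * norm v" using n by (simp add: mult_right_mono)
        finally show "norm (((\<lambda>v. grad f y \<bullet> v) - (\<lambda>v. grad f x \<bullet> v)) v) \<le> \<epsilon> * norm v"
          by (simp add: inner_diff_left)
      qed
    qed auto
    then show "\<bar>f (x + h) - f x - grad f x \<bullet> h\<bar> \<le> \<epsilon> * norm h" by (simp add: mult.commute)
  qed
qed

subsection \<open>Test functions\<close>

lemma Cc_infinityI:
  assumes "\<And>k. cd k \<phi>" "compact K" "K \<subseteq> \<Omega>" "\<And>x. x \<notin> K \<Longrightarrow> \<phi> x = 0"
  shows "\<phi> \<in> Cc_infinity \<Omega>"
proof -
  have "closure {x. \<phi> x \<noteq> 0} \<subseteq> K"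
    using assms by (intro closure_minimal) (auto simp: compact_imp_closed)
  moreover from this have "compact (closure {x. \<phi> x \<noteq> 0})"
    using \<open>compact K\<close> closed_closure compact_Int_closed by (metis inf.absorb_iff2)
  ultimately show ?thesis using assms by (auto simp: Cc_infinity_def)
qed

lemma Cc_infinity_support:
  assumes "\<phi> \<in> Cc_infinity \<Omega>"
  obtains K where "compact K" "K \<subseteq> \<Omega>" "\<And>x. x \<notin> K \<Longrightarrow> \<phi> x = 0" "\<And>x. x \<notin> K \<Longrightarrow> grad \<phi> x = 0"
proof
  let ?K = "closure {x. \<phi> x \<noteq> 0}"
  show "compact ?K" "?K \<subseteq> \<Omega>" using assms by (auto simp: Cc_infinity_def)
  show 1: "\<phi> x = 0" if "x \<notin> ?K" for x using that closure_subset[of "{x. \<phi> x \<noteq> 0}"] by auto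
  show "grad \<phi> x = 0" if "x \<notin> ?K" for x
    using grad_zero_outside[OF closed_closure 1 that] .
qed

lemma Cc_infinity_C1c: 
  assumes "\<phi> \<in> Cc_infinity \<Omega>"
  shows "C1c \<phi>"
  unfolding C1c_def
proof (intro conjI)
  have c: "\<And>k. cd k \<phi>" and k: "compact (closure {x. \<phi> x \<noteq> 0})" using assms by (auto simp: Cc_infinity_def)
  have 1: "cd (Suc 0) \<phi>" using c by blast
  then show "\<forall>x. \<phi> differentiable at x" by simp
  show "continuous_on UNIV (grad \<phi>)" unfolding grad_def[abs_def]
    using 1 by (intro continuous_on_sum continuous_on_scaleR continuous_on_const) auto
  show "bounded {x. \<phi> x \<noteq> 0}"
    using compact_imp_bounded[OF k] closure_subset by (rule bounded_subset)
qed

lemma Cc_infinity_add: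
  assumes "\<phi> \<in> Cc_infinity \<Omega>" "\<eta> \<in> Cc_infinity \<Omega>"
  shows "(\<lambda>x. \<phi> x + \<eta> x) \<in> Cc_infinity \<Omega>"
proof -
  obtain K where K: "compact K" "K \<subseteq> \<Omega>" "\<And>x. x \<notin> K \<Longrightarrow> \<phi> x = 0" using Cc_infinity_support[OF assms(1)] by metis
  obtain L where L: "compact L" "L \<subseteq> \<Omega>" "\<And>x. x \<notin> L \<Longrightarrow> \<eta> x = 0" using Cc_infinity_support[OF assms(2)] by metis
  show ?thesis
    by (rule Cc_infinityI[where K="K \<union> L"]) (use K L assms in \<open>auto simp: Cc_infinity_def intro!: cd_add\<close>)
qed

lemma C1c_add:
  assumes f: "C1c f" and g: "C1c g"
  shows "C1c (\<lambda>x. f x + g x)" "grad (\<lambda>x. f x + g x) = (\<lambda>x. grad f x + grad g x)"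
proof (atomize(full), rule C1cI_conj[where G="\<lambda>x. grad f x + grad g x"])
  show "((\<lambda>x. f x + g x) has_derivative (\<lambda>v. (grad f x + grad g x) \<bullet> v)) (at x)" for x
    using has_derivative_add[OF C1c_has_derivative[OF f] C1c_has_derivative[OF g], of x]
    by (simp add: inner_add_left)
  have "bounded ({x. f x \<noteq> 0} \<union> {x. g x \<noteq> 0})" using f g by (simp add: C1c_def)
  then show "bounded {x. f x + g x \<noteq> 0}" by (rule bounded_subset) auto
qed (intro continuous_intros C1c_continuous_grad f g)+

lemma C1c_zero: "C1c (\<lambda>x. 0)"
  by (rule C1cI[where G="\<lambda>x. 0"]) (auto intro!: derivative_eq_intros)

lemma C1c_sum:
  assumes "finite I" "\<And>i. i \<in> I \<Longrightarrow> C1c (f i)"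
  shows "C1c (\<lambda>x. \<Sum>i\<in>I. f i x) \<and> grad (\<lambda>x. \<Sum>i\<in>I. f i x) = (\<lambda>x. \<Sum>i\<in>I. grad (f i) x)"
  using assms by (induction I rule: finite_induct) (auto simp: C1c_zero C1c_add)

text \<open>The standard mollifier profile exp(-1/(1 - |y|^2)) at y = (x - e)/r, with y expanded as
  an affine expression so that \<open>cd_affine\<close> applies literally.\<close>

definition bump :: "'a::euclidean_space \<Rightarrow> real \<Rightarrow> 'a \<Rightarrow> real" where
  "bump e r x = flat_exp 0 (1 - (- (1/r) *\<^sub>R e + (1/r) *\<^sub>R x) \<bullet> (- (1/r) *\<^sub>R e + (1/r) *\<^sub>R x))"

lemma cd_bump_ball: "cd k (bump e r)"
  unfolding bump_def by (rule cd_affine[OF cd_bump])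

lemma bump_nonneg: "0 \<le> bump e r x"
  by (simp add: bump_def flat_exp_def)

lemma bump_pos_iff:
  assumes "r > 0"
  shows "0 < bump e r x \<longleftrightarrow> x \<in> ball e r"
proof -
  have "- (1/r) *\<^sub>R e + (1/r) *\<^sub>R x = (1/r) *\<^sub>R (x - e)" by (simp add: algebra_simps)
  then have "(- (1/r) *\<^sub>R e + (1/r) *\<^sub>R x) \<bullet> (- (1/r) *\<^sub>R e + (1/r) *\<^sub>R x) = (norm (x - e) / r)\<^sup>2"
    by (simp only: dot_square_norm) (simp add: power_divide)
  then show ?thesis
    using assms by (simp add: bump_def flat_exp_def abs_square_less_1 dist_norm norm_minus_commute)
qed

lemma bump_outside: "r > 0 \<Longrightarrow> x \<notin> ball e r \<Longrightarrow> bump e r x = 0"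
  using bump_pos_iff[of r e x] bump_nonneg[of e r x] by linarith

lemma bump_Cc_infinity: "r > 0 \<Longrightarrow> bump e r \<in> Cc_infinity UNIV"
  by (rule Cc_infinityI[where K="cball e r"]) (auto intro: cd_bump_ball bump_outside)

text \<open>The centre \<open>e\<close> need not be the origin, and the support may avoid the
  origin. Convolution then moves supports in the direction \<open>e\<close>, which is how pieces
  touching the boundary are pushed into the domain.\<close>

definition kernel :: "'a::euclidean_space \<Rightarrow> real \<Rightarrow> ('a \<Rightarrow> real) \<Rightarrow> bool" where
  "kernel e r \<kappa> \<longleftrightarrow> (\<forall>k. cd k \<kappa>) \<and> (\<forall>x. 0 \<le> \<kappa> x) \<and> (\<forall>x. x \<notin> cball e r \<longrightarrow> \<kappa> x = 0) \<and>
     integral\<^sup>L lborel \<kappa> = 1"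

lemma kernel_exists:
  assumes "r > 0"
  obtains \<kappa> where "kernel (e::'a::euclidean_space) r \<kappa>"
proof -
  let ?b = "bump e r" and ?c = "integral\<^sup>L lborel (bump e r)"
  have int: "integrable lborel ?b"
    by (rule C1c_integrable) (rule Cc_infinity_C1c[OF bump_Cc_infinity[OF assms]])
  \<comment> \<open>A zero integral of the nonnegative bump would make the open ball on which it is
    positive a null set.\<close>
  have "?c \<noteq> 0"
  proof
    assume "?c = 0"
    then have "AE x in lborel. ?b x = 0"
      using integral_nonneg_eq_0_iff_AE[OF int] bump_nonneg by auto
    then have "AE x in lborel. x \<notin> ball e r"
      by (rule eventually_mono) (metis bump_pos_iff[OF assms] less_irrefl)
    then have "emeasure lborel (ball e r) = 0"
      by (subst (asm) AE_iff_measurable[of "ball e r"]) auto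
    then have "ball e r \<in> null_sets lebesgue" by (auto simp: null_sets_def emeasure_completion)
    then have "negligible (ball e r)" by (simp add: negligible_iff_null_sets)
    then show False using assms open_not_negligible[of "ball e r"] by auto
  qed
  moreover have "?c \<ge> 0" using bump_nonneg by (intro Bochner_Integration.integral_nonneg)
  ultimately have c: "?c > 0" by simp
  have "kernel e r (\<lambda>x. (1/?c) * ?b x)"
    unfolding kernel_def
  proof (intro conjI allI impI)
    show "cd k (\<lambda>x. (1/?c) * ?b x)" for k by (rule cd_mult[OF cd_const cd_bump_ball])
    show "0 \<le> (1/?c) * ?b x" for x using c bump_nonneg[of e r x] by simp
    show "(1/?c) * ?b x = 0" if "x \<notin> cball e r" for x
      using bump_outside[of r x e] that assms by auto
    show "(LINT x|lborel. (1/?c) * ?b x) = 1" using c by simp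
  qed
  then show ?thesis by (rule that)
qed

subsection \<open>Mollification in \<open>L\<^sup>1\<close>\<close>

lemma nn_integral_lborel_affine:
  fixes f :: "'a::euclidean_space \<Rightarrow> ennreal"
  assumes [measurable]: "f \<in> borel_measurable borel" and c: "c \<noteq> 0"
  shows "(\<integral>\<^sup>+x. f x \<partial>lborel) = ennreal (\<bar>c\<bar> ^ DIM('a)) * (\<integral>\<^sup>+x. f (t + c *\<^sub>R x) \<partial>lborel)"
  by (subst lborel_affine[OF c, of t])
    (simp add: nn_integral_density nn_integral_distr nn_integral_cmult)

lemma integrable_lborel_affine_iff:
  fixes f :: "'a::euclidean_space \<Rightarrow> 'b::euclidean_space"
  assumes [measurable]: "f \<in> borel_measurable borel" and c: "c \<noteq> 0"
  shows "integrable lborel (\<lambda>x. f (t + c *\<^sub>R x)) \<longleftrightarrow> integrable lborel f"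
  using nn_integral_lborel_affine[of "\<lambda>x. ennreal (norm (f x))" c t] c
  by (auto simp: integrable_iff_bounded ennreal_mult_less_top ennreal_eq_0_iff power_le_zero_eq)

lemma integral_lborel_affine:
  fixes f :: "'a::euclidean_space \<Rightarrow> 'b::euclidean_space"
  assumes [measurable]: "f \<in> borel_measurable borel" and c: "c \<noteq> 0"
  shows "integral\<^sup>L lborel f = \<bar>c\<bar> ^ DIM('a) *\<^sub>R (LINT x|lborel. f (t + c *\<^sub>R x))"
  by (subst lborel_affine[OF c, of t])
    (simp add: integral_density integral_distr)

lemma nn_integral_reflect:
  fixes f :: "'a::euclidean_space \<Rightarrow> ennreal"
  assumes "f \<in> borel_measurable borel"
  shows "(\<integral>\<^sup>+y. f (x - y) \<partial>lborel) = (\<integral>\<^sup>+y. f y \<partial>lborel)" "(\<integral>\<^sup>+y. f (y - x) \<partial>lborel) = (\<integral>\<^sup>+y. f y \<partial>lborel)"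
  using nn_integral_lborel_affine[OF assms, of "-1" x] nn_integral_lborel_affine[OF assms, of 1 "-x"] by auto

lemma integral_reflect:
  fixes f :: "'a::euclidean_space \<Rightarrow> 'b::euclidean_space"
  assumes "f \<in> borel_measurable borel"
  shows "(LINT y|lborel. f (x - y)) = integral\<^sup>L lborel f" 
  using integral_lborel_affine[OF assms, of "-1" x] by auto

lemma integrable_reflect_iff:
  fixes f :: "'a::euclidean_space \<Rightarrow> 'b::euclidean_space"
  assumes "f \<in> borel_measurable borel"
  shows "integrable lborel (\<lambda>y. f (x - y)) \<longleftrightarrow> integrable lborel f"
  using integrable_lborel_affine_iff[OF assms, of "-1" x] by auto

section \<open>Convolution as an operator on L^1\<close>

definition conv :: "('a::euclidean_space \<Rightarrow> real) \<Rightarrow> ('a \<Rightarrow> 'b::euclidean_space) \<Rightarrow> 'a \<Rightarrow> 'b" where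
  "conv \<kappa> f x = (LINT y|lborel. \<kappa> (x - y) *\<^sub>R f y)"

lemma conv_eq:
  assumes [measurable]: "\<kappa> \<in> borel_measurable borel" "f \<in> borel_measurable borel"
  shows "conv \<kappa> f x = (LINT z|lborel. \<kappa> z *\<^sub>R f (x - z))"
proof -
  have "(LINT z|lborel. \<kappa> (x - (x - z)) *\<^sub>R f (x - z)) = (LINT y|lborel. \<kappa> (x - y) *\<^sub>R f y)"
    by (rule integral_reflect) measurable
  then show ?thesis by (simp add: conv_def)
qed

lemma conv_measurable [measurable]:
  assumes [measurable]: "\<kappa> \<in> borel_measurable borel" "f \<in> borel_measurable borel"
  shows "conv \<kappa> f \<in> borel_measurable borel"
proof -
  have "(\<lambda>x. LINT y|lborel. \<kappa> (x - y) *\<^sub>R f y) \<in> borel_measurable borel"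
    by (rule lborel.borel_measurable_lebesgue_integral) measurable
  then show ?thesis by (simp add: conv_def[abs_def])
qed

lemma integrable_bounded_mult:
  fixes f :: "'a::euclidean_space \<Rightarrow> 'b::euclidean_space"
  assumes f: "integrable lborel f" and [measurable]: "\<kappa> \<in> borel_measurable borel" and B: "\<And>x. \<bar>\<kappa> x\<bar> \<le> B"
  shows "integrable lborel (\<lambda>y. \<kappa> y *\<^sub>R f y)"
proof (rule Bochner_Integration.integrable_bound)
  show "integrable lborel (\<lambda>y. B *\<^sub>R f y)" using f by simp
  have [measurable]: "f \<in> borel_measurable borel" using f by auto
  show "(\<lambda>y. \<kappa> y *\<^sub>R f y) \<in> borel_measurable lborel" by measurable
  have "B \<ge> 0" using B[of 0] by linarith
  then show "AE x in lborel. norm (\<kappa> x *\<^sub>R f x) \<le> norm (B *\<^sub>R f x)"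
    using B by (auto intro!: mult_right_mono)
qed

lemma norm_conv_le:
  fixes f :: "'a::euclidean_space \<Rightarrow> 'b::euclidean_space"
  assumes [measurable]: "\<kappa> \<in> borel_measurable borel" "f \<in> borel_measurable borel"
  shows "ennreal (norm (conv \<kappa> f x)) \<le> (\<integral>\<^sup>+y. ennreal \<bar>\<kappa> (x - y)\<bar> * ennreal (norm (f y)) \<partial>lborel)"
proof (cases "integrable lborel (\<lambda>y. \<kappa> (x - y) *\<^sub>R f y)")
  case True
  have "ennreal (norm (conv \<kappa> f x)) \<le> (\<integral>\<^sup>+y. ennreal (norm (\<kappa> (x - y) *\<^sub>R f y)) \<partial>lborel)"
    unfolding conv_def by (rule integral_norm_bound_ennreal[OF True])
  then show ?thesis by (simp add: ennreal_mult)
next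
  \<comment> \<open>Without integrability \<open>conv\<close> takes the default value 0 of the
    Bochner integral, and the bound is trivial.\<close>
  case False
  then show ?thesis by (simp add: conv_def not_integrable_integral_eq)
qed

text \<open>Young's inequality for L^1, by Tonelli and translation invariance. Both sides may be
  infinite, so no integrability has to be known beforehand.\<close>

lemma nn_integral_conv_le:
  fixes f :: "'a::euclidean_space \<Rightarrow> 'b::euclidean_space"
  assumes [measurable]: "\<kappa> \<in> borel_measurable borel" "f \<in> borel_measurable borel"
  shows "(\<integral>\<^sup>+x. ennreal (norm (conv \<kappa> f x)) \<partial>lborel) \<le>
    (\<integral>\<^sup>+z. ennreal \<bar>\<kappa> z\<bar> \<partial>lborel) * (\<integral>\<^sup>+y. ennreal (norm (f y)) \<partial>lborel)"
proof -
  have "(\<integral>\<^sup>+x. ennreal (norm (conv \<kappa> f x)) \<partial>lborel) \<le>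
      (\<integral>\<^sup>+x. (\<integral>\<^sup>+y. ennreal \<bar>\<kappa> (x - y)\<bar> * ennreal (norm (f y)) \<partial>lborel) \<partial>lborel)"
    by (intro nn_integral_mono norm_conv_le) measurable
  also have "\<dots> = (\<integral>\<^sup>+y. (\<integral>\<^sup>+x. ennreal \<bar>\<kappa> (x - y)\<bar> * ennreal (norm (f y)) \<partial>lborel) \<partial>lborel)"
    by (rule lborel_pair.Fubini'[symmetric]) measurable
  also have "\<dots> = (\<integral>\<^sup>+y. (\<integral>\<^sup>+z. ennreal \<bar>\<kappa> z\<bar> \<partial>lborel) * ennreal (norm (f y)) \<partial>lborel)"
  proof (rule nn_integral_cong)
    fix y :: 'a
    have "(\<integral>\<^sup>+x. ennreal \<bar>\<kappa> (x - y)\<bar> * ennreal (norm (f y)) \<partial>lborel) =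
        (\<integral>\<^sup>+x. ennreal \<bar>\<kappa> (x - y)\<bar> \<partial>lborel) * ennreal (norm (f y))"
      by (rule nn_integral_multc) measurable
    then show "(\<integral>\<^sup>+x. ennreal \<bar>\<kappa> (x - y)\<bar> * ennreal (norm (f y)) \<partial>lborel) = (\<integral>\<^sup>+z. ennreal \<bar>\<kappa> z\<bar> \<partial>lborel) * ennreal (norm (f y))"
      using nn_integral_reflect(2)[of "\<lambda>z. ennreal \<bar>\<kappa> z\<bar>" y] by simp
  qed
  also have "\<dots> = (\<integral>\<^sup>+z. ennreal \<bar>\<kappa> z\<bar> \<partial>lborel) * (\<integral>\<^sup>+y. ennreal (norm (f y)) \<partial>lborel)"
    by (rule nn_integral_cmult) measurable
  finally show ?thesis .
qed

lemma conv_diff: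
  assumes "integrable lborel f" "integrable lborel g"
    and [measurable]: "\<kappa> \<in> borel_measurable borel" and "\<And>x. \<bar>\<kappa> x\<bar> \<le> B"
  shows "conv \<kappa> (\<lambda>x. f x - g x) x = conv \<kappa> f x - conv \<kappa> g x"
proof -
  have "integrable lborel (\<lambda>y. \<kappa> (x - y) *\<^sub>R f y)" "integrable lborel (\<lambda>y. \<kappa> (x - y) *\<^sub>R g y)"
    by (rule integrable_bounded_mult[where B=B]; (rule assms)?; measurable; simp add: assms)+
  then show ?thesis by (simp add: conv_def scaleR_diff_right)
qed

section \<open>Density of continuous functions with bounded support in L^1\<close>

abbreviation L1d :: "('a::euclidean_space \<Rightarrow> 'b::euclidean_space) \<Rightarrow> ('a \<Rightarrow> 'b) \<Rightarrow> ennreal" where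
  "L1d f g \<equiv> (\<integral>\<^sup>+x. ennreal (norm (f x - g x)) \<partial>lborel)"

lemma L1d_triangle:
  assumes [measurable]: "f \<in> borel_measurable borel" "g \<in> borel_measurable borel" "h \<in> borel_measurable borel"
  shows "L1d f h \<le> L1d f g + L1d g h"
proof -
  have "L1d f h \<le> (\<integral>\<^sup>+x. ennreal (norm (f x - g x)) + ennreal (norm (g x - h x)) \<partial>lborel)"
    by (intro nn_integral_mono)
      (simp add: dist_norm[symmetric] dist_triangle flip: ennreal_plus)
  also have "\<dots> = L1d f g + L1d g h" by (rule nn_integral_add) measurable
  finally show ?thesis .
qed

lemma L1d_commute: "L1d f g = L1d g f"
  by (simp add: norm_minus_commute)

definition L1_approx :: "('a::euclidean_space \<Rightarrow> 'b::euclidean_space) \<Rightarrow> bool" where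
  "L1_approx f \<longleftrightarrow> (\<forall>\<epsilon>>0. \<exists>g R. continuous_on UNIV g \<and> (\<forall>x. x \<notin> cball 0 R \<longrightarrow> g x = 0) \<and> L1d f g < ennreal \<epsilon>)"

lemma ennreal_add_less:
  assumes "a < ennreal x" "b < ennreal y" "0 \<le> x" "0 \<le> y"
  shows "a + b < ennreal (x + y)"
proof -
  obtain a' b' where "a = ennreal a'" "0 \<le> a'" "b = ennreal b'" "0 \<le> b'"
    using assms by (metis ennreal_cases ennreal_less_top less_irrefl less_trans)
  then show ?thesis using assms by (simp add: ennreal_less_iff flip: ennreal_plus)
qed

lemma L1_approx_close:
  fixes f :: "'a::euclidean_space \<Rightarrow> 'b::euclidean_space"
  assumes f [measurable]: "f \<in> borel_measurable borel"
    and "\<And>\<epsilon>. \<epsilon> > 0 \<Longrightarrow> \<exists>h. h \<in> borel_measurable borel \<and> L1_approx h \<and> L1d f h < ennreal \<epsilon>"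
  shows "L1_approx f"
  unfolding L1_approx_def
proof (intro allI impI)
  fix \<epsilon> :: real assume e: "\<epsilon> > 0"
  obtain h where h [measurable]: "h \<in> borel_measurable borel" and "L1_approx h" and 1: "L1d f h < ennreal (\<epsilon>/2)"
    using assms(2)[of "\<epsilon>/2"] e by auto
  then obtain g R where g: "continuous_on UNIV g" "\<forall>x. x \<notin> cball 0 R \<longrightarrow> g x = 0" and 2: "L1d h g < ennreal (\<epsilon>/2)"
    using e unfolding L1_approx_def by (metis half_gt_zero)
  have [measurable]: "g \<in> borel_measurable borel" by (rule borel_measurable_continuous_onI[OF g(1)])
  have "L1d f g \<le> L1d f h + L1d h g" by (rule L1d_triangle) measurable
  also have "\<dots> < ennreal (\<epsilon>/2 + \<epsilon>/2)" by (rule ennreal_add_less[OF 1 2]) (use e in auto)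
  finally show "\<exists>g R. continuous_on UNIV g \<and> (\<forall>x. x \<notin> cball 0 R \<longrightarrow> g x = 0) \<and> L1d f g < ennreal \<epsilon>"
    using g by auto
qed

lemma nn_integral_const_indicator:
  fixes c :: real
  assumes "A \<in> sets borel" "c \<ge> 0"
  shows "(\<integral>\<^sup>+x. ennreal (c * indicator A x) \<partial>lborel) = ennreal c * emeasure lborel A"
proof -
  have "(\<integral>\<^sup>+x. ennreal (c * indicator A x) \<partial>lborel) = (\<integral>\<^sup>+x. ennreal c * indicator A x \<partial>lborel)"
    by (intro nn_integral_cong) (auto simp: indicator_def)
  also have "\<dots> = ennreal c * emeasure lborel A" using assms by (intro nn_integral_cmult_indicator) simp
  finally show ?thesis .
qed

lemma L1_approx_limit:
  fixes f :: "'a::euclidean_space \<Rightarrow> 'b::euclidean_space"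
  assumes [measurable]: "f \<in> borel_measurable borel" "\<And>i. s i \<in> borel_measurable borel" "w \<in> borel_measurable borel"
    and s: "\<And>i. L1_approx (s i)" and lim: "\<And>x. (\<lambda>i. s i x) \<longlonglongrightarrow> f x"
    and w: "\<And>i x. norm (s i x) \<le> w x" "(\<integral>\<^sup>+x. ennreal (w x) \<partial>lborel) < \<infinity>"
  shows "L1_approx f"
proof (rule L1_approx_close)
  fix \<epsilon> :: real assume e: "\<epsilon> > 0"
  have "(\<lambda>i. \<integral>\<^sup>+x. ennreal (norm (f x - s i x)) \<partial>lborel) \<longlonglongrightarrow> 0"
    by (rule nn_integral_dominated_convergence_norm[where w=w]) (use lim w in auto)
  then have "eventually (\<lambda>i. L1d f (s i) < ennreal \<epsilon>) sequentially"
    by (rule order_tendstoD) (use e in simp)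
  then show "\<exists>h. h \<in> borel_measurable borel \<and> L1_approx h \<and> L1d f h < ennreal \<epsilon>"
    using s assms(2) unfolding eventually_sequentially by blast
qed measurable

text \<open>The tents max(0, 1 - n dist(x, K)) decrease to the indicator of K, and for n at least 1
  all of them vanish outside the unit neighbourhood of K, so dominated convergence applies.\<close>

lemma L1_dense_compact:
  fixes K :: "'a::euclidean_space set" and c :: "'b::euclidean_space"
  assumes K: "compact K"
  shows "L1_approx (\<lambda>x. indicator K x *\<^sub>R c)"
proof (cases "K = {}")
  case True
  have "continuous_on UNIV (\<lambda>x::'a. 0::'b)" by simp
  then show ?thesis using True by (auto simp: L1_approx_def intro!: exI[of _ "\<lambda>x. 0"])
next
  case False
  define f where "f n x = max 0 (1 - real n * infdist x K)" for n x
  have cf: "continuous_on UNIV (f n)" for n unfolding f_def by (intro continuous_intros)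
  obtain R where R: "K \<subseteq> cball 0 R" using compact_imp_bounded[OF K] bounded_subset_ballD[of K 0] ball_subset_cball by blast
  have supp: "f n x = 0" if "n > 0" "x \<notin> cball 0 (R + 1)" for n x
  proof -
    have "1 \<le> infdist x K"
    proof (rule cINF_greatest[where A=K and f="dist x" and m=1, folded infdist_notempty[OF False]])
      fix a assume "a \<in> K"
      then show "1 \<le> dist x a" using R that(2) norm_triangle_ineq2[of x a] by (auto simp: dist_norm subset_iff)
    qed (use False in auto)
    then have "1 \<le> real n * infdist x K" using \<open>n > 0\<close> by (metis One_nat_def Suc_leI mult_mono' mult_1 of_nat_1 of_nat_mono zero_le_one)
    then show ?thesis by (simp add: f_def)
  qed
  have f01: "0 \<le> f n x" "f n x \<le> 1" for n x by (auto simp: f_def infdist_nonneg)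
  have lim: "(\<lambda>n. f n x) \<longlonglongrightarrow> indicator K x" for x
  proof (cases "x \<in> K")
    case True then show ?thesis by (simp add: f_def)
  next
    case False
    then have pos: "infdist x K > 0"
      using in_closed_iff_infdist_zero[OF compact_imp_closed[OF K] \<open>K \<noteq> {}\<close>, of x] infdist_nonneg[of x K] by linarith
    obtain N where N: "1 < real N * infdist x K" using reals_Archimedean3[OF pos] by blast
    have "f n x = 0" if "n \<ge> N" for n
    proof -
      have "real N * infdist x K \<le> real n * infdist x K" using that pos by simp
      then show ?thesis using N by (simp add: f_def)
    qed
    then have "eventually (\<lambda>n. f n x = 0) sequentially" unfolding eventually_sequentially by blast
    then show ?thesis using False by (simp add: tendsto_eventually)
  qed
  have Kb [measurable]: "K \<in> sets borel" using compact_imp_closed[OF K] by simp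
  have [measurable]: "cball (0::'a) (R + 1) \<in> sets borel" by simp
  have fm [measurable]: "f n \<in> borel_measurable borel" for n by (rule borel_measurable_continuous_onI[OF cf])
  show ?thesis
  \<comment> \<open>The index is shifted because the tent for n = 0 is the constant 1, which has no
    bounded support.\<close>
  proof (rule L1_approx_limit[where s="\<lambda>n x. f (Suc n) x *\<^sub>R c" and w="\<lambda>x. norm c * indicator (cball 0 (R + 1)) x"])
    show "(\<integral>\<^sup>+x. ennreal (norm c * indicator (cball (0::'a) (R + 1)) x) \<partial>lborel) < \<infinity>"
      using emeasure_lborel_cball_finite[of "0::'a" "R+1"]
      by (subst nn_integral_const_indicator) (auto simp: ennreal_mult_less_top)
    show "norm (f (Suc j) x *\<^sub>R c) \<le> norm c * indicator (cball 0 (R + 1)) x" for j x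
      using f01[of "Suc j" x] supp[of "Suc j" x]
      by (cases "x \<in> cball 0 (R+1)") (auto simp: mult_left_le_one_le)
    show "(\<lambda>i. f (Suc i) x *\<^sub>R c) \<longlonglongrightarrow> indicator K x *\<^sub>R c" for x
      using lim[THEN LIMSEQ_Suc] by (intro tendsto_intros)
    show "L1_approx (\<lambda>x. f (Suc i) x *\<^sub>R c)" for i
      unfolding L1_approx_def
    proof (intro allI impI exI conjI)
      show "continuous_on UNIV (\<lambda>x. f (Suc i) x *\<^sub>R c)" by (intro continuous_intros cf)
      show "f (Suc i) x *\<^sub>R c = 0" if "x \<notin> cball 0 (R+1)" for x using supp[OF _ that, of "Suc i"] by simp
    qed simp
  qed measurable
qed

text \<open>Inner regularity reduces a Borel set of finite measure to a closed subset, and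
  intersecting with balls reduces a closed set to compact ones; the remaining cases of the induction
  are stability under sums and dominated limits.\<close>

lemma L1_dense:
  fixes f :: "'a::euclidean_space \<Rightarrow> 'b::euclidean_space"
  assumes "integrable lborel f" 
  shows "L1_approx f"
  using assms
proof (induction rule: integrable_induct)
  case (base A c)
  have [measurable]: "A \<in> sets borel" using base by simp
  have closed: "L1_approx (\<lambda>x. indicator T x *\<^sub>R c)" if T: "closed T" "emeasure lborel T < \<infinity>" for T :: "'a set"
  proof (rule L1_approx_limit[where s="\<lambda>n x. indicator (T \<inter> cball 0 (real n)) x *\<^sub>R c" and w="\<lambda>x. norm c * indicator T x"])
    have [measurable]: "T \<in> sets borel" using T by simp
    show "(\<lambda>x. indicator T x *\<^sub>R c) \<in> borel_measurable borel"
      "(\<lambda>x. indicator (T \<inter> cball 0 (real n)) x *\<^sub>R c) \<in> borel_measurable borel" 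
      "(\<lambda>x. norm c * indicator T x) \<in> borel_measurable borel" for n
      by (intro borel_measurable_scaleR borel_measurable_times borel_measurable_indicator borel_measurable_const; simp)+
    show "L1_approx (\<lambda>x. indicator (T \<inter> cball 0 (real n)) x *\<^sub>R c)" for n
      by (intro L1_dense_compact closed_Int_compact T compact_cball)
    show "(\<integral>\<^sup>+x. ennreal (norm c * indicator T x) \<partial>lborel) < \<infinity>"
      using T by (subst nn_integral_const_indicator) (auto simp: ennreal_mult_less_top)
    show "norm (indicator (T \<inter> cball 0 (real n)) x *\<^sub>R c) \<le> norm c * indicator T x" for n x
      by (auto simp: indicator_def)
    show "(\<lambda>n. indicator (T \<inter> cball 0 (real n)) x *\<^sub>R c) \<longlonglongrightarrow> indicator T x *\<^sub>R c" for x
    proof (rule tendsto_eventually)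
      obtain N where "norm x \<le> real N" using real_arch_simple by blast
      then have "indicator (T \<inter> cball 0 (real n)) x *\<^sub>R c = indicator T x *\<^sub>R c" if "n \<ge> N" for n
        using that by (auto simp: indicator_def)
      then show "\<forall>\<^sub>F n in sequentially. indicator (T \<inter> cball 0 (real n)) x *\<^sub>R c = indicator T x *\<^sub>R c"
        unfolding eventually_sequentially by blast
    qed
  qed
  show ?case
  proof (rule L1_approx_close)
    fix \<epsilon> :: real assume "\<epsilon> > 0"
    \<comment> \<open>The denominator norm c + 1 instead of norm c covers c = 0.\<close>
    define \<delta> where "\<delta> = \<epsilon> / (norm c + 1)"
    have "\<delta> > 0" using \<open>\<epsilon> > 0\<close> by (simp add: \<delta>_def add_nonneg_pos)
    have "A \<in> sets lebesgue" using base by (simp add: sets_completionI_sets)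
    from sets_lebesgue_inner_closed[OF this \<open>\<delta> > 0\<close>]
    obtain T where T: "closed T" "T \<subseteq> A" "emeasure lebesgue (A - T) < ennreal \<delta>" .
    have [measurable]: "T \<in> sets borel" using T by simp
    have "emeasure lborel T \<le> emeasure lborel A" using T(2) by (intro emeasure_mono) auto
    then have "L1_approx (\<lambda>x. indicator T x *\<^sub>R c)" using T(1) base(2) by (intro closed) (auto simp: less_top top_unique)
    moreover have "L1d (\<lambda>x. indicator A x *\<^sub>R c) (\<lambda>x. indicator T x *\<^sub>R c) < ennreal \<epsilon>"
    proof -
      have "L1d (\<lambda>x. indicator A x *\<^sub>R c) (\<lambda>x. indicator T x *\<^sub>R c) = (\<integral>\<^sup>+x. ennreal (norm c) * indicator (A - T) x \<partial>lborel)"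
        using T(2) by (intro nn_integral_cong) (auto simp: indicator_def)
      also have "\<dots> = ennreal (norm c) * emeasure lborel (A - T)" by (subst nn_integral_cmult_indicator) auto
      also have "\<dots> \<le> ennreal (norm c) * ennreal \<delta>" using T(3) by (intro mult_left_mono) auto
      also have "\<dots> = ennreal (norm c * \<delta>)" using \<open>\<delta> > 0\<close> by (simp add: ennreal_mult'')
      also have "\<dots> < ennreal \<epsilon>"
      proof (rule ennreal_lessI[OF \<open>\<epsilon> > 0\<close>])
        have "\<delta> * (norm c + 1) = \<epsilon>" using norm_ge_zero[of c] by (simp add: \<delta>_def add_nonneg_eq_0_iff)
        then show "norm c * \<delta> < \<epsilon>" using \<open>\<delta> > 0\<close> by (simp add: algebra_simps)
      qed
      finally show ?thesis .
    qed
    ultimately show "\<exists>h. h \<in> borel_measurable borel \<and> L1_approx h \<and> L1d (\<lambda>x. indicator A x *\<^sub>R c) h < ennreal \<epsilon>"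
      by (intro exI[of _ "\<lambda>x. indicator T x *\<^sub>R c"]) auto
  qed measurable
next
  case (add f1 f2)
  have [measurable]: "f1 \<in> borel_measurable borel" "f2 \<in> borel_measurable borel" using add.hyps by auto
  show ?case unfolding L1_approx_def
  proof (intro allI impI)
    fix \<epsilon> :: real assume e: "\<epsilon> > 0"
    obtain g1 R1 where g1: "continuous_on UNIV g1" "\<forall>x. x \<notin> cball 0 R1 \<longrightarrow> g1 x = 0" "L1d f1 g1 < ennreal (\<epsilon>/2)"
      using add.IH(1) e unfolding L1_approx_def by (metis half_gt_zero)
    obtain g2 R2 where g2: "continuous_on UNIV g2" "\<forall>x. x \<notin> cball 0 R2 \<longrightarrow> g2 x = 0" "L1d f2 g2 < ennreal (\<epsilon>/2)"
      using add.IH(2) e unfolding L1_approx_def by (metis half_gt_zero)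
    have [measurable]: "g1 \<in> borel_measurable borel" "g2 \<in> borel_measurable borel"
      using g1 g2 by (auto intro: borel_measurable_continuous_onI)
    have "L1d (\<lambda>x. f1 x + f2 x) (\<lambda>x. g1 x + g2 x) \<le> (\<integral>\<^sup>+x. ennreal (norm (f1 x - g1 x)) + ennreal (norm (f2 x - g2 x)) \<partial>lborel)"
      by (intro nn_integral_mono) (simp add: norm_diff_triangle_ineq flip: ennreal_plus)
    also have "\<dots> = L1d f1 g1 + L1d f2 g2" by (rule nn_integral_add) measurable
    also have "\<dots> < ennreal (\<epsilon>/2 + \<epsilon>/2)" by (rule ennreal_add_less[OF g1(3) g2(3)]) (use e in auto)
    finally have "L1d (\<lambda>x. f1 x + f2 x) (\<lambda>x. g1 x + g2 x) < ennreal \<epsilon>" by simp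
    moreover have "continuous_on UNIV (\<lambda>x. g1 x + g2 x)" by (intro continuous_intros g1 g2)
    moreover have "\<forall>x. x \<notin> cball 0 (max R1 R2) \<longrightarrow> g1 x + g2 x = 0" using g1(2) g2(2) by auto
    ultimately show "\<exists>g R. continuous_on UNIV g \<and> (\<forall>x. x \<notin> cball 0 R \<longrightarrow> g x = 0) \<and> L1d (\<lambda>x. f1 x + f2 x) g < ennreal \<epsilon>"
      by blast
  qed
next
  case (lim f s)
  have [measurable]: "f \<in> borel_measurable borel" "s i \<in> borel_measurable borel" for i using lim.hyps by auto
  show ?case
  proof (rule L1_approx_limit[where s=s and w="\<lambda>x. norm (2 *\<^sub>R f x)"])
    have "integrable lborel (\<lambda>x. 2 *\<^sub>R f x)" using lim.hyps by simp
    then show "(\<integral>\<^sup>+x. ennreal (norm (2 *\<^sub>R f x)) \<partial>lborel) < \<infinity>" unfolding integrable_iff_bounded by simp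
  qed (use lim in auto)
qed

section \<open>Kernels as approximate identities\<close>

lemma kernelD:
  assumes "kernel e r \<kappa>"
  shows kernel_Cc: "\<kappa> \<in> Cc_infinity UNIV" and kernel_C1c: "C1c \<kappa>"
    and kernel_integral: "integral\<^sup>L lborel \<kappa> = 1"
    and kernel_nonneg: "\<And>x. 0 \<le> \<kappa> x"
    and kernel_support: "\<And>x. x \<notin> cball e r \<Longrightarrow> \<kappa> x = 0"
proof -
  show s: "\<And>x. x \<notin> cball e r \<Longrightarrow> \<kappa> x = 0" "\<And>x. 0 \<le> \<kappa> x" "integral\<^sup>L lborel \<kappa> = 1"
    using assms by (auto simp: kernel_def)
  show "\<kappa> \<in> Cc_infinity UNIV"
    by (rule Cc_infinityI[where K="cball e r"]) (use assms s in \<open>auto simp: kernel_def\<close>)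
  then show "C1c \<kappa>" by (rule Cc_infinity_C1c)
qed

lemma kernel_nn_integral: 
  assumes "kernel e r \<kappa>"
  shows "(\<integral>\<^sup>+z. ennreal \<bar>\<kappa> z\<bar> \<partial>lborel) = 1"
proof -
  have "(\<integral>\<^sup>+z. ennreal \<bar>\<kappa> z\<bar> \<partial>lborel) = (\<integral>\<^sup>+z. ennreal (\<kappa> z) \<partial>lborel)"
    using kernel_nonneg[OF assms] by simp
  also have "\<dots> = ennreal (integral\<^sup>L lborel \<kappa>)"
    using kernel_nonneg[OF assms] C1c_integrable(1)[OF kernel_C1c[OF assms]]
    by (intro nn_integral_eq_integral) auto
  finally show ?thesis using kernel_integral[OF assms] by simp
qed

lemma conv_near:
  fixes g :: "'a::euclidean_space \<Rightarrow> 'b::euclidean_space"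
  assumes \<kappa>: "kernel e r \<kappa>" and g: "continuous_on UNIV g"
    and d: "\<And>z. \<kappa> z \<noteq> 0 \<Longrightarrow> norm z < \<delta>" "\<And>z. norm z < \<delta> \<Longrightarrow> norm (g (x - z) - g x) \<le> \<eta>"
  shows "norm (conv \<kappa> g x - g x) \<le> \<eta>"
proof -
  note [measurable] = C1c_measurable[OF kernel_C1c[OF \<kappa>]] borel_measurable_continuous_onI[OF g]
  have c\<kappa>: "continuous_on UNIV \<kappa>" by (rule C1c_continuous[OF kernel_C1c[OF \<kappa>]])
  have cg: "continuous_on UNIV (\<lambda>z. g (x - z))"
    by (intro continuous_on_compose2[OF g] continuous_intros) auto
  have i1: "integrable lborel (\<lambda>z. \<kappa> z *\<^sub>R g (x - z))" "integrable lborel (\<lambda>z. \<kappa> z *\<^sub>R g x)"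
    "integrable lborel (\<lambda>z. \<kappa> z * \<eta>)" 
  proof -
    have *: "integrable lborel (\<lambda>z. \<kappa> z *\<^sub>R h z)" if "continuous_on UNIV h" for h :: "'a \<Rightarrow> 'b"
      by (rule integrable_continuous_compact_support[OF _ compact_cball[of e r]])
        (use that c\<kappa> in \<open>auto intro: continuous_on_scaleR simp: kernel_support[OF \<kappa>]\<close>)
    show "integrable lborel (\<lambda>z. \<kappa> z *\<^sub>R g (x - z))" by (rule *[OF cg])
    show "integrable lborel (\<lambda>z. \<kappa> z *\<^sub>R g x)" by (rule *) simp
    show "integrable lborel (\<lambda>z. \<kappa> z * \<eta>)" using C1c_integrable(1)[OF kernel_C1c[OF \<kappa>]] by simp
  qed
  have "conv \<kappa> g x - g x = (LINT z|lborel. \<kappa> z *\<^sub>R g (x - z)) - (LINT z|lborel. \<kappa> z *\<^sub>R g x)"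
    using kernel_integral[OF \<kappa>] C1c_integrable(1)[OF kernel_C1c[OF \<kappa>]] by (simp add: conv_eq)
  also have "\<dots> = (LINT z|lborel. \<kappa> z *\<^sub>R (g (x - z) - g x))"
    using i1 by (simp add: scaleR_diff_right)
  also have "norm \<dots> \<le> (LINT z|lborel. norm (\<kappa> z *\<^sub>R (g (x - z) - g x)))"
    by (rule integral_norm_bound)
  also have "\<dots> \<le> (LINT z|lborel. \<kappa> z * \<eta>)"
  proof (rule integral_mono)
    show "integrable lborel (\<lambda>z. norm (\<kappa> z *\<^sub>R (g (x - z) - g x)))"
      using i1 by (intro integrable_norm) (simp add: scaleR_diff_right)
    show "norm (\<kappa> z *\<^sub>R (g (x - z) - g x)) \<le> \<kappa> z * \<eta>" for z
      using d(1)[of z] d(2)[of z] kernel_nonneg[OF \<kappa>, of z] by (cases "\<kappa> z = 0") (auto intro: mult_left_mono)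
  qed (rule i1)
  also have "\<dots> = \<eta>" using kernel_integral[OF \<kappa>] by simp
  finally show ?thesis .
qed

lemma conv_zero:
  assumes "\<And>z. \<kappa> z \<noteq> 0 \<Longrightarrow> g (x - z) = 0"
  shows "conv \<kappa> g x = 0"
proof -
  have "\<kappa> (x - y) *\<^sub>R g y = 0" for y using assms[of "x - y"] by auto
  then show ?thesis unfolding conv_def by (simp only: integral_zero)
qed

text \<open>A kernel living inside the unit ball enlarges the support of \<open>g\<close> by at most
  1, so the uniform error \<eta> from uniform continuity is integrated over a ball of finite measure
  m only. This dictates \<eta> = \<epsilon> / (m + 1).\<close>

lemma mollify_continuous:
  fixes g :: "'a::euclidean_space \<Rightarrow> 'b::euclidean_space"
  assumes g: "continuous_on UNIV g" and R: "\<And>x. x \<notin> cball 0 R \<Longrightarrow> g x = 0" and \<epsilon>: "\<epsilon> > 0"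
  shows "\<exists>\<delta>>0. \<forall>e r \<kappa>. kernel e r \<kappa> \<and> (\<forall>z. \<kappa> z \<noteq> 0 \<longrightarrow> norm z < \<delta>) \<longrightarrow> L1d (conv \<kappa> g) g < ennreal \<epsilon>"
proof -
  have [measurable]: "g \<in> borel_measurable borel" by (rule borel_measurable_continuous_onI[OF g])
  let ?B = "cball (0::'a) (R + 1)"
  have [measurable]: "?B \<in> sets borel" by simp
  define m where "m = measure lborel ?B"
  have em: "emeasure lborel ?B = ennreal m"
    unfolding m_def using emeasure_lborel_cball_finite[of "0::'a" "R+1"] by (intro emeasure_eq_ennreal_measure) auto
  have m: "m \<ge> 0" by (simp add: m_def)
  define \<eta> where "\<eta> = \<epsilon> / (m + 1)"
  have \<eta>: "\<eta> > 0" using \<epsilon> m by (simp add: \<eta>_def)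
  have \<eta>m: "\<eta> * m < \<epsilon>"
  proof -
    have "\<eta> * (m + 1) = \<epsilon>" using m by (simp add: \<eta>_def)
    then show ?thesis using \<eta> by (simp add: algebra_simps)
  qed
  have "uniformly_continuous_on (cball 0 (R + 2)) g"
    by (intro compact_uniformly_continuous continuous_on_subset[OF g] compact_cball subset_UNIV)
  then obtain d where d: "d > 0" "\<And>x y. x \<in> cball 0 (R+2) \<Longrightarrow> y \<in> cball 0 (R+2) \<Longrightarrow> dist x y < d \<Longrightarrow> dist (g x) (g y) < \<eta>"
    using \<eta> unfolding uniformly_continuous_on_def by metis
  have uc: "norm (g (x - z) - g x) \<le> \<eta>" if "norm z < min d 1" for x z
  proof (cases "x \<in> cball 0 (R+2) \<and> x - z \<in> cball 0 (R+2)")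
    case True
    have "dist (x - z) x < d" using that by (simp add: dist_norm)
    then show ?thesis using d(2)[of "x - z" x] True by (simp add: dist_norm)
  next
    case False
    have "\<bar>norm x - norm (x - z)\<bar> \<le> norm (x - (x - z))" by (rule norm_triangle_ineq3)
    then have "x \<notin> cball 0 R" "x - z \<notin> cball 0 R" using False that by auto
    then show ?thesis using R \<eta> by simp
  qed
  show ?thesis
  proof (intro exI conjI allI impI)
    show "min d 1 > 0" using d by simp
    fix e r and \<kappa> :: "'a \<Rightarrow> real" assume k: "kernel e r \<kappa> \<and> (\<forall>z. \<kappa> z \<noteq> 0 \<longrightarrow> norm z < min d 1)"
    have le: "norm (conv \<kappa> g x - g x) \<le> \<eta> * indicator ?B x" for x
    proof (cases "x \<in> ?B")
      case True
      have "norm (conv \<kappa> g x - g x) \<le> \<eta>"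
      proof (rule conv_near[where \<delta>="min d 1"])
        show "kernel e r \<kappa>" using k by simp
        show "norm z < min d 1" if "\<kappa> z \<noteq> 0" for z using k that by blast
      qed (use g uc in auto)
      then show ?thesis using True by simp
    next
      case False
      have "g (x - z) = 0" if "\<kappa> z \<noteq> 0" for z
      proof -
        have "norm z < 1" using that k by auto
        then have "x - z \<notin> cball 0 R" using False norm_triangle_ineq2[of x z] by auto
        then show ?thesis by (rule R)
      qed
      then have "conv \<kappa> g x = 0" by (rule conv_zero)
      moreover have "g x = 0" using False by (intro R) auto
      ultimately show ?thesis using \<eta> by simp
    qed
    have "L1d (conv \<kappa> g) g \<le> (\<integral>\<^sup>+x. ennreal (\<eta> * indicator ?B x) \<partial>lborel)"
      by (intro nn_integral_mono ennreal_leI le)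
    also have "\<dots> = ennreal \<eta> * ennreal m" using \<eta> by (subst nn_integral_const_indicator) (auto simp: em)
    also have "\<dots> = ennreal (\<eta> * m)" using \<eta> by (simp add: ennreal_mult')
    also have "\<dots> < ennreal \<epsilon>" using ennreal_lessI[OF \<epsilon> \<eta>m] .
    finally show "L1d (conv \<kappa> g) g < ennreal \<epsilon>" .
  qed
qed

text \<open>Convolution with a kernel is an L^1 contraction, so f may be exchanged for a continuous
  approximation at the cost of two further errors. Nothing but the smallness of the support about
  the origin is asked of the kernel: \<delta> serves centred and off-centre kernels of every shape
  at once.\<close>

lemma mollify_L1:
  fixes f :: "'a::euclidean_space \<Rightarrow> 'b::euclidean_space"
  assumes f: "integrable lborel f" and \<epsilon>: "\<epsilon> > 0"
  shows "\<exists>\<delta>>0. \<forall>e r \<kappa>. kernel e r \<kappa> \<and> (\<forall>z. \<kappa> z \<noteq> 0 \<longrightarrow> norm z < \<delta>) \<longrightarrow> L1d (conv \<kappa> f) f < ennreal \<epsilon>"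
proof -
  have e3: "\<epsilon>/3 > 0" using \<epsilon> by simp
  obtain g R where g: "continuous_on UNIV g" "\<And>x. x \<notin> cball 0 R \<Longrightarrow> g x = 0" "L1d f g < ennreal (\<epsilon>/3)"
    using L1_dense[OF f] e3 unfolding L1_approx_def by metis
  obtain \<delta> where \<delta>: "\<delta> > 0" "\<And>e r \<kappa>. kernel e r \<kappa> \<Longrightarrow> (\<And>z. \<kappa> z \<noteq> 0 \<Longrightarrow> norm z < \<delta>) \<Longrightarrow> L1d (conv \<kappa> g) g < ennreal (\<epsilon>/3)"
    using mollify_continuous[OF g(1,2) e3] by meson
  have [measurable]: "f \<in> borel_measurable borel" "g \<in> borel_measurable borel"
    using f borel_measurable_continuous_onI[OF g(1)] by auto
  have ig: "integrable lborel g"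
    by (rule integrable_continuous_compact_support[OF g(1) compact_cball g(2)])
  show ?thesis
  proof (intro exI conjI allI impI)
    show "\<delta> > 0" by fact
    fix e r and \<kappa> :: "'a \<Rightarrow> real" assume k: "kernel e r \<kappa> \<and> (\<forall>z. \<kappa> z \<noteq> 0 \<longrightarrow> norm z < \<delta>)"
    then have \<kappa>: "kernel e r \<kappa>" by simp
    have [measurable]: "\<kappa> \<in> borel_measurable borel" by (rule C1c_measurable(1)[OF kernel_C1c[OF \<kappa>]])
    obtain B where B: "\<And>x. \<bar>\<kappa> x\<bar> \<le> B" using C1c_bounded[OF kernel_C1c[OF \<kappa>]] by metis
    have 1: "L1d (conv \<kappa> g) g < ennreal (\<epsilon>/3)" using k by (intro \<delta>(2)) auto
    have "L1d (conv \<kappa> f) (conv \<kappa> g) = (\<integral>\<^sup>+x. ennreal (norm (conv \<kappa> (\<lambda>x. f x - g x) x)) \<partial>lborel)"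
      by (intro nn_integral_cong) (simp add: conv_diff[OF f ig _ B])
    also have "\<dots> \<le> (\<integral>\<^sup>+z. ennreal \<bar>\<kappa> z\<bar> \<partial>lborel) * L1d f g"
      by (rule nn_integral_conv_le) measurable
    also have "\<dots> = L1d f g" using kernel_nn_integral[OF \<kappa>] by simp
    finally have 2: "L1d (conv \<kappa> f) (conv \<kappa> g) < ennreal (\<epsilon>/3)" using g(3) by simp
    have "L1d (conv \<kappa> f) f \<le> L1d (conv \<kappa> f) (conv \<kappa> g) + L1d (conv \<kappa> g) f"
      by (rule L1d_triangle) measurable
    also have "\<dots> \<le> L1d (conv \<kappa> f) (conv \<kappa> g) + (L1d (conv \<kappa> g) g + L1d g f)"
      by (intro add_left_mono L1d_triangle) measurable
    also have "\<dots> < ennreal (\<epsilon>/3 + (\<epsilon>/3 + \<epsilon>/3))"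
      using e3 by (intro ennreal_add_less 1 2) (auto simp: L1d_commute[of g f] g(3))
    finally show "L1d (conv \<kappa> f) f < ennreal \<epsilon>" by simp
  qed
qed

subsection \<open>Smoothness of mollified functions\<close>

text \<open>All smoothness comes from the kernel. Its first-order remainder is at most \<eta> |h|
  uniformly by \<open>C1c_uniform\<close>, so after integration only the L^1 norm of f
  enters.\<close>

lemma conv_has_derivative:
  assumes \<kappa>: "C1c \<kappa>" and f: "integrable lborel f"
  shows "(conv \<kappa> f has_derivative (\<lambda>h. (LINT y|lborel. f y *\<^sub>R grad \<kappa> (x - y)) \<bullet> h)) (at x)"
proof -
  note [measurable] = C1c_measurable[OF \<kappa>] 
  have [measurable]: "f \<in> borel_measurable borel" using f by auto
  obtain B where B: "\<And>x. \<bar>\<kappa> x\<bar> \<le> B" "\<And>x. norm (grad \<kappa> x) \<le> B" using C1c_bounded[OF \<kappa>] by metis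
  have i1: "integrable lborel (\<lambda>y. \<kappa> (x - y) * f y)" for x
    using integrable_bounded_mult[OF f, of "\<lambda>y. \<kappa> (x - y)" B] B by simp
  have i2: "integrable lborel (\<lambda>y. f y *\<^sub>R grad \<kappa> (x - y))"
  proof (rule Bochner_Integration.integrable_bound)
    show "integrable lborel (\<lambda>y. B * norm (f y))" using f by simp
    show "AE y in lborel. norm (f y *\<^sub>R grad \<kappa> (x - y)) \<le> norm (B * norm (f y))"
      using B(2) order_trans[OF norm_ge_zero B(2)] by (auto simp: mult.commute[of B] intro!: mult_left_mono)
  qed measurable
  have i3: "integrable lborel (\<lambda>y. f y * (grad \<kappa> (x - y) \<bullet> h))" for h
    using integrable_inner_left[OF i2, of h] by simp
  define A where "A = (LINT y|lborel. \<bar>f y\<bar>)"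
  have A: "A \<ge> 0" unfolding A_def by simp
  show ?thesis unfolding has_derivative_at_alt
  proof (intro conjI allI impI)
    show "bounded_linear (\<lambda>h. (LINT y|lborel. f y *\<^sub>R grad \<kappa> (x - y)) \<bullet> h)" by (rule bounded_linear_inner_right)
    fix \<epsilon> :: real assume \<epsilon>: "\<epsilon> > 0"
    define \<eta> where "\<eta> = \<epsilon> / (A + 1)"
    have \<eta>: "\<eta> > 0" "\<eta> * A \<le> \<epsilon>" using A \<epsilon> by (auto simp: \<eta>_def field_simps)
    obtain \<delta> where \<delta>: "\<delta> > 0" "\<And>x h. norm h < \<delta> \<Longrightarrow> \<bar>\<kappa> (x + h) - \<kappa> x - grad \<kappa> x \<bullet> h\<bar> \<le> \<eta> * norm h"
      using C1c_uniform[OF \<kappa> \<eta>(1)] by metis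
    show "\<exists>d>0. \<forall>y. norm (y - x) < d \<longrightarrow> norm (conv \<kappa> f y - conv \<kappa> f x - (LINT y|lborel. f y *\<^sub>R grad \<kappa> (x - y)) \<bullet> (y - x)) \<le> \<epsilon> * norm (y - x)"
    proof (intro exI conjI allI impI)
      show "\<delta> > 0" by fact
      fix w assume w: "norm (w - x) < \<delta>"
      define h where "h = w - x"
      have wh: "w = x + h" and h: "norm h < \<delta>" using w by (auto simp: h_def)
      have eq: "f y * (a - b - c) = a * f y - b * f y - f y * c" for a b c y
        by (simp add: algebra_simps)
      have int: "integrable lborel (\<lambda>y. f y * (\<kappa> (w - y) - \<kappa> (x - y) - grad \<kappa> (x - y) \<bullet> h))"
        unfolding eq by (intro Bochner_Integration.integrable_diff i1 i3)
      have "conv \<kappa> f w - conv \<kappa> f x - (LINT y|lborel. f y *\<^sub>R grad \<kappa> (x - y)) \<bullet> h =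
          (LINT y|lborel. \<kappa> (w - y) * f y) - (LINT y|lborel. \<kappa> (x - y) * f y) - (LINT y|lborel. f y * (grad \<kappa> (x - y) \<bullet> h))"
        using integral_inner_left[OF i2, of h] by (simp add: conv_def)
      also have "\<dots> = (LINT y|lborel. f y * (\<kappa> (w - y) - \<kappa> (x - y) - grad \<kappa> (x - y) \<bullet> h))"
        unfolding eq using i1 i3 by simp
      finally have "norm (conv \<kappa> f w - conv \<kappa> f x - (LINT y|lborel. f y *\<^sub>R grad \<kappa> (x - y)) \<bullet> h) =
          norm (LINT y|lborel. f y * (\<kappa> (w - y) - \<kappa> (x - y) - grad \<kappa> (x - y) \<bullet> h))" by (rule arg_cong)
      also have "\<dots> \<le> (LINT y|lborel. norm (f y * (\<kappa> (w - y) - \<kappa> (x - y) - grad \<kappa> (x - y) \<bullet> h)))"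
        by (rule integral_norm_bound)
      also have "\<dots> \<le> (LINT y|lborel. \<bar>f y\<bar> * (\<eta> * norm h))"
      proof (rule integral_mono)
        show "integrable lborel (\<lambda>y. norm (f y * (\<kappa> (w - y) - \<kappa> (x - y) - grad \<kappa> (x - y) \<bullet> h)))"
          by (rule integrable_norm[OF int])
        show "integrable lborel (\<lambda>y. \<bar>f y\<bar> * (\<eta> * norm h))" using f by simp
        show "norm (f y * (\<kappa> (w - y) - \<kappa> (x - y) - grad \<kappa> (x - y) \<bullet> h)) \<le> \<bar>f y\<bar> * (\<eta> * norm h)" for y
        proof -
          have "\<bar>\<kappa> (w - y) - \<kappa> (x - y) - grad \<kappa> (x - y) \<bullet> h\<bar> \<le> \<eta> * norm h"
            using \<delta>(2)[OF h, of "x - y"] by (simp add: wh algebra_simps)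
          then show ?thesis by (simp only: real_norm_def abs_mult) (rule mult_left_mono, auto)
        qed
      qed
      also have "\<dots> = A * (\<eta> * norm h)" by (simp add: A_def)
      also have "\<dots> \<le> \<epsilon> * norm h" using mult_right_mono[OF \<eta>(2) norm_ge_zero[of h]] by (simp add: ac_simps)
      finally show "norm (conv \<kappa> f w - conv \<kappa> f x - (LINT y|lborel. f y *\<^sub>R grad \<kappa> (x - y)) \<bullet> (w - x)) \<le> \<epsilon> * norm (w - x)"
        by (simp only: h_def)
    qed
  qed
qed

text \<open>Directional derivatives of the convolution are convolutions with directional derivatives
  of the kernel, and these are again test functions; hence the induction with the kernel
  arbitrary.\<close>

lemma cd_conv:
  assumes "\<kappa> \<in> Cc_infinity UNIV" and f: "integrable lborel f"
  shows "cd k (conv \<kappa> f)"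
  using assms(1)
proof (induction k arbitrary: \<kappa>)
  case 0
  have "continuous_on UNIV (conv \<kappa> f)"
    by (rule has_derivative_continuous_on) (rule has_derivative_at_withinI[OF conv_has_derivative[OF Cc_infinity_C1c[OF 0] f]])
  then show ?case by simp
next
  case (Suc k)
  have \<kappa>: "C1c \<kappa>" by (rule Cc_infinity_C1c[OF Suc.prems])
  note [measurable] = C1c_measurable[OF \<kappa>] 
  have [measurable]: "f \<in> borel_measurable borel" using f by auto
  show ?case
  proof (rule cd_SucI[OF conv_has_derivative[OF \<kappa> f]])
    fix v
    obtain K where K: "compact K" "K \<subseteq> UNIV" "\<And>x. x \<notin> K \<Longrightarrow> \<kappa> x = 0" "\<And>x. x \<notin> K \<Longrightarrow> grad \<kappa> x = 0"
      using Cc_infinity_support[OF Suc.prems] by metis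
    have "(\<lambda>x. frechet_derivative \<kappa> (at x) v) \<in> Cc_infinity UNIV"
    proof (rule Cc_infinityI[OF _ K(1,2)])
      show "cd j (\<lambda>x. frechet_derivative \<kappa> (at x) v)" for j
      proof -
        have "cd (Suc j) \<kappa>" using Suc.prems unfolding Cc_infinity_def by blast
        then show ?thesis by simp
      qed
      show "frechet_derivative \<kappa> (at x) v = 0" if "x \<notin> K" for x using K(4)[OF that] by (simp add: C1c_frechet[OF \<kappa>])
    qed
    then have c: "cd k (conv (\<lambda>x. frechet_derivative \<kappa> (at x) v) f)" by (rule Suc.IH)
    have "(LINT y|lborel. f y *\<^sub>R grad \<kappa> (x - y)) \<bullet> v = conv (\<lambda>x. frechet_derivative \<kappa> (at x) v) f x" for x
    proof -
      obtain B where B: "B > 0" "\<And>x. norm (grad \<kappa> x) \<le> B" using C1c_bounded[OF \<kappa>] by metis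
      have "integrable lborel (\<lambda>y. f y *\<^sub>R grad \<kappa> (x - y))"
      proof (rule Bochner_Integration.integrable_bound)
        show "integrable lborel (\<lambda>y. B * norm (f y))" using f by simp
        show "AE y in lborel. norm (f y *\<^sub>R grad \<kappa> (x - y)) \<le> norm (B * norm (f y))"
          using B by (auto simp: mult.commute[of B] intro!: mult_left_mono)
      qed measurable
      from integral_inner_left[OF this, of v] show ?thesis
        by (simp add: conv_def C1c_frechet[OF \<kappa>] mult.commute)
    qed
    then show "cd k (\<lambda>x. (LINT y|lborel. f y *\<^sub>R grad \<kappa> (x - y)) \<bullet> v)" using c by simp
  qed
qed

text \<open>The convolution of \<open>h\<close> with the indicator of a large ball is constant near the origin; differentiating it
  there shows that the gradient has mean zero.\<close>

lemma integral_grad_zero: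
  fixes h :: "'a::euclidean_space \<Rightarrow> real"
  assumes h: "C1c h"
  shows "integral\<^sup>L lborel (grad h) = 0"
proof -
  note [measurable] = C1c_measurable[OF h] 
  obtain R where R: "R > 0" "\<And>x. x \<notin> cball 0 R \<Longrightarrow> h x = 0" "\<And>x. x \<notin> cball 0 R \<Longrightarrow> grad h x = 0"
    using C1c_support[OF h] by metis
  let ?f = "indicator (cball (0::'a) (R + 1)) :: 'a \<Rightarrow> real"
  have f: "integrable lborel ?f" 
    using emeasure_lborel_cball_finite[of "0::'a" "R+1"] by (intro integrable_real_indicator) auto
  have const: "conv h ?f x = integral\<^sup>L lborel h" if "x \<in> ball 0 1" for x
  proof -
    have "h (x - y) * ?f y = h (x - y)" for y
    proof (cases "y \<in> cball 0 (R+1)")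
      case False
      then have "x - y \<notin> cball 0 R" using that norm_triangle_ineq2[of y x] by (simp add: norm_minus_commute)
      then show ?thesis using R by simp
    qed simp
    then have "conv h ?f x = (LINT y|lborel. h (x - y))" unfolding conv_def real_scaleR_def by (simp only:)
    then show ?thesis by (simp add: integral_reflect)
  qed
  have "grad (conv h ?f) 0 = grad (\<lambda>x. integral\<^sup>L lborel h) (0::'a)"
    by (rule grad_eq_on_open[of "ball 0 1"]) (auto simp: const)
  then have "0 = (LINT y|lborel. ?f y *\<^sub>R grad h (0 - y))"
    using gradI(2)[OF conv_has_derivative[OF h f, of 0]] by simp
  also have "\<dots> = (LINT y|lborel. grad h (0 - y))"
  proof (rule Bochner_Integration.integral_cong[OF refl])
    fix y show "?f y *\<^sub>R grad h (0 - y) = grad h (0 - y)" using R(3)[of "0 - y"] by (cases "y \<in> cball 0 (R+1)") auto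
  qed
  also have "\<dots> = integral\<^sup>L lborel (grad h)" by (rule integral_reflect) measurable
  finally show ?thesis by simp
qed

text \<open>The product is again of class \<open>C1c\<close>, so its gradient has mean zero; the
  product rule splits that integral into the two sides.\<close>

lemma integration_by_parts:
  fixes f g :: "'a::euclidean_space \<Rightarrow> real"
  assumes f: "C1c f" and g: "C1c g"
  shows "(LINT x|lborel. f x *\<^sub>R grad g x) = - (LINT x|lborel. g x *\<^sub>R grad f x)"
proof -
  note [measurable] = C1c_measurable[OF f] C1c_measurable[OF g]
  obtain A where "\<And>x. \<bar>f x\<bar> \<le> A" using C1c_bounded[OF f] by metis
  then have 1: "integrable lborel (\<lambda>x. f x *\<^sub>R grad g x)"
    by (intro integrable_bounded_mult C1c_integrable g) auto
  obtain B where "\<And>x. \<bar>g x\<bar> \<le> B" using C1c_bounded[OF g] by metis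
  then have 2: "integrable lborel (\<lambda>x. g x *\<^sub>R grad f x)"
    by (intro integrable_bounded_mult C1c_integrable f) auto
  have "0 = (LINT x|lborel. f x *\<^sub>R grad g x + g x *\<^sub>R grad f x)"
    using integral_grad_zero[OF C1c_mult(1)[OF f g]] C1c_mult(2)[OF f g] by simp
  also have "\<dots> = (LINT x|lborel. f x *\<^sub>R grad g x) + (LINT x|lborel. g x *\<^sub>R grad f x)"
    using 1 2 by simp
  finally show ?thesis by (simp add: eq_neg_iff_add_eq_0)
qed

subsection \<open>Uniqueness of weak gradients\<close>

text \<open>Bridge between the two measure-theoretic settings: the spaces are defined with Lebesgue
  measurable functions on \<Omega>, whereas convolution and Fubini use Borel functions on the whole
  space. Representatives are taken componentwise, and the factor \<open>indicator S\<close> makes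
  the extension vanish everywhere outside S, not only almost everywhere.\<close>

lemma lebesgue_on_borel_representative:
  fixes f :: "'a::euclidean_space \<Rightarrow> 'b::euclidean_space"
  assumes S [measurable]: "S \<in> sets borel" and f: "integrable (lebesgue_on S) f"
  shows "\<exists>f'. integrable lborel f' \<and> (\<forall>x. x \<notin> S \<longrightarrow> f' x = 0) \<and> (AE x in lborel. x \<in> S \<longrightarrow> f' x = f x)"
proof -
  let ?F = "\<lambda>x. indicator S x *\<^sub>R f x"
  have S': "S \<in> sets lebesgue" using S by (simp add: sets_completionI_sets)
  then have F: "integrable lebesgue ?F" using f by (simp add: integrable_restrict_space)
  have "\<exists>h\<in>borel_measurable lborel. AE x in lborel. ?F x \<bullet> b = h x" for b
    by (rule completion_ex_borel_measurable_real)
      (rule borel_measurable_inner[OF borel_measurable_integrable[OF F] borel_measurable_const])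
  then obtain h where h: "\<And>b. h b \<in> borel_measurable lborel" "\<And>b. AE x in lborel. ?F x \<bullet> b = h b x" by metis
  note [measurable] = h(1)
  define f' where "f' x = indicator S x *\<^sub>R (\<Sum>b\<in>Basis. h b x *\<^sub>R b)" for x
  have [measurable]: "f' \<in> borel_measurable lborel" unfolding f'_def by measurable
  have "AE x in lborel. \<forall>b\<in>Basis. ?F x \<bullet> b = h b x" using h(2) by (intro AE_finite_allI) auto
  then have AE: "AE x in lborel. f' x = ?F x"
  proof (rule eventually_mono)
    fix x assume "\<forall>b\<in>Basis. ?F x \<bullet> b = h b x"
    then have "(\<Sum>b\<in>Basis. h b x *\<^sub>R b) = (\<Sum>b\<in>Basis. (?F x \<bullet> b) *\<^sub>R b)" by (intro sum.cong) auto
    also have "\<dots> = ?F x" by (rule euclidean_representation)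
    finally show "f' x = ?F x" by (simp add: f'_def indicator_def)
  qed
  have "integrable lebesgue f'"
  proof (rule integrable_cong_AE_imp[OF F])
    show "f' \<in> borel_measurable lebesgue" by (rule measurable_completion) measurable
    show "AE x in lebesgue. ?F x = f' x" using AE_completion[OF AE] by (auto elim!: eventually_mono)
  qed
  then have "integrable lborel f'" by (simp add: integrable_completion)
  moreover have "\<forall>x. x \<notin> S \<longrightarrow> f' x = 0" by (simp add: f'_def)
  moreover have "AE x in lborel. x \<in> S \<longrightarrow> f' x = f x" using AE by (auto elim!: eventually_mono)
  ultimately show ?thesis by blast
qed

lemma locally_integrable_mult_test:
  fixes h :: "'a::euclidean_space \<Rightarrow> 'b::euclidean_space"
  assumes \<Omega>: "open \<Omega>" and h: "locally_integrable \<Omega> h"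
    and K: "compact K" "K \<subseteq> \<Omega>" "\<And>x. x \<notin> K \<Longrightarrow> \<phi> x = 0" and \<phi>: "\<phi> \<in> borel_measurable borel" "\<And>x. \<bar>\<phi> x\<bar> \<le> B"
  shows "integrable (lebesgue_on \<Omega>) (\<lambda>x. \<phi> x *\<^sub>R h x)"
proof -
  have s: "\<Omega> \<in> sets lebesgue" "K \<in> sets lebesgue" using \<Omega> K(1) by (auto simp: compact_imp_closed)
  have "integrable (lebesgue_on K) h" using h K unfolding locally_integrable_def by blast
  then have i: "integrable lebesgue (\<lambda>x. indicator K x *\<^sub>R h x)" using s by (simp add: integrable_restrict_space)
  have [measurable]: "\<phi> \<in> borel_measurable lebesgue" by (rule measurable_completion) (use \<phi> in simp)
  have "integrable lebesgue (\<lambda>x. \<phi> x *\<^sub>R (indicator K x *\<^sub>R h x))"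
  proof (rule Bochner_Integration.integrable_bound)
    show "integrable lebesgue (\<lambda>x. B *\<^sub>R (indicator K x *\<^sub>R h x))" by (rule integrable_scaleR_right) (rule i)
    show "(\<lambda>x. \<phi> x *\<^sub>R (indicator K x *\<^sub>R h x)) \<in> borel_measurable lebesgue"
      by (rule borel_measurable_scaleR[OF _ borel_measurable_integrable[OF i]]) measurable
    show "AE x in lebesgue. norm (\<phi> x *\<^sub>R (indicator K x *\<^sub>R h x)) \<le> norm (B *\<^sub>R (indicator K x *\<^sub>R h x))"
    proof (rule AE_I2)
      fix x
      have "\<bar>\<phi> x\<bar> \<le> \<bar>B\<bar>" using \<phi>(2)[of x] by linarith
      then show "norm (\<phi> x *\<^sub>R (indicator K x *\<^sub>R h x)) \<le> norm (B *\<^sub>R (indicator K x *\<^sub>R h x))"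
        by (simp only: norm_scaleR) (rule mult_right_mono, auto)
    qed
  qed
  also have "(\<lambda>x. \<phi> x *\<^sub>R (indicator K x *\<^sub>R h x)) = (\<lambda>x. indicator \<Omega> x *\<^sub>R (\<phi> x *\<^sub>R h x))"
    using K by (auto simp: fun_eq_iff indicator_def)
  finally show ?thesis using s by (simp add: integrable_restrict_space)
qed

lemma locally_integrable_mult_Cc:
  fixes h :: "'a::euclidean_space \<Rightarrow> 'b::euclidean_space"
  assumes "open \<Omega>" "locally_integrable \<Omega> h" and \<phi>: "\<phi> \<in> Cc_infinity \<Omega>"
  shows "integrable (lebesgue_on \<Omega>) (\<lambda>x. \<phi> x *\<^sub>R h x)"
    "integrable (lebesgue_on \<Omega>) (\<lambda>x. frechet_derivative \<phi> (at x) b *\<^sub>R h x)"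
proof -
  note C = Cc_infinity_C1c[OF \<phi>]
  obtain K where K: "compact K" "K \<subseteq> \<Omega>" "\<And>x. x \<notin> K \<Longrightarrow> \<phi> x = 0" "\<And>x. x \<notin> K \<Longrightarrow> grad \<phi> x = 0"
    using Cc_infinity_support[OF \<phi>] by metis
  obtain B where B: "B > 0" "\<And>x. \<bar>\<phi> x\<bar> \<le> B" "\<And>x. norm (grad \<phi> x) \<le> B" using C1c_bounded[OF C] by metis
  show "integrable (lebesgue_on \<Omega>) (\<lambda>x. \<phi> x *\<^sub>R h x)"
    by (rule locally_integrable_mult_test[OF assms(1,2) K(1-3) C1c_measurable(1)[OF C] B(2)])
  show "integrable (lebesgue_on \<Omega>) (\<lambda>x. frechet_derivative \<phi> (at x) b *\<^sub>R h x)"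
  proof (rule locally_integrable_mult_test[OF assms(1,2) K(1,2)])
    have eq: "(\<lambda>x. frechet_derivative \<phi> (at x) b) = (\<lambda>x. grad \<phi> x \<bullet> b)" by (simp add: C1c_frechet[OF C])
    show "frechet_derivative \<phi> (at x) b = 0" if "x \<notin> K" for x using K(4)[OF that] by (simp add: C1c_frechet[OF C])
    show "(\<lambda>x. frechet_derivative \<phi> (at x) b) \<in> borel_measurable borel"
      unfolding eq using C1c_measurable(2)[OF C] by (intro borel_measurable_inner borel_measurable_const)
    show "\<bar>frechet_derivative \<phi> (at x) b\<bar> \<le> B * norm b" for x
      using Cauchy_Schwarz_ineq2[of "grad \<phi> x" b] mult_right_mono[OF B(3)[of x] norm_ge_zero[of b]]
      by (simp add: C1c_frechet[OF C])
  qed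
qed

text \<open>For x in the smaller ball the reflected kernel y \<mapsto> \<kappa>(x - y) is itself a
  test function in \<Omega>, so the mollification of h vanishes at x; shrinking the kernel gives h =
  0 by L^1 convergence. The doubled radius leaves room for the support of the kernel.\<close>

lemma fundamental_lemma_local:
  fixes h :: "'a::euclidean_space \<Rightarrow> real"
  assumes \<Omega>: "open \<Omega>" and h: "locally_integrable \<Omega> h"
    and 0: "\<And>\<phi>. \<phi> \<in> Cc_infinity \<Omega> \<Longrightarrow> (LINT x|lebesgue_on \<Omega>. \<phi> x * h x) = 0"
    and r: "r > 0" "cball x0 (2 * r) \<subseteq> \<Omega>"
  shows "AE x in lborel. x \<in> cball x0 r \<longrightarrow> h x = 0"
proof -
  let ?K = "cball x0 (2 * r)"
  have "integrable (lebesgue_on ?K) h" using h r(2) by (simp add: locally_integrable_def)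
  then obtain f where f: "integrable lborel f" "\<And>x. x \<notin> ?K \<Longrightarrow> f x = 0" "AE x in lborel. x \<in> ?K \<longrightarrow> f x = h x"
    using lebesgue_on_borel_representative[of ?K h] by auto
  have [measurable]: "f \<in> borel_measurable borel" using f by auto
  have conv0: "conv \<kappa> f x = 0" if \<kappa>: "kernel e s \<kappa>" "\<And>z. \<kappa> z \<noteq> 0 \<Longrightarrow> norm z < r" and x: "x \<in> cball x0 r" for e s \<kappa> x
  proof -
    let ?\<phi> = "\<lambda>y. \<kappa> (x + (-1) *\<^sub>R y)"
    have sub: "cball x r \<subseteq> ?K"
    proof
      fix y assume "y \<in> cball x r"
      then show "y \<in> ?K" using x dist_triangle[of x0 y x] by auto
    qed
    have out: "?\<phi> y = 0" if "y \<notin> cball x r" for y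
      using \<kappa>(2)[of "x - y"] that by (auto simp: dist_norm)
    have "?\<phi> \<in> Cc_infinity \<Omega>"
    proof (rule Cc_infinityI[of _ "cball x r"])
      show "cd k ?\<phi>" for k by (rule cd_affine) (use \<kappa>(1) in \<open>simp add: kernel_def\<close>)
      show "cball x r \<subseteq> \<Omega>" using sub r by blast
    qed (use out in auto)
    then have "0 = (LINT y|lebesgue_on \<Omega>. ?\<phi> y * h y)" using 0 by simp
    also have "\<dots> = (LINT y|lebesgue. indicator \<Omega> y *\<^sub>R (?\<phi> y * h y))"
      using \<Omega> by (intro integral_restrict_space) simp
    also have "\<dots> = (LINT y|lebesgue. ?\<phi> y *\<^sub>R f y)"
    proof (rule integral_cong_AE)
      have m\<phi>: "?\<phi> \<in> borel_measurable borel" using C1c_measurable(1)[OF kernel_C1c[OF \<kappa>(1)]] by measurable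
      obtain B where B: "\<And>x. \<bar>\<kappa> x\<bar> \<le> B" using C1c_bounded[OF kernel_C1c[OF \<kappa>(1)]] by metis
      have "integrable (lebesgue_on \<Omega>) (\<lambda>y. ?\<phi> y *\<^sub>R h y)"
        by (rule locally_integrable_mult_test[OF \<Omega> h, of "cball x r"]) (use sub r out B m\<phi> in auto)
      then have "integrable lebesgue (\<lambda>y. indicator \<Omega> y *\<^sub>R (?\<phi> y * h y))"
        using \<Omega> by (simp add: integrable_restrict_space)
      then show "(\<lambda>y. indicator \<Omega> y *\<^sub>R (?\<phi> y * h y)) \<in> borel_measurable lebesgue" by auto
      show "(\<lambda>y. ?\<phi> y *\<^sub>R f y) \<in> borel_measurable lebesgue"
        using m\<phi> \<open>f \<in> borel_measurable borel\<close> by (intro measurable_completion borel_measurable_scaleR) auto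
      show "AE y in lebesgue. indicator \<Omega> y *\<^sub>R (?\<phi> y * h y) = ?\<phi> y *\<^sub>R f y"
        using AE_completion[OF f(3)]
      proof (rule eventually_mono)
        fix y assume y: "y \<in> ?K \<longrightarrow> f y = h y"
        show "indicator \<Omega> y *\<^sub>R (?\<phi> y * h y) = ?\<phi> y *\<^sub>R f y"
        proof (cases "y \<in> cball x r")
          case True
          then have "y \<in> ?K" "y \<in> \<Omega>" using sub r by auto
          then show ?thesis using y by simp
        next
          case False
          then show ?thesis using out[OF False] by simp
        qed
      qed
    qed
    also have "\<dots> = conv \<kappa> f x" unfolding conv_def
      using C1c_measurable(1)[OF kernel_C1c[OF \<kappa>(1)]] by (subst integral_completion) auto
    finally show ?thesis by simp
  qed
  have "(\<integral>\<^sup>+x. ennreal \<bar>f x\<bar> * indicator (cball x0 r) x \<partial>lborel) \<le> 0 + ennreal \<epsilon>" if \<epsilon>: "\<epsilon> > 0" for \<epsilon>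
  proof -
    obtain \<delta> where \<delta>: "\<delta> > 0" "\<And>e s \<kappa>. kernel e s \<kappa> \<Longrightarrow> (\<And>z. \<kappa> z \<noteq> 0 \<Longrightarrow> norm z < \<delta>) \<Longrightarrow> L1d (conv \<kappa> f) f < ennreal \<epsilon>"
      using mollify_L1[OF f(1) \<epsilon>] by meson
    define s where "s = min \<delta> r / 2"
    have s: "s > 0" "s < \<delta>" "s < r" using \<delta>(1) r by (auto simp: s_def)
    obtain \<kappa> where \<kappa>: "kernel (0::'a) s \<kappa>" using kernel_exists[OF s(1)] by blast
    have n: "norm z \<le> s" if "\<kappa> z \<noteq> 0" for z using kernel_support[OF \<kappa>, of z] that by auto
    have "(\<integral>\<^sup>+x. ennreal \<bar>f x\<bar> * indicator (cball x0 r) x \<partial>lborel) \<le> L1d (conv \<kappa> f) f"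
    proof (rule nn_integral_mono)
      fix x show "ennreal \<bar>f x\<bar> * indicator (cball x0 r) x \<le> ennreal (norm (conv \<kappa> f x - f x))"
      proof (cases "x \<in> cball x0 r")
        case True
        have "conv \<kappa> f x = 0" by (rule conv0[OF \<kappa> _ True]) (use n s in force)
        then show ?thesis using True by (simp add: indicator_def)
      qed simp
    qed
    also have "\<dots> < ennreal \<epsilon>" by (rule \<delta>(2)[OF \<kappa>]) (use n s in force)
    finally show ?thesis by simp
  qed
  then have "(\<integral>\<^sup>+x. ennreal \<bar>f x\<bar> * indicator (cball x0 r) x \<partial>lborel) \<le> 0"
    by (rule ennreal_le_epsilon)
  then have "(\<integral>\<^sup>+x. ennreal \<bar>f x\<bar> * indicator (cball x0 r) x \<partial>lborel) = 0" by simp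
  moreover have "AE x in lborel. ennreal \<bar>f x\<bar> * indicator (cball x0 r) x = 0"
      if "(\<integral>\<^sup>+x. ennreal \<bar>f x\<bar> * indicator (cball x0 r) x \<partial>lborel) = 0"
  proof -
    have [measurable]: "cball x0 r \<in> sets borel" by simp
    have "(\<lambda>x. ennreal \<bar>f x\<bar> * indicator (cball x0 r) x) \<in> borel_measurable lborel" by measurable
    from nn_integral_0_iff_AE[OF this] show ?thesis using that by simp
  qed
  ultimately have "AE x in lborel. ennreal \<bar>f x\<bar> * indicator (cball x0 r) x = 0" by blast
  then show ?thesis using f(3)
  proof eventually_elim
    case (elim x)
    show ?case
    proof
      assume x: "x \<in> cball x0 r"
      then have "x \<in> ?K" using r by auto
      then show "h x = 0" using elim x by (simp add: ennreal_eq_0_iff)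
    qed
  qed
qed

text \<open>The exceptional set is negligible near each of its points, and local negligibility
  implies negligibility, so no countable cover has to be chosen.\<close>

lemma fundamental_lemma:
  fixes h :: "'a::euclidean_space \<Rightarrow> real"
  assumes \<Omega>: "open \<Omega>" and h: "locally_integrable \<Omega> h"
    and 0: "\<And>\<phi>. \<phi> \<in> Cc_infinity \<Omega> \<Longrightarrow> (LINT x|lebesgue_on \<Omega>. \<phi> x * h x) = 0"
  shows "AE x in lebesgue_on \<Omega>. h x = 0"
proof -
  let ?S = "{x\<in>\<Omega>. h x \<noteq> 0}"
  have "negligible ?S"
  proof (subst locally_negligible_alt, intro ballI)
    fix x0 assume x0: "x0 \<in> ?S"
    then obtain R where R: "R > 0" "cball x0 R \<subseteq> \<Omega>" using \<Omega> open_contains_cball by blast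
    have "AE x in lborel. x \<in> cball x0 (R/2) \<longrightarrow> h x = 0"
      by (rule fundamental_lemma_local[OF \<Omega> h 0]) (use R in auto)
    then obtain N where N: "N \<in> null_sets lborel" "{x. \<not> (x \<in> cball x0 (R/2) \<longrightarrow> h x = 0)} \<subseteq> N"
      unfolding eventually_ae_filter by auto
    then have n: "negligible N" by (simp add: negligible_iff_null_sets null_sets_completionI)
    show "\<exists>U. openin (top_of_set ?S) U \<and> x0 \<in> U \<and> negligible U"
    proof (intro exI conjI)
      show "openin (top_of_set ?S) (?S \<inter> ball x0 (R/2))" by (rule openin_open_Int) simp
      show "x0 \<in> ?S \<inter> ball x0 (R/2)" using x0 R by simp
      show "negligible (?S \<inter> ball x0 (R/2))" by (rule negligible_subset[OF n]) (use N(2) in auto)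
    qed
  qed
  then have "?S \<in> null_sets lebesgue" by (simp add: negligible_iff_null_sets)
  then have "AE x in lebesgue. x \<notin> ?S" by (rule AE_not_in)
  then have "AE x in lebesgue. x \<in> \<Omega> \<longrightarrow> h x = 0" by (auto elim!: eventually_mono)
  then show ?thesis using \<Omega> by (subst AE_restrict_space_iff) auto
qed

lemma locally_integrable_diff:
  "locally_integrable \<Omega> f \<Longrightarrow> locally_integrable \<Omega> g \<Longrightarrow> locally_integrable \<Omega> (\<lambda>x. f x - g x)"
  unfolding locally_integrable_def by auto

lemma locally_integrable_add:
  "locally_integrable \<Omega> f \<Longrightarrow> locally_integrable \<Omega> g \<Longrightarrow> locally_integrable \<Omega> (\<lambda>x. f x + g x)"
  unfolding locally_integrable_def by auto

lemma locally_integrable_inner: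
  "locally_integrable \<Omega> f \<Longrightarrow> locally_integrable \<Omega> (\<lambda>x. f x \<bullet> b)"
  unfolding locally_integrable_def by auto

text \<open>Since \<open>weak_gradient\<close> is an arbitrary choice, every later computation with
  it passes through this uniqueness, applied to each coordinate by the fundamental lemma.\<close>

lemma is_weak_gradient_unique:
  assumes \<Omega>: "open \<Omega>" and g: "is_weak_gradient \<Omega> u g1" "is_weak_gradient \<Omega> u g2"
  shows "AE x in lebesgue_on \<Omega>. g1 x = g2 x"
proof -
  have l: "locally_integrable \<Omega> g1" "locally_integrable \<Omega> g2" using g by (auto simp: is_weak_gradient_def)
  have "AE x in lebesgue_on \<Omega>. \<forall>b\<in>Basis. g1 x \<bullet> b - g2 x \<bullet> b = 0"
  proof (rule AE_finite_allI)
    fix b :: 'a assume b: "b \<in> Basis"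
    show "AE x in lebesgue_on \<Omega>. g1 x \<bullet> b - g2 x \<bullet> b = 0"
    proof (rule fundamental_lemma[OF \<Omega>])
      show "locally_integrable \<Omega> (\<lambda>x. g1 x \<bullet> b - g2 x \<bullet> b)"
        by (intro locally_integrable_diff locally_integrable_inner l)
      fix \<phi> assume \<phi>: "\<phi> \<in> Cc_infinity \<Omega>"
      have i: "integrable (lebesgue_on \<Omega>) (\<lambda>x. \<phi> x * (g1 x \<bullet> b))" "integrable (lebesgue_on \<Omega>) (\<lambda>x. \<phi> x * (g2 x \<bullet> b))"
        using locally_integrable_mult_Cc(1)[OF \<Omega> locally_integrable_inner[OF l(1)] \<phi>]
          locally_integrable_mult_Cc(1)[OF \<Omega> locally_integrable_inner[OF l(2)] \<phi>] by simp_all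
      have "(LINT x|lebesgue_on \<Omega>. \<phi> x * (g1 x \<bullet> b)) = (LINT x|lebesgue_on \<Omega>. \<phi> x * (g2 x \<bullet> b))"
        using g \<phi> b by (simp add: is_weak_gradient_def mult.commute[of "\<phi> _"])
      then show "(LINT x|lebesgue_on \<Omega>. \<phi> x * (g1 x \<bullet> b - g2 x \<bullet> b)) = 0"
        using i by (simp add: right_diff_distrib)
    qed
  qed simp
  then show ?thesis by (auto elim!: eventually_mono intro: euclidean_eqI)
qed

lemma weak_gradient_eq:
  assumes "open \<Omega>" "is_weak_gradient \<Omega> u g"
  shows "is_weak_gradient \<Omega> u (weak_gradient \<Omega> u)" "AE x in lebesgue_on \<Omega>. weak_gradient \<Omega> u x = g x"
proof -
  show "is_weak_gradient \<Omega> u (weak_gradient \<Omega> u)"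
    unfolding weak_gradient_def using assms(2) by (rule someI[where P="is_weak_gradient \<Omega> u"])
  then show "AE x in lebesgue_on \<Omega>. weak_gradient \<Omega> u x = g x"
    by (rule is_weak_gradient_unique[OF assms(1) _ assms(2)])
qed

lemma is_weak_gradient_combine:
  assumes \<Omega>: "open \<Omega>" and u: "is_weak_gradient \<Omega> u g" "is_weak_gradient \<Omega> v h"
  shows "is_weak_gradient \<Omega> (\<lambda>x. u x + v x) (\<lambda>x. g x + h x)"
    "is_weak_gradient \<Omega> (\<lambda>x. u x - v x) (\<lambda>x. g x - h x)"
proof -
  have l: "locally_integrable \<Omega> u" "locally_integrable \<Omega> v" "locally_integrable \<Omega> g" "locally_integrable \<Omega> h"
    using u by (auto simp: is_weak_gradient_def)
  have e: "(LINT x|lebesgue_on \<Omega>. u x * frechet_derivative \<phi> (at x) b) = - (LINT x|lebesgue_on \<Omega>. (g x \<bullet> b) * \<phi> x)"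
    "(LINT x|lebesgue_on \<Omega>. v x * frechet_derivative \<phi> (at x) b) = - (LINT x|lebesgue_on \<Omega>. (h x \<bullet> b) * \<phi> x)"
    if "\<phi> \<in> Cc_infinity \<Omega>" "b \<in> Basis" for \<phi> b using u that by (auto simp: is_weak_gradient_def)
  have i1: "integrable (lebesgue_on \<Omega>) (\<lambda>x. w x * frechet_derivative \<phi> (at x) b)"
    if "\<phi> \<in> Cc_infinity \<Omega>" "locally_integrable \<Omega> w" for \<phi> b and w :: "'a \<Rightarrow> real"
    using locally_integrable_mult_Cc(2)[OF \<Omega> that(2,1), of b] by (simp add: mult.commute)
  have i2: "integrable (lebesgue_on \<Omega>) (\<lambda>x. (w x \<bullet> b) * \<phi> x)"
    if "\<phi> \<in> Cc_infinity \<Omega>" "locally_integrable \<Omega> w" for \<phi> b and w :: "'a \<Rightarrow> 'a"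
    using locally_integrable_mult_Cc(1)[OF \<Omega> locally_integrable_inner[OF that(2)] that(1), of b] by (simp add: mult.commute)
  show "is_weak_gradient \<Omega> (\<lambda>x. u x + v x) (\<lambda>x. g x + h x)"
    unfolding is_weak_gradient_def
  proof (intro conjI ballI)
    fix \<phi> and b :: 'a assume "\<phi> \<in> Cc_infinity \<Omega>" "b \<in> Basis"
    then show "(LINT x|lebesgue_on \<Omega>. (u x + v x) * frechet_derivative \<phi> (at x) b) = - (LINT x|lebesgue_on \<Omega>. ((g x + h x) \<bullet> b) * \<phi> x)"
      using l by (simp add: inner_add_left distrib_right i1 i2 e)
  qed (intro locally_integrable_add l)+
  show "is_weak_gradient \<Omega> (\<lambda>x. u x - v x) (\<lambda>x. g x - h x)"
    unfolding is_weak_gradient_def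
  proof (intro conjI ballI)
    fix \<phi> and b :: 'a assume "\<phi> \<in> Cc_infinity \<Omega>" "b \<in> Basis"
    then show "(LINT x|lebesgue_on \<Omega>. (u x - v x) * frechet_derivative \<phi> (at x) b) = - (LINT x|lebesgue_on \<Omega>. ((g x - h x) \<bullet> b) * \<phi> x)"
      using l by (simp add: inner_diff_left left_diff_distrib i1 i2 e)
  qed (intro locally_integrable_diff l)+
qed

text \<open>The test function vanishes outside a compact subset of \<Omega>, so both integrals over
  \<Omega> are integrals over the whole space, where integration by parts has no boundary
  term.\<close>

lemma C1c_is_weak_gradient:
  assumes \<Omega>: "open \<Omega>" and f: "C1c f"
  shows "is_weak_gradient \<Omega> f (grad f)"
  unfolding is_weak_gradient_def
proof (intro conjI ballI)
  note [measurable] = C1c_measurable[OF f]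
  have loc: "locally_integrable \<Omega> w" if "integrable lborel w" for w :: "'a \<Rightarrow> 'b::euclidean_space"
    unfolding locally_integrable_def
  proof (intro allI impI)
    fix K assume "compact K \<and> K \<subseteq> \<Omega>"
    then have K: "K \<in> sets borel" "K \<in> sets lebesgue" by (auto simp: compact_imp_closed)
    have [measurable]: "w \<in> borel_measurable borel" using that by auto
    have "integrable lborel (\<lambda>x. indicator K x *\<^sub>R w x)" by (rule integrable_bounded_mult[OF that, of _ 1]) (use K in auto)
    then show "integrable (lebesgue_on K) w" using K by (simp add: integrable_restrict_space integrable_completion)
  qed
  show "locally_integrable \<Omega> f" "locally_integrable \<Omega> (grad f)"
    by (intro loc C1c_integrable f)+
  fix \<phi> and b :: 'a assume \<phi>: "\<phi> \<in> Cc_infinity \<Omega>" and b: "b \<in> Basis"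
  note C = Cc_infinity_C1c[OF \<phi>]
  note [measurable] = C1c_measurable[OF C]
  obtain K where K: "compact K" "K \<subseteq> \<Omega>" "\<And>x. x \<notin> K \<Longrightarrow> \<phi> x = 0" "\<And>x. x \<notin> K \<Longrightarrow> grad \<phi> x = 0"
    using Cc_infinity_support[OF \<phi>] by metis
  have eq: "(LINT x|lebesgue_on \<Omega>. w x) = (LINT x|lborel. w x)"
    if "\<And>x. x \<notin> K \<Longrightarrow> w x = 0" and [measurable]: "w \<in> borel_measurable borel" for w :: "'a \<Rightarrow> real"
  proof -
    have "(LINT x|lebesgue_on \<Omega>. w x) = (LINT x|lebesgue. indicator \<Omega> x *\<^sub>R w x)"
      using \<Omega> by (intro integral_restrict_space) simp
    also have "(\<lambda>x. indicator \<Omega> x *\<^sub>R w x) = w" using that(1) K(2) by (auto simp: fun_eq_iff indicator_def)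
    also have "integral\<^sup>L lebesgue w = integral\<^sup>L lborel w" by (rule integral_completion) measurable
    finally show ?thesis .
  qed
  obtain A where "\<And>x. \<bar>f x\<bar> \<le> A" using C1c_bounded[OF f] by metis
  then have i1: "integrable lborel (\<lambda>x. f x *\<^sub>R grad \<phi> x)"
    by (intro integrable_bounded_mult C1c_integrable C) auto
  obtain B where "\<And>x. \<bar>\<phi> x\<bar> \<le> B" using C1c_bounded[OF C] by metis
  then have i2: "integrable lborel (\<lambda>x. \<phi> x *\<^sub>R grad f x)"
    by (intro integrable_bounded_mult C1c_integrable f) auto
  have "(LINT x|lebesgue_on \<Omega>. f x * frechet_derivative \<phi> (at x) b) = (LINT x|lborel. (f x *\<^sub>R grad \<phi> x) \<bullet> b)"
    unfolding C1c_frechet[OF C] by (subst eq) (auto simp: K(4))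
  also have "\<dots> = (LINT x|lborel. f x *\<^sub>R grad \<phi> x) \<bullet> b" by (rule integral_inner_left) (rule i1)
  also have "\<dots> = - ((LINT x|lborel. \<phi> x *\<^sub>R grad f x) \<bullet> b)" by (simp add: integration_by_parts[OF f C])
  also have "\<dots> = - (LINT x|lborel. (\<phi> x *\<^sub>R grad f x) \<bullet> b)" using integral_inner_left[OF i2, of b] by simp
  also have "\<dots> = - (LINT x|lebesgue_on \<Omega>. (grad f x \<bullet> b) * \<phi> x)"
    by (subst eq) (auto simp: K(3) mult.commute)
  finally show "(LINT x|lebesgue_on \<Omega>. f x * frechet_derivative \<phi> (at x) b) = - (LINT x|lebesgue_on \<Omega>. (grad f x \<bullet> b) * \<phi> x)" .
qed

subsection \<open>Sobolev pairs as \<open>L\<^sup>1\<close> limits of test functions\<close>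

text \<open>Membership of (v, g) in the L^1 closure of the graph of the gradient on
  \<open>C1c\<close>, that is, v in W^{1,1} of the whole space with gradient g. Chain rule, product
  rule and commutation with mollification all pass to such limits. The domain \<Omega> does not
  occur here; vanishing outside it is kept as a separate assumption.\<close>

definition approx_pair :: "('a::euclidean_space \<Rightarrow> real) \<Rightarrow> ('a \<Rightarrow> 'a) \<Rightarrow> bool" where
  "approx_pair v g \<longleftrightarrow> integrable lborel v \<and> integrable lborel g \<and>
     (\<forall>\<epsilon>>0. \<exists>f. C1c f \<and> L1d v f < ennreal \<epsilon> \<and> L1d g (grad f) < ennreal \<epsilon>)"

lemma norm_integral_diff_le:
  fixes f g :: "'a::euclidean_space \<Rightarrow> 'b::euclidean_space"
  assumes f: "integrable lborel f" and g: "integrable lborel g"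
    and [measurable]: "\<kappa> \<in> borel_measurable borel" and B: "\<And>x. \<bar>\<kappa> x\<bar> \<le> B"
    and \<epsilon>: "L1d f g < ennreal \<epsilon>" "\<epsilon> > 0"
  shows "norm ((LINT y|lborel. \<kappa> y *\<^sub>R f y) - (LINT y|lborel. \<kappa> y *\<^sub>R g y)) \<le> B * \<epsilon>"
proof -
  have B0: "B \<ge> 0" using B[of 0] by linarith
  have [measurable]: "f \<in> borel_measurable borel" "g \<in> borel_measurable borel" using f g by auto
  have i: "integrable lborel (\<lambda>y. \<kappa> y *\<^sub>R f y)" "integrable lborel (\<lambda>y. \<kappa> y *\<^sub>R g y)"
    by (intro integrable_bounded_mult[OF _ _ B] f g; measurable)+
  have "(LINT y|lborel. \<kappa> y *\<^sub>R f y) - (LINT y|lborel. \<kappa> y *\<^sub>R g y) = (LINT y|lborel. \<kappa> y *\<^sub>R f y - \<kappa> y *\<^sub>R g y)"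
    using i by simp
  then have "ennreal (norm ((LINT y|lborel. \<kappa> y *\<^sub>R f y) - (LINT y|lborel. \<kappa> y *\<^sub>R g y))) = ennreal (norm (LINT y|lborel. \<kappa> y *\<^sub>R f y - \<kappa> y *\<^sub>R g y))"
    by (rule arg_cong)
  also have "\<dots> \<le> (\<integral>\<^sup>+y. ennreal (norm (\<kappa> y *\<^sub>R f y - \<kappa> y *\<^sub>R g y)) \<partial>lborel)"
    by (rule integral_norm_bound_ennreal) (intro Bochner_Integration.integrable_diff i)
  also have "\<dots> \<le> (\<integral>\<^sup>+y. ennreal B * ennreal (norm (f y - g y)) \<partial>lborel)"
  proof (rule nn_integral_mono)
    fix y show "ennreal (norm (\<kappa> y *\<^sub>R f y - \<kappa> y *\<^sub>R g y)) \<le> ennreal B * ennreal (norm (f y - g y))"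
      using B[of y] B0 by (simp add: mult_right_mono flip: scaleR_diff_right ennreal_mult)
  qed
  also have "\<dots> = ennreal B * L1d f g" by (rule nn_integral_cmult) measurable
  also have "\<dots> \<le> ennreal B * ennreal \<epsilon>" using \<epsilon>(1) by (intro mult_left_mono) auto
  also have "\<dots> = ennreal (B * \<epsilon>)" using B0 by (simp add: ennreal_mult')
  finally show ?thesis using B0 \<epsilon>(2) by (simp add: ennreal_le_iff)
qed

text \<open>For C^1 functions this is integration by parts against the reflected kernel. Both sides
  are continuous in (v, g) with respect to L^1, because the kernel and its gradient are bounded, so
  the identity extends to the closure.\<close>

lemma grad_conv:
  assumes v: "approx_pair v g" and \<kappa>: "C1c \<kappa>"
  shows "grad (conv \<kappa> v) x = conv \<kappa> g x"
proof (rule euclidean_eqI)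
  fix b :: 'a assume b: "b \<in> Basis"
  have iv: "integrable lborel v" and ig: "integrable lborel g" using v by (auto simp: approx_pair_def)
  note [measurable] = C1c_measurable[OF \<kappa>]
  have [measurable]: "v \<in> borel_measurable borel" "g \<in> borel_measurable borel" using iv ig by auto
  obtain B where B: "B > 0" "\<And>x. \<bar>\<kappa> x\<bar> \<le> B" "\<And>x. norm (grad \<kappa> x) \<le> B" using C1c_bounded[OF \<kappa>] by metis
  \<comment> \<open>With the reflection \<open>k\<close> both sides become integrals against one
    fixed C^1 function. Its gradient carries a minus sign, which integration by parts
    removes.\<close>
  define k where "k y = \<kappa> (x + (-1) *\<^sub>R y)" for y
  have k: "C1c k" "grad k = (\<lambda>y. (-1) *\<^sub>R grad \<kappa> (x + (-1) *\<^sub>R y))"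
    unfolding k_def[abs_def] by (rule C1c_affine[OF \<kappa>]; simp)+
  note [measurable] = C1c_measurable[OF k(1)]
  have kB: "\<bar>k y\<bar> \<le> B" "\<bar>grad k y \<bullet> b\<bar> \<le> B" for y
  proof -
    show "\<bar>k y\<bar> \<le> B" using B(2) by (simp add: k_def)
    have "\<bar>grad k y \<bullet> b\<bar> \<le> norm (grad k y)" using b by (rule Basis_le_norm)
    also have "\<dots> \<le> B" using B(3) by (simp add: k(2))
    finally show "\<bar>grad k y \<bullet> b\<bar> \<le> B" .
  qed
  have ik: "integrable lborel (\<lambda>y. w y *\<^sub>R grad k y)" if "integrable lborel w" for w :: "'a \<Rightarrow> real"
  proof (rule Bochner_Integration.integrable_bound)
    have [measurable]: "w \<in> borel_measurable borel" using that by auto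
    show "integrable lborel (\<lambda>y. B * norm (w y))" using that by simp
    show "(\<lambda>y. w y *\<^sub>R grad k y) \<in> borel_measurable lborel" by measurable
    show "AE y in lborel. norm (w y *\<^sub>R grad k y) \<le> norm (B * norm (w y))"
      using B by (auto simp: k(2) mult.commute[of B] intro!: mult_left_mono)
  qed
  have ikg: "integrable lborel (\<lambda>y. k y *\<^sub>R w y)" if "integrable lborel w" for w :: "'a \<Rightarrow> 'a"
    by (rule integrable_bounded_mult[OF that _ kB(1)]) measurable
  have L: "grad (conv \<kappa> v) x \<bullet> b = - (LINT y|lborel. (grad k y \<bullet> b) *\<^sub>R v y)"
  proof -
    have "grad (conv \<kappa> v) x = (LINT y|lborel. - (v y *\<^sub>R grad k y))"
      using gradI(2)[OF conv_has_derivative[OF \<kappa> iv]] by (simp add: k(2))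
    also have "\<dots> = - (LINT y|lborel. v y *\<^sub>R grad k y)" by simp
    finally have "grad (conv \<kappa> v) x \<bullet> b = - ((LINT y|lborel. v y *\<^sub>R grad k y) \<bullet> b)" by simp
    then show ?thesis using integral_inner_left[OF ik[OF iv], of b] by (simp add: mult.commute)
  qed
  have R: "conv \<kappa> g x = (LINT y|lborel. k y *\<^sub>R g y)" by (simp add: conv_def k_def)
  have "\<bar>grad (conv \<kappa> v) x \<bullet> b - conv \<kappa> g x \<bullet> b\<bar> \<le> 0 + \<epsilon>" if "\<epsilon> > 0" for \<epsilon>
  proof -
    define \<eta> where "\<eta> = \<epsilon> / (2 * B)"
    have \<eta>: "\<eta> > 0" "B * \<eta> + B * \<eta> = \<epsilon>" using that B(1) by (auto simp: \<eta>_def)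
    then obtain f where f: "C1c f" "L1d v f < ennreal \<eta>" "L1d g (grad f) < ennreal \<eta>"
      using v unfolding approx_pair_def by metis
    have 1: "norm ((LINT y|lborel. (grad k y \<bullet> b) *\<^sub>R v y) - (LINT y|lborel. (grad k y \<bullet> b) *\<^sub>R f y)) \<le> B * \<eta>"
      by (rule norm_integral_diff_le[OF iv C1c_integrable(1)[OF f(1)] _ kB(2) f(2) \<eta>(1)]) measurable
    have "norm ((LINT y|lborel. k y *\<^sub>R g y) - (LINT y|lborel. k y *\<^sub>R grad f y)) \<le> B * \<eta>"
      by (rule norm_integral_diff_le[OF ig C1c_integrable(2)[OF f(1)] _ kB(1) f(3) \<eta>(1)]) measurable
    then have 2: "\<bar>(LINT y|lborel. k y *\<^sub>R g y) \<bullet> b - (LINT y|lborel. k y *\<^sub>R grad f y) \<bullet> b\<bar> \<le> B * \<eta>"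
      using Basis_le_norm[OF b, of "(LINT y|lborel. k y *\<^sub>R g y) - (LINT y|lborel. k y *\<^sub>R grad f y)"]
      by (simp add: inner_diff_left)
    have "(LINT y|lborel. (grad k y \<bullet> b) *\<^sub>R f y) = (LINT y|lborel. (f y *\<^sub>R grad k y) \<bullet> b)" by (simp add: mult.commute)
    also have "\<dots> = (LINT y|lborel. f y *\<^sub>R grad k y) \<bullet> b"
      by (rule integral_inner_left) (rule ik[OF C1c_integrable(1)[OF f(1)]])
    also have "\<dots> = - ((LINT y|lborel. k y *\<^sub>R grad f y) \<bullet> b)"
      by (simp add: integration_by_parts[OF f(1) k(1)])
    finally show ?thesis using 1 2 \<eta>(2) by (simp add: L R)
  qed
  then have "\<bar>grad (conv \<kappa> v) x \<bullet> b - conv \<kappa> g x \<bullet> b\<bar> \<le> 0" by (rule field_le_epsilon)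
  then show "grad (conv \<kappa> v) x \<bullet> b = conv \<kappa> g x \<bullet> b" by simp
qed

lemma L1d_finite:
  assumes "integrable lborel f" "integrable lborel g"
  shows "L1d f g = ennreal (LINT x|lborel. norm (f x - g x))"
  using assms by (intro nn_integral_eq_integral) auto

lemma L1d_AE_subseq:
  fixes v :: "'a::euclidean_space \<Rightarrow> 'b::euclidean_space"
  assumes v: "integrable lborel v" and f: "\<And>n. integrable lborel (f n)" and lim: "(\<lambda>n. L1d v (f n)) \<longlonglongrightarrow> 0"
  shows "\<exists>r. strict_mono r \<and> (AE x in lborel. (\<lambda>n. f (r n) x) \<longlonglongrightarrow> v x)"
proof -
  have "(\<lambda>n. ennreal (LINT x|lborel. norm (v x - f n x))) \<longlonglongrightarrow> ennreal 0"
    using lim by (simp add: L1d_finite[OF v f])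
  then have "(\<lambda>n. LINT x|lborel. norm (v x - f n x)) \<longlonglongrightarrow> 0"
    by (subst (asm) tendsto_ennreal_iff) auto
  then obtain r where r: "strict_mono (r::nat\<Rightarrow>nat)" "AE x in lborel. (\<lambda>n. v x - f (r n) x) \<longlonglongrightarrow> 0"
    using tendsto_L1_AE_subseq[of lborel "\<lambda>n x. v x - f n x"] v f by auto
  have "AE x in lborel. (\<lambda>n. f (r n) x) \<longlonglongrightarrow> v x" using r(2)
  proof (rule eventually_mono)
    fix x assume "(\<lambda>n. v x - f (r n) x) \<longlonglongrightarrow> 0"
    then have "(\<lambda>n. v x - (v x - f (r n) x)) \<longlonglongrightarrow> v x - 0" by (intro tendsto_intros)
    then show "(\<lambda>n. f (r n) x) \<longlonglongrightarrow> v x" by simp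
  qed
  then show ?thesis using r(1) by blast
qed

lemma ennreal_tendsto_0_le:
  fixes a b :: "nat \<Rightarrow> ennreal"
  assumes "b \<longlonglongrightarrow> 0" "\<And>n. a n \<le> b n"
  shows "a \<longlonglongrightarrow> 0"
  by (rule tendsto_sandwich[OF _ _ tendsto_const assms(1)]) (use assms(2) in auto)

text \<open>Pointwise convergence is extracted for the functions only; the chain rule uses it for
  the factor \<tau>'(f_n), while the gradients are handled in L^1.\<close>

lemma approx_pair_seq:
  assumes "approx_pair v g"
  shows "\<exists>f. (\<forall>n. C1c (f n)) \<and> (\<lambda>n. L1d v (f n)) \<longlonglongrightarrow> 0 \<and> (\<lambda>n. L1d g (grad (f n))) \<longlonglongrightarrow> 0 \<and>
    (AE x in lborel. (\<lambda>n. f n x) \<longlonglongrightarrow> v x)"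
proof -
  have iv: "integrable lborel v" and ig: "integrable lborel g" using assms by (auto simp: approx_pair_def)
  have "\<exists>f. C1c f \<and> L1d v f < ennreal (1 / Suc n) \<and> L1d g (grad f) < ennreal (1 / Suc n)" for n
    using assms unfolding approx_pair_def by simp
  then obtain f where f: "\<And>n. C1c (f n)" "\<And>n. L1d v (f n) < ennreal (1 / Suc n)" "\<And>n. L1d g (grad (f n)) < ennreal (1 / Suc n)"
    by metis
  have z: "(\<lambda>n. ennreal (1 / Suc n)) \<longlonglongrightarrow> 0"
    using tendsto_ennrealI[OF LIMSEQ_Suc[OF lim_1_over_n]] by simp
  have 1: "(\<lambda>n. L1d v (f n)) \<longlonglongrightarrow> 0" "(\<lambda>n. L1d g (grad (f n))) \<longlonglongrightarrow> 0"
    by (rule ennreal_tendsto_0_le[OF z less_imp_le[OF f(2)]], rule ennreal_tendsto_0_le[OF z less_imp_le[OF f(3)]])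
  obtain r where r: "strict_mono r" "AE x in lborel. (\<lambda>n. f (r n) x) \<longlonglongrightarrow> v x"
    using L1d_AE_subseq[OF iv C1c_integrable(1)[OF f(1)] 1(1)] by blast
  show ?thesis
    by (rule exI[of _ "\<lambda>n. f (r n)"])
      (use f(1) r LIMSEQ_subseq_LIMSEQ[OF 1(1) r(1)] LIMSEQ_subseq_LIMSEQ[OF 1(2) r(1)] in \<open>simp add: o_def\<close>)
qed

lemma approx_pairI_seq:
  assumes "integrable lborel v" "integrable lborel g" "\<And>n. C1c (f n)"
    and lim: "(\<lambda>n. L1d v (f n)) \<longlonglongrightarrow> 0" "(\<lambda>n. L1d g (grad (f n))) \<longlonglongrightarrow> 0"
  shows "approx_pair v g"
  unfolding approx_pair_def
proof (intro conjI allI impI)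
  fix \<epsilon> :: real assume e: "\<epsilon> > 0"
  have "eventually (\<lambda>n. L1d v (f n) < ennreal \<epsilon> \<and> L1d g (grad (f n)) < ennreal \<epsilon>) sequentially"
    by (intro eventually_conj order_tendstoD(2)[OF lim(1)] order_tendstoD(2)[OF lim(2)]) (use e in auto)
  then obtain n where "L1d v (f n) < ennreal \<epsilon> \<and> L1d g (grad (f n)) < ennreal \<epsilon>"
    unfolding eventually_sequentially by blast
  then show "\<exists>f. C1c f \<and> L1d v f < ennreal \<epsilon> \<and> L1d g (grad f) < ennreal \<epsilon>" using assms(3) by blast
qed (fact assms)+

text \<open>The error \<tau>'(v) g - \<tau>'(f_n) grad f_n is split at \<tau>'(f_n) g. The first
  part tends to 0 by dominated convergence with dominating function |g|; the second is at most the
  L^1 distance of the gradients, as |\<tau>'| is at most 1.\<close>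

lemma approx_pair_compose:
  fixes \<tau> \<tau>' :: "real \<Rightarrow> real"
  assumes v: "approx_pair v g"
    and \<tau>: "\<And>t. (\<tau> has_real_derivative \<tau>' t) (at t)" "continuous_on UNIV \<tau>'" "\<tau> 0 = 0" "\<And>t. \<bar>\<tau>' t\<bar> \<le> 1"
  shows "approx_pair (\<lambda>x. \<tau> (v x)) (\<lambda>x. \<tau>' (v x) *\<^sub>R g x)"
proof -
  have iv: "integrable lborel v" and ig: "integrable lborel g" using v by (auto simp: approx_pair_def)
  have [measurable]: "v \<in> borel_measurable borel" "g \<in> borel_measurable borel" using iv ig by auto
  have [measurable]: "\<tau>' \<in> borel_measurable borel" by (rule borel_measurable_continuous_onI[OF \<tau>(2)])
  have "continuous_on UNIV \<tau>" by (rule DERIV_continuous_on) (rule has_field_derivative_at_within[OF \<tau>(1)])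
  then have [measurable]: "\<tau> \<in> borel_measurable borel" by (rule borel_measurable_continuous_onI)
  have lip: "\<bar>\<tau> a - \<tau> b\<bar> \<le> \<bar>a - b\<bar>" for a b
    using field_differentiable_bound[of UNIV \<tau> \<tau>' 1 a b] \<tau>(1,4) by (simp add: has_field_derivative_at_within)
  obtain f where f: "\<And>n. C1c (f n)" "(\<lambda>n. L1d v (f n)) \<longlonglongrightarrow> 0" "(\<lambda>n. L1d g (grad (f n))) \<longlonglongrightarrow> 0"
    "AE x in lborel. (\<lambda>n. f n x) \<longlonglongrightarrow> v x"
    using approx_pair_seq[OF v] by auto
  note [measurable] = C1c_measurable[OF f(1)]
  have cf: "C1c (\<lambda>x. \<tau> (f n x))" "grad (\<lambda>x. \<tau> (f n x)) = (\<lambda>x. \<tau>' (f n x) *\<^sub>R grad (f n) x)" for n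
    using C1c_compose[OF f(1) \<tau>(1-3)] by auto
  have i1: "integrable lborel (\<lambda>x. \<tau> (v x))"
  proof (rule Bochner_Integration.integrable_bound[OF iv])
    show "AE x in lborel. norm (\<tau> (v x)) \<le> norm (v x)" using lip[of _ 0] \<tau>(3) by auto
  qed measurable
  have i2: "integrable lborel (\<lambda>x. \<tau>' (v x) *\<^sub>R g x)"
    by (rule integrable_bounded_mult[OF ig _ \<tau>(4)]) measurable
  show ?thesis
  proof (rule approx_pairI_seq[OF i1 i2 cf(1)])
    show "(\<lambda>n. L1d (\<lambda>x. \<tau> (v x)) (\<lambda>x. \<tau> (f n x))) \<longlonglongrightarrow> 0"
      by (rule ennreal_tendsto_0_le[OF f(2)]) (auto intro!: nn_integral_mono ennreal_leI lip)
    have A: "(\<lambda>n. L1d (\<lambda>x. \<tau>' (v x) *\<^sub>R g x) (\<lambda>x. \<tau>' (f n x) *\<^sub>R g x)) \<longlonglongrightarrow> 0"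
    proof (rule nn_integral_dominated_convergence_norm[where w="\<lambda>x. norm (g x)"])
      show "AE x in lborel. norm (\<tau>' (f n x) *\<^sub>R g x) \<le> norm (g x)" for n
        using \<tau>(4) by (auto intro!: AE_I2 mult_left_le_one_le)
      show "(\<integral>\<^sup>+x. ennreal (norm (g x)) \<partial>lborel) < \<infinity>" using ig unfolding integrable_iff_bounded by simp
      show "AE x in lborel. (\<lambda>n. \<tau>' (f n x) *\<^sub>R g x) \<longlonglongrightarrow> \<tau>' (v x) *\<^sub>R g x"
        using f(4)
      proof (rule eventually_mono)
        fix x assume "(\<lambda>n. f n x) \<longlonglongrightarrow> v x"
        moreover have "isCont \<tau>' (v x)" using \<tau>(2) by (simp add: continuous_on_eq_continuous_at)
        ultimately have "(\<lambda>n. \<tau>' (f n x)) \<longlonglongrightarrow> \<tau>' (v x)" using isCont_tendsto_compose by blast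
        then show "(\<lambda>n. \<tau>' (f n x) *\<^sub>R g x) \<longlonglongrightarrow> \<tau>' (v x) *\<^sub>R g x" by (intro tendsto_intros)
      qed
    qed measurable
    have B: "L1d (\<lambda>x. \<tau>' (f n x) *\<^sub>R g x) (\<lambda>x. \<tau>' (f n x) *\<^sub>R grad (f n) x) \<le> L1d g (grad (f n))" for n
      by (intro nn_integral_mono ennreal_leI)
        (use \<tau>(4) in \<open>auto simp flip: scaleR_diff_right intro!: mult_left_le_one_le\<close>)
    have C: "L1d (\<lambda>x. \<tau>' (v x) *\<^sub>R g x) (\<lambda>x. \<tau>' (f n x) *\<^sub>R grad (f n) x) \<le>
      L1d (\<lambda>x. \<tau>' (v x) *\<^sub>R g x) (\<lambda>x. \<tau>' (f n x) *\<^sub>R g x) + L1d g (grad (f n))" for n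
      by (rule order_trans[OF L1d_triangle[where g="\<lambda>x. \<tau>' (f n x) *\<^sub>R g x"] add_left_mono[OF B]]) measurable
    have "(\<lambda>n. L1d (\<lambda>x. \<tau>' (v x) *\<^sub>R g x) (\<lambda>x. \<tau>' (f n x) *\<^sub>R g x) + L1d g (grad (f n))) \<longlonglongrightarrow> 0 + 0"
      by (intro tendsto_add A f(3))
    then show "(\<lambda>n. L1d (\<lambda>x. \<tau>' (v x) *\<^sub>R g x) (grad (\<lambda>x. \<tau> (f n x)))) \<longlonglongrightarrow> 0"
      unfolding cf(2) by (intro ennreal_tendsto_0_le[OF _ C]) simp
  qed
qed

text \<open>The cutoff and its gradient are bounded by one constant B, so every error term is at
  most B times a given L^1 distance.\<close>

lemma approx_pair_mult:
  assumes v: "approx_pair v g" and \<eta>: "C1c \<eta>"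
  shows "approx_pair (\<lambda>x. \<eta> x * v x) (\<lambda>x. \<eta> x *\<^sub>R g x + v x *\<^sub>R grad \<eta> x)"
proof -
  have iv: "integrable lborel v" and ig: "integrable lborel g" using v by (auto simp: approx_pair_def)
  have [measurable]: "v \<in> borel_measurable borel" "g \<in> borel_measurable borel" using iv ig by auto
  note [measurable] = C1c_measurable[OF \<eta>]
  obtain B where B: "B > 0" "\<And>x. \<bar>\<eta> x\<bar> \<le> B" "\<And>x. norm (grad \<eta> x) \<le> B" using C1c_bounded[OF \<eta>] by metis
  obtain f where f: "\<And>n. C1c (f n)" "(\<lambda>n. L1d v (f n)) \<longlonglongrightarrow> 0" "(\<lambda>n. L1d g (grad (f n))) \<longlonglongrightarrow> 0"
    "AE x in lborel. (\<lambda>n. f n x) \<longlonglongrightarrow> v x"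
    using approx_pair_seq[OF v] by auto
  note [measurable] = C1c_measurable[OF f(1)]
  have i1: "integrable lborel (\<lambda>x. \<eta> x * v x)" using integrable_bounded_mult[OF iv _ B(2)] by simp
  have i2: "integrable lborel (\<lambda>x. \<eta> x *\<^sub>R g x)" by (rule integrable_bounded_mult[OF ig _ B(2)]) measurable
  have i3: "integrable lborel (\<lambda>x. v x *\<^sub>R grad \<eta> x)"
  proof (rule Bochner_Integration.integrable_bound)
    show "integrable lborel (\<lambda>y. B * norm (v y))" using iv by simp
    show "AE y in lborel. norm (v y *\<^sub>R grad \<eta> y) \<le> norm (B * norm (v y))"
      using B by (auto simp: mult.commute[of B] intro!: mult_left_mono)
  qed measurable
  show ?thesis
  proof (rule approx_pairI_seq[OF i1 Bochner_Integration.integrable_add[OF i2 i3] C1c_mult(1)[OF \<eta> f(1)]])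
    have e1: "L1d (\<lambda>x. \<eta> x * v x) (\<lambda>x. \<eta> x * f n x) \<le> ennreal B * L1d v (f n)" for n
    proof -
      have "L1d (\<lambda>x. \<eta> x * v x) (\<lambda>x. \<eta> x * f n x) \<le> (\<integral>\<^sup>+x. ennreal B * ennreal (norm (v x - f n x)) \<partial>lborel)"
      proof (rule nn_integral_mono)
        fix x
        have "norm (\<eta> x * v x - \<eta> x * f n x) \<le> B * norm (v x - f n x)"
          using B(2)[of x] by (simp add: abs_mult mult_right_mono flip: right_diff_distrib)
        then show "ennreal (norm (\<eta> x * v x - \<eta> x * f n x)) \<le> ennreal B * ennreal (norm (v x - f n x))"
          using B(1) by (simp add: ennreal_leI flip: ennreal_mult)
      qed
      also have "\<dots> = ennreal B * L1d v (f n)" by (rule nn_integral_cmult) measurable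
      finally show ?thesis .
    qed
    have z1: "(\<lambda>n. ennreal B * L1d v (f n)) \<longlonglongrightarrow> 0"
      using ennreal_tendsto_cmult[OF _ f(2), of "ennreal B"] by simp
    then show "(\<lambda>n. L1d (\<lambda>x. \<eta> x * v x) (\<lambda>x. \<eta> x * f n x)) \<longlonglongrightarrow> 0"
      by (rule ennreal_tendsto_0_le[OF _ e1])
    have e2: "L1d (\<lambda>x. \<eta> x *\<^sub>R g x + v x *\<^sub>R grad \<eta> x) (\<lambda>x. \<eta> x *\<^sub>R grad (f n) x + f n x *\<^sub>R grad \<eta> x) \<le> ennreal B * L1d g (grad (f n)) + ennreal B * L1d v (f n)" for n
    proof -
      have "L1d (\<lambda>x. \<eta> x *\<^sub>R g x + v x *\<^sub>R grad \<eta> x) (\<lambda>x. \<eta> x *\<^sub>R grad (f n) x + f n x *\<^sub>R grad \<eta> x) \<le>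
        (\<integral>\<^sup>+x. ennreal B * ennreal (norm (g x - grad (f n) x)) + ennreal B * ennreal (norm (v x - f n x)) \<partial>lborel)"
      proof (rule nn_integral_mono)
        fix x
        have "norm ((\<eta> x *\<^sub>R g x + v x *\<^sub>R grad \<eta> x) - (\<eta> x *\<^sub>R grad (f n) x + f n x *\<^sub>R grad \<eta> x)) \<le>
            norm (\<eta> x *\<^sub>R g x - \<eta> x *\<^sub>R grad (f n) x) + norm (v x *\<^sub>R grad \<eta> x - f n x *\<^sub>R grad \<eta> x)"
          by (rule norm_diff_triangle_ineq)
        also have "\<dots> = \<bar>\<eta> x\<bar> * norm (g x - grad (f n) x) + \<bar>v x - f n x\<bar> * norm (grad \<eta> x)"
          by (simp flip: scaleR_diff_right scaleR_diff_left)
        also have "\<dots> \<le> B * norm (g x - grad (f n) x) + B * norm (v x - f n x)"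
          using mult_right_mono[OF B(2)[of x] norm_ge_zero[of "g x - grad (f n) x"]]
            mult_left_mono[OF B(3)[of x] abs_ge_zero[of "v x - f n x"]] by (simp add: mult.commute[of B])
        finally show "ennreal (norm ((\<eta> x *\<^sub>R g x + v x *\<^sub>R grad \<eta> x) - (\<eta> x *\<^sub>R grad (f n) x + f n x *\<^sub>R grad \<eta> x))) \<le> ennreal B * ennreal (norm (g x - grad (f n) x)) + ennreal B * ennreal (norm (v x - f n x))"
          using B(1) by (simp add: ennreal_leI flip: ennreal_mult ennreal_plus)
      qed
      also have "\<dots> = ennreal B * L1d g (grad (f n)) + ennreal B * L1d v (f n)"
        by (simp add: nn_integral_add nn_integral_cmult)
      finally show ?thesis .
    qed
    have z2: "(\<lambda>n. ennreal B * L1d g (grad (f n)) + ennreal B * L1d v (f n)) \<longlonglongrightarrow> 0"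
      using tendsto_add[OF ennreal_tendsto_cmult[OF _ f(3), of "ennreal B"] z1] by simp
    then show "(\<lambda>n. L1d (\<lambda>x. \<eta> x *\<^sub>R g x + v x *\<^sub>R grad \<eta> x) (grad (\<lambda>x. \<eta> x * f n x))) \<longlonglongrightarrow> 0"
      unfolding C1c_mult(2)[OF \<eta> f(1)]
      by (rule ennreal_tendsto_0_le[OF _ e2])
  qed
qed

subsection \<open>Localisation in a Lipschitz domain\<close>

lemma DERIV_positive_part_square:
  "((\<lambda>t::real. (max 0 t)\<^sup>2) has_real_derivative 2 * max 0 t) (at t)"
proof -
  consider "t > 0" | "t < 0" | "t = 0" by linarith
  then show ?thesis
  proof cases
    case 1
    have "((\<lambda>t::real. t\<^sup>2) has_real_derivative 2 * max 0 t) (at t)"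
      using 1 by (auto intro!: derivative_eq_intros)
    then show ?thesis
      by (rule has_field_derivative_transform_within_open[of _ _ _ "{0<..}"]) (use 1 in auto)
  next
    case 2
    have "((\<lambda>t::real. 0) has_real_derivative 2 * max 0 t) (at t)"
      using 2 by (auto intro!: derivative_eq_intros)
    then show ?thesis
      by (rule has_field_derivative_transform_within_open[of _ _ _ "{..<0}"]) (use 2 in auto)
  next
    case 3
    have "((\<lambda>h::real. (max 0 h)\<^sup>2 / h) \<longlongrightarrow> 0) (at 0)"
    proof (rule Lim_null_comparison)
      show "eventually (\<lambda>h::real. norm ((max 0 h)\<^sup>2 / h) \<le> \<bar>h\<bar>) (at 0)"
        by (rule always_eventually) (auto simp: max_def power2_eq_square)
      show "((\<lambda>h::real. \<bar>h\<bar>) \<longlongrightarrow> 0) (at 0)" by (intro tendsto_eq_intros) auto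
    qed
    then show ?thesis using 3 by (simp add: has_field_derivative_iff)
  qed
qed

text \<open>A C^1 function on the whole line that is 1/t from m on. It is the reciprocal of u(t) = t
  + max(0, m - t)^2 / m, which equals t for t at least m and never vanishes. It allows division by a
  function that is bounded below only on a compact set.\<close>

lemma C1_reciprocal:
  fixes m :: real
  assumes "m > 0"
  obtains R R' where "\<And>t. (R has_real_derivative R' t) (at t)" "continuous_on UNIV R'" "\<And>t. t \<ge> m \<Longrightarrow> R t = 1 / t"
proof -
  define u where "u t = t + (max 0 (m - t))\<^sup>2 / m" for t
  define u' where "u' t = 1 - 2 * max 0 (m - t) / m" for t
  have pos: "u t > 0" for t
  proof (cases "t \<ge> m")
    case True
    then show ?thesis using assms by (simp add: u_def)
  next
    case False
    \<comment> \<open>Completing the square in m t + (m - t)^2 = t^2 - m t + m^2.\<close>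
    have "0 < (m / 2)\<^sup>2 + (t - m / 2)\<^sup>2 + m\<^sup>2 / 2" using assms by (intro add_nonneg_pos) auto
    then have "0 < m * t + (m - t)\<^sup>2" by (simp add: power2_eq_square algebra_simps)
    then have "0 < (m * t + (m - t)\<^sup>2) / m" using assms by simp
    then show ?thesis using False assms by (simp add: u_def field_simps)
  qed
  have du: "(u has_real_derivative u' t) (at t)" for t
  proof -
    have "((\<lambda>t. (max 0 (m - t))\<^sup>2) has_real_derivative (2 * max 0 (m - t)) * (-1)) (at t)"
      by (rule DERIV_chain2[OF DERIV_positive_part_square]) (auto intro!: derivative_eq_intros)
    then have "((\<lambda>t. t + (max 0 (m - t))\<^sup>2 / m) has_real_derivative 1 + (2 * max 0 (m - t)) * (-1) / m) (at t)"
      by (intro DERIV_add DERIV_ident DERIV_cdivide)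
    then show ?thesis by (simp add: u_def[abs_def] u'_def)
  qed
  have cu: "continuous_on UNIV u" by (rule DERIV_continuous_on) (rule has_field_derivative_at_within[OF du])
  show ?thesis
  proof (rule that[of "\<lambda>t. inverse (u t)" "\<lambda>t. - (u' t * inverse ((u t)\<^sup>2))"])
    show "((\<lambda>t. inverse (u t)) has_real_derivative - (u' t * inverse ((u t)\<^sup>2))) (at t)" for t
      using DERIV_inverse_fun[OF du, of t] pos[of t] by (simp add: power2_eq_square)
    show "continuous_on UNIV (\<lambda>t. - (u' t * inverse ((u t)\<^sup>2)))"
      unfolding u'_def using pos by (intro continuous_intros cu) (auto simp: less_imp_neq[THEN not_sym] assms)
    show "inverse (u t) = 1 / t" if "t \<ge> m" for t using that by (simp add: u_def inverse_eq_divide)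
  qed
qed

text \<open>Bumps over a finite subcover are normalised by their sum S. Since S vanishes far away,
  1/S is replaced by R(S), where R agrees with the reciprocal above the minimum of S on K. The
  result is only of class C^1, which is all that the product rule for pairs needs.\<close>

lemma partition_of_unity:
  fixes K :: "'a::euclidean_space set"
  assumes K: "compact K" and s: "\<And>x. x \<in> K \<Longrightarrow> s x > (0::real)"
  shows "\<exists>X \<eta>. finite X \<and> X \<subseteq> K \<and> (\<forall>x\<in>X. C1c (\<eta> x) \<and> (\<forall>y. y \<notin> cball x (s x) \<longrightarrow> \<eta> x y = 0)) \<and>
    (\<forall>y\<in>K. (\<Sum>x\<in>X. \<eta> x y) = (1::real))"
proof (cases "K = {}")
  case True
  then show ?thesis by (intro exI[of _ "{}"]) simp
next
  case False
  have "K \<subseteq> (\<Union>x\<in>K. ball x (s x))" using s by auto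
  then obtain X where X: "X \<subseteq> K" "finite X" "K \<subseteq> (\<Union>x\<in>X. ball x (s x))"
    by (rule compactE_image[OF K, rotated]) auto
  define S where "S y = (\<Sum>x\<in>X. bump x (s x) y)" for y
  have b: "C1c (bump x (s x))" if "x \<in> X" for x
    using that X(1) s by (intro Cc_infinity_C1c[OF bump_Cc_infinity]) auto
  have S: "C1c S" unfolding S_def[abs_def] using C1c_sum[OF X(2) b] by simp
  have Spos: "S y > 0" if yK: "y \<in> K" for y
  proof -
    obtain x where x: "x \<in> X" "y \<in> ball x (s x)" using X(3) yK by blast
    have "bump x (s x) y > 0" using bump_pos_iff[of "s x" x y] x X(1) s by auto
    then show ?thesis unfolding S_def
      by (intro sum_pos2[OF X(2) x(1)]) (auto simp: bump_nonneg)
  qed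
  obtain y0 where y0: "y0 \<in> K" "\<And>y. y \<in> K \<Longrightarrow> S y0 \<le> S y"
    using continuous_attains_inf[OF K False C1c_continuous[OF S]] by blast
  obtain R R' where R: "\<And>t. (R has_real_derivative R' t) (at t)" "continuous_on UNIV R'" "\<And>t. t \<ge> S y0 \<Longrightarrow> R t = 1 / t"
    using C1_reciprocal[OF Spos[OF y0(1)]] by metis
  \<comment> \<open>The product bump * R(S) is split because R need not vanish at 0: R(S) has no
    bounded support, whereas R(S) - R(0) has.\<close>
  define \<eta> where "\<eta> x y = bump x (s x) y * (R (S y) - R 0) + R 0 * bump x (s x) y" for x y
  have \<eta>: "\<eta> x y = bump x (s x) y * R (S y)" for x y by (simp add: \<eta>_def algebra_simps)
  have "C1c (\<eta> x)" if "x \<in> X" for x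
  proof -
    have 1: "C1c (\<lambda>y. R (S y) - R 0)"
      by (rule C1c_compose(1)[where \<tau>="\<lambda>t. R t - R 0" and \<tau>'=R', OF S _ R(2)])
        (use DERIV_diff[OF R(1) DERIV_const] in auto)
    have 2: "C1c (\<lambda>y. R 0 * bump x (s x) y)"
      by (rule C1c_compose(1)[where \<tau>="\<lambda>t. R 0 * t" and \<tau>'="\<lambda>t. R 0", OF b[OF that]])
        (use DERIV_cmult[OF DERIV_ident] in auto)
    show ?thesis unfolding \<eta>_def by (rule C1c_add(1)[OF C1c_mult(1)[OF b[OF that] 1] 2])
  qed
  moreover have "\<eta> x y = 0" if "x \<in> X" "y \<notin> cball x (s x)" for x y
    using bump_outside[of "s x" y x] that X(1) s by (auto simp: \<eta>)
  moreover have "(\<Sum>x\<in>X. \<eta> x y) = 1" if "y \<in> K" for y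
  proof -
    have "(\<Sum>x\<in>X. \<eta> x y) = S y * R (S y)" by (simp add: \<eta> S_def sum_distrib_right)
    then show ?thesis using R(3)[OF y0(2)[OF that]] Spos[OF that] by simp
  qed
  ultimately show ?thesis using X by (intro exI[of _ X] exI[of _ \<eta>]) auto
qed

text \<open>Points of \<open>closure \<Omega>\<close> near \<open>x0\<close> are moved into \<open>\<Omega>\<close> by all small multiples of the vectors close to a
  transversal direction \<open>e\<close>; this lets a mollifier supported near \<open>e\<close> preserve compact support.\<close>

definition inward :: "'a::euclidean_space set \<Rightarrow> 'a \<Rightarrow> real \<Rightarrow> 'a \<Rightarrow> real \<Rightarrow> real \<Rightarrow> bool" where
  "inward \<Omega> x0 s e r \<gamma>0 \<longleftrightarrow> s > 0 \<and> r > 0 \<and> r \<le> 1 \<and> \<gamma>0 > 0 \<and> norm e \<le> 1 \<and>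
     (\<forall>x\<in>cball x0 s \<inter> closure \<Omega>. \<forall>z\<in>cball e r. \<forall>t. 0 < t \<and> t < \<gamma>0 \<longrightarrow> x + t *\<^sub>R z \<in> \<Omega>)"

text \<open>At an interior point e = 0 and r = 1 work, as every short displacement stays inside. At
  a boundary point e is the axis of the Lipschitz epigraph: a step t z with |z - e| at most r raises
  the height over the hyperplane by at least t (1 - r), and the graph function changes by at most 2
  L r t.\<close>

lemma inward_exists:
  fixes \<Omega> :: "'a::euclidean_space set"
  assumes \<Omega>: "bounded_lipschitz_domain \<Omega>" and x0: "x0 \<in> closure \<Omega>"
  shows "\<exists>s e r \<gamma>0. inward \<Omega> x0 s e r \<gamma>0"
proof (cases "x0 \<in> \<Omega>")
  case True
  have "open \<Omega>" using \<Omega> by (simp add: bounded_lipschitz_domain_def)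
  then obtain R where R: "R > 0" "ball x0 R \<subseteq> \<Omega>" using True open_contains_ball by blast
  have "inward \<Omega> x0 (R/2) 0 1 (R/2)"
    unfolding inward_def
  proof (intro conjI ballI allI impI)
    fix x z t assume x: "x \<in> cball x0 (R/2) \<inter> closure \<Omega>" and z: "z \<in> cball (0::'a) 1" and t: "0 < t \<and> t < R/2"
    have "norm (t *\<^sub>R z) \<le> t" using z t by (simp add: mult_left_le)
    then have "dist x0 (x + t *\<^sub>R z) < R"
      using x t norm_triangle_ineq4[of "x0 - x" "t *\<^sub>R z"] by (simp del: norm_scaleR add: dist_norm diff_diff_eq)
    then show "x + t *\<^sub>R z \<in> \<Omega>" using R by auto
  qed (use R in auto)
  then show ?thesis by blast
next
  case False
  have "open \<Omega>" using \<Omega> by (simp add: bounded_lipschitz_domain_def)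
  then have "x0 \<in> frontier \<Omega>" using x0 False by (simp add: frontier_def interior_open)
  moreover have "\<forall>x0\<in>frontier \<Omega>. \<exists>r>0. \<exists>e. \<exists>L. \<exists>g::'a \<Rightarrow> real.
        norm e = 1 \<and> L-lipschitz_on {y. y \<bullet> e = 0} g \<and>
        \<Omega> \<inter> ball x0 r = {x \<in> ball x0 r. g (x - (x \<bullet> e) *\<^sub>R e) < x \<bullet> e}"
    using \<Omega> unfolding bounded_lipschitz_domain_def by (elim conjE)
  ultimately have "\<exists>r>0. \<exists>e. \<exists>L. \<exists>g::'a \<Rightarrow> real.
        norm e = 1 \<and> L-lipschitz_on {y. y \<bullet> e = 0} g \<and>
        \<Omega> \<inter> ball x0 r = {x \<in> ball x0 r. g (x - (x \<bullet> e) *\<^sub>R e) < x \<bullet> e}"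
    by (rule bspec[rotated])
  then obtain \<rho> e L g where \<rho>: "\<rho> > 0" and e: "norm e = 1" and g: "L-lipschitz_on {y. y \<bullet> e = 0} (g::'a \<Rightarrow> real)"
    and eq: "\<Omega> \<inter> ball x0 \<rho> = {x \<in> ball x0 \<rho>. g (x - (x \<bullet> e) *\<^sub>R e) < x \<bullet> e}"
    by (elim exE conjE) (rule that)
  have ee: "e \<bullet> e = 1" using e by (simp add: dot_square_norm)
  have L: "L \<ge> 0" using g by (rule lipschitz_on_nonneg)
  define P where "P x = x - (x \<bullet> e) *\<^sub>R e" for x
  have P: "P x \<in> {y. y \<bullet> e = 0}" for x by (simp add: P_def inner_diff_left ee)
  have cP: "continuous_on UNIV P" unfolding P_def by (intro continuous_intros)
  have cg: "continuous_on UNIV (\<lambda>x. g (P x))"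
    by (rule continuous_on_compose2[OF lipschitz_on_continuous_on[OF g] cP]) (use P in auto)
  \<comment> \<open>Chosen so that (2 L + 2) r = 1, that is 2 L r = 1 - 2 r, which leaves a strict
    gain of height.\<close>
  define r where "r = 1 / (2 * L + 2)"
  have r: "r > 0" "r \<le> 1" "2 * L * r < 1 - r"
  proof -
    show "r > 0" "r \<le> 1" using L by (auto simp: r_def)
    have "(2 * L + 2) * r = 1" using L by (simp add: r_def)
    then have "2 * L * r + r = 1 - r" by (simp add: algebra_simps)
    then show "2 * L * r < 1 - r" using \<open>r > 0\<close> by linarith
  qed
  \<comment> \<open>The directions have norm at most 2, so steps with t below \<rho>/4 are shorter
    than \<rho>/2 and remain in the ball where the epigraph describes \<Omega>.\<close>
  have "inward \<Omega> x0 (\<rho>/2) e r (\<rho>/4)"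
    unfolding inward_def
  proof (intro conjI ballI allI impI)
    fix x z t assume x: "x \<in> cball x0 (\<rho>/2) \<inter> closure \<Omega>" and z: "z \<in> cball e r" and t: "0 < t \<and> t < \<rho>/4"
    have xb: "x \<in> ball x0 \<rho>" using x \<rho> by auto
    \<comment> \<open>In the closure only the weak inequality survives; the strict one is produced
      by the displacement.\<close>
    have le: "g (P x) \<le> x \<bullet> e"
    proof -
      have "closed {y. g (P y) \<le> y \<bullet> e}" by (intro closed_Collect_le cg continuous_intros)
      moreover have "\<Omega> \<inter> ball x0 \<rho> \<subseteq> {y. g (P y) \<le> y \<bullet> e}" unfolding eq P_def by auto
      ultimately have "closure (\<Omega> \<inter> ball x0 \<rho>) \<subseteq> {y. g (P y) \<le> y \<bullet> e}" by (rule closure_minimal[rotated])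
      moreover have "x \<in> closure (\<Omega> \<inter> ball x0 \<rho>)"
        using open_Int_closure_subset[of "ball x0 \<rho>" \<Omega>] x xb by (auto simp: Int_commute)
      ultimately show ?thesis by blast
    qed
    define w where "w = z - e"
    have w: "norm w \<le> r" "z = e + w" using z by (auto simp: w_def dist_norm norm_minus_commute)
    have we: "\<bar>w \<bullet> e\<bar> \<le> r" using Cauchy_Schwarz_ineq2[of w e] w(1) e by simp
    have "P (x + t *\<^sub>R z) - P x = t *\<^sub>R (w - (w \<bullet> e) *\<^sub>R e)"
      by (simp add: P_def w(2) inner_add_left ee algebra_simps)
    moreover have "norm (w - (w \<bullet> e) *\<^sub>R e) \<le> r + r"
      using norm_triangle_ineq4[of w "(w \<bullet> e) *\<^sub>R e"] w(1) we e by simp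
    ultimately have "dist (P (x + t *\<^sub>R z)) (P x) \<le> t * (r + r)"
      using t by (simp add: dist_norm mult_left_mono)
    then have "L * dist (P (x + t *\<^sub>R z)) (P x) \<le> L * (t * (r + r))" using L by (rule mult_left_mono)
    moreover have "dist (g (P (x + t *\<^sub>R z))) (g (P x)) \<le> L * dist (P (x + t *\<^sub>R z)) (P x)"
      by (rule lipschitz_onD[OF g P P])
    ultimately have "g (P (x + t *\<^sub>R z)) \<le> g (P x) + t * (2 * L * r)"
      by (simp add: dist_real_def algebra_simps)
    also have "\<dots> < x \<bullet> e + t * (1 - r)"
      by (intro add_le_less_mono le mult_strict_left_mono r(3)) (use t in simp)
    also have "\<dots> \<le> x \<bullet> e + t * (1 + w \<bullet> e)" using we t by (intro add_left_mono mult_left_mono) auto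
    also have "\<dots> = (x + t *\<^sub>R z) \<bullet> e" by (simp add: w(2) inner_add_left ee)
    finally have "g (P (x + t *\<^sub>R z)) < (x + t *\<^sub>R z) \<bullet> e" .
    moreover have "x + t *\<^sub>R z \<in> ball x0 \<rho>"
    proof -
      have "norm z \<le> 2" using norm_triangle_ineq[of e w] w e r(2) by simp
      then have "norm (t *\<^sub>R z) \<le> t * 2" using t by simp
      then show ?thesis using x t norm_triangle_ineq4[of "x0 - x" "t *\<^sub>R z"] by (simp del: norm_scaleR add: dist_norm diff_diff_eq)
    qed
    ultimately have "x + t *\<^sub>R z \<in> \<Omega> \<inter> ball x0 \<rho>" unfolding eq by (simp add: P_def)
    then show "x + t *\<^sub>R z \<in> \<Omega>" by blast
  qed (use \<rho> r e in auto)
  then show ?thesis by blast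
qed

definition dil :: "real \<Rightarrow> ('a::euclidean_space \<Rightarrow> real) \<Rightarrow> 'a \<Rightarrow> real" where
  "dil \<gamma> \<kappa> z = (1 / \<gamma> ^ DIM('a)) * \<kappa> ((1 / \<gamma>) *\<^sub>R z)"

lemma kernel_dil:
  fixes \<kappa> :: "'a::euclidean_space \<Rightarrow> real"
  assumes \<kappa>: "kernel e r \<kappa>" and \<gamma>: "\<gamma> > 0"
  shows "kernel (\<gamma> *\<^sub>R e) (\<gamma> * r) (dil \<gamma> \<kappa>)"
  unfolding kernel_def
proof (intro conjI allI impI)
  show "cd k (dil \<gamma> \<kappa>)" for k
    unfolding dil_def[abs_def] using cd_affine[of k \<kappa> 0 "1/\<gamma>"] \<kappa> by (intro cd_mult cd_const) (simp add: kernel_def)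
  show "0 \<le> dil \<gamma> \<kappa> x" for x using kernel_nonneg[OF \<kappa>] \<gamma> by (simp add: dil_def)
  show "dil \<gamma> \<kappa> x = 0" if "x \<notin> cball (\<gamma> *\<^sub>R e) (\<gamma> * r)" for x
  proof -
    have "\<gamma> * r < norm (\<gamma> *\<^sub>R e - x)" using that by (simp add: dist_norm)
    also have "\<gamma> *\<^sub>R e - x = \<gamma> *\<^sub>R (e - (1/\<gamma>) *\<^sub>R x)" using \<gamma> by (simp add: algebra_simps)
    finally have "r < norm (e - (1/\<gamma>) *\<^sub>R x)" using \<gamma> by simp
    then have "\<kappa> ((1/\<gamma>) *\<^sub>R x) = 0" by (intro kernel_support[OF \<kappa>]) (simp add: dist_norm)
    then show ?thesis by (simp add: dil_def)
  qed
  have "integral\<^sup>L lborel \<kappa> = \<bar>1/\<gamma>\<bar> ^ DIM('a) *\<^sub>R (LINT x|lborel. \<kappa> (0 + (1/\<gamma>) *\<^sub>R x))"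
    by (rule integral_lborel_affine) (use \<gamma> C1c_measurable(1)[OF kernel_C1c[OF \<kappa>]] in auto)
  then have "(LINT x|lborel. \<kappa> ((1/\<gamma>) *\<^sub>R x)) = \<gamma> ^ DIM('a)"
    using \<gamma> kernel_integral[OF \<kappa>] by (simp add: power_divide)
  then show "integral\<^sup>L lborel (dil \<gamma> \<kappa>) = 1"
    using \<gamma> by (simp add: dil_def[abs_def])
qed

text \<open>Source of the factor 1/\<gamma> in the gradient bound for bounded functions when p is at
  most the dimension.\<close>

lemma grad_dil_L1:
  fixes \<kappa> :: "'a::euclidean_space \<Rightarrow> real"
  assumes \<kappa>: "C1c \<kappa>" and \<gamma>: "\<gamma> > 0"
  shows "(LINT z|lborel. norm (grad (dil \<gamma> \<kappa>) z)) = (1 / \<gamma>) * (LINT z|lborel. norm (grad \<kappa> z))"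
proof -
  note [measurable] = C1c_measurable[OF \<kappa>]
  define c where "c = 1 / \<gamma>"
  have c: "c > 0" using \<gamma> by (simp add: c_def)
  have D: "((dil \<gamma> \<kappa>) has_derivative (\<lambda>v. (c ^ DIM('a) *\<^sub>R (c *\<^sub>R grad \<kappa> (0 + c *\<^sub>R z))) \<bullet> v)) (at z)" for z
  proof -
    have a: "C1c (\<lambda>x. \<kappa> (0 + c *\<^sub>R x))" "grad (\<lambda>x. \<kappa> (0 + c *\<^sub>R x)) = (\<lambda>x. c *\<^sub>R grad \<kappa> (0 + c *\<^sub>R x))"
      using C1c_affine[OF \<kappa>, of c 0] c by auto
    have "((\<lambda>z. c ^ DIM('a) * \<kappa> (0 + c *\<^sub>R z)) has_derivative (\<lambda>v. c ^ DIM('a) * ((c *\<^sub>R grad \<kappa> (0 + c *\<^sub>R z)) \<bullet> v))) (at z)"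
      using has_derivative_mult_right[OF C1c_has_derivative[OF a(1)], of "c ^ DIM('a)"] unfolding a(2) .
    then show ?thesis by (simp add: dil_def[abs_def] c_def power_divide)
  qed
  have "(LINT z|lborel. norm (grad (dil \<gamma> \<kappa>) z)) = (LINT z|lborel. c * (c ^ DIM('a) * norm (grad \<kappa> (0 + c *\<^sub>R z))))"
    using c by (intro Bochner_Integration.integral_cong) (auto simp: gradI(2)[OF D])
  also have "\<dots> = c * (c ^ DIM('a) * (LINT z|lborel. norm (grad \<kappa> (0 + c *\<^sub>R z))))" by simp
  also have "c ^ DIM('a) * (LINT z|lborel. norm (grad \<kappa> (0 + c *\<^sub>R z))) = (LINT z|lborel. norm (grad \<kappa> z))"
    using integral_lborel_affine[of "\<lambda>z. norm (grad \<kappa> z)" c 0] c by simp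
  finally show ?thesis by (simp add: c_def)
qed

subsection \<open>The integrand\<close>

text \<open>The conditions with their constants fixed and read at points of \<Omega>, which is where
  the integrals live. The doubling constant may always be enlarged, so C4 is taken to be at least 2
  and can be used as a divisor. (Cont) stays in its original form, since M and N depend on the D
  that is found later.\<close>

locale integrand =
  fixes \<Omega> :: "'a::euclidean_space set" and \<psi> :: "'a \<Rightarrow> real \<Rightarrow> real"
    and p q C1 C2 C4 \<xi>0 :: real
  assumes lip: "bounded_lipschitz_domain \<Omega>"
    and p: "p > 1" and q: "q > 0" and C1: "C1 > 0" and C2: "C2 > 0" and C4: "C4 \<ge> 2" and \<xi>0: "\<xi>0 \<ge> 1"
    and psi_measurable_const: "\<And>\<xi>. \<xi> \<ge> 0 \<Longrightarrow> (\<lambda>x. \<psi> x \<xi>) \<in> borel_measurable (lebesgue_on \<Omega>)"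
    and psi_nonneg: "\<And>x \<xi>. x \<in> \<Omega> \<Longrightarrow> \<xi> \<ge> 0 \<Longrightarrow> \<psi> x \<xi> \<ge> 0"
    and psi_0: "\<And>x. x \<in> \<Omega> \<Longrightarrow> \<psi> x 0 = 0"
    and psi_convex: "\<And>x. x \<in> \<Omega> \<Longrightarrow> convex_on {0..} (\<psi> x)"
    and psi_lower: "\<And>x \<xi>. x \<in> \<Omega> \<Longrightarrow> \<xi> \<ge> \<xi>0 \<Longrightarrow> C1 * \<xi> powr p \<le> \<psi> x \<xi>"
    and psi_upper: "\<And>x \<xi>. x \<in> \<Omega> \<Longrightarrow> \<xi> \<ge> 0 \<Longrightarrow> \<psi> x \<xi> \<le> C2 * (1 + \<xi> powr q)"
    and psi_double: "\<And>x \<xi>. x \<in> \<Omega> \<Longrightarrow> \<xi> \<ge> 0 \<Longrightarrow> \<psi> x (2 * \<xi>) \<le> C4 * \<psi> x \<xi>"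
    and psi_Cont: "cond_Cont \<Omega> p \<psi>"
begin

lemma open_\<Omega>: "open \<Omega>" and bounded_\<Omega>: "bounded \<Omega>"
  using lip by (auto simp: bounded_lipschitz_domain_def)

lemma \<Omega>_borel [measurable]: "\<Omega> \<in> sets borel"
  using open_\<Omega> by simp

lemma \<Omega>_lebesgue: "\<Omega> \<in> sets lebesgue"
  using \<Omega>_borel by (simp add: sets_completionI_sets)

lemma emeasure_\<Omega>: "emeasure lborel \<Omega> < \<infinity>"
  using emeasure_bounded_finite[OF bounded_\<Omega>] by simp

section \<open>Consequences of convexity, doubling and growth\<close>

lemma psi_scale:
  assumes "x \<in> \<Omega>" "0 \<le> t" "t \<le> 1" "a \<ge> 0"
  shows "\<psi> x (t * a) \<le> t * \<psi> x a"
  using convex_onD[OF psi_convex[OF assms(1)] assms(2,3), of 0 a] assms psi_0 by simp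

lemma psi_mono:
  assumes "x \<in> \<Omega>" "0 \<le> a" "a \<le> b"
  shows "\<psi> x a \<le> \<psi> x b"
proof (cases "b = 0")
  case False
  have "\<psi> x (a / b * b) \<le> a / b * \<psi> x b" using assms False by (intro psi_scale) auto
  also have "\<dots> \<le> 1 * \<psi> x b" using assms False by (intro mult_right_mono psi_nonneg) auto
  finally show ?thesis using False by simp
qed (use assms in simp)

lemma psi_ratio:
  assumes "x \<in> \<Omega>" "0 < a" "a \<le> b"
  shows "\<psi> x a / a \<le> \<psi> x b / b"
  using psi_scale[of x "a / b" b] assms by (simp add: field_simps)

lemma psi_add:
  assumes "x \<in> \<Omega>" "a \<ge> 0" "b \<ge> 0"
  shows "\<psi> x (a + b) \<le> C4 * (\<psi> x a + \<psi> x b)"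
proof -
  have "\<psi> x (a + b) \<le> \<psi> x (2 * max a b)" using assms by (intro psi_mono) auto
  also have "\<dots> \<le> C4 * \<psi> x (max a b)" using assms by (intro psi_double) auto
  also have "\<dots> \<le> C4 * (\<psi> x a + \<psi> x b)"
    using assms psi_nonneg[of x a] psi_nonneg[of x b] C4 by (intro mult_left_mono) (auto simp: max_def)
  finally show ?thesis .
qed

lemma psi_norm_add:
  fixes u v :: 'a
  assumes "x \<in> \<Omega>"
  shows "\<psi> x (norm (u + v)) \<le> C4 * (\<psi> x (norm u) + \<psi> x (norm v))"
  by (rule order_trans[OF psi_mono[OF assms _ norm_triangle_ineq] psi_add]) (use assms in auto)

lemma psi_power2:
  assumes "x \<in> \<Omega>" "a \<ge> 0"
  shows "\<psi> x (2 ^ n * a) \<le> C4 ^ n * \<psi> x a"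
proof (induction n)
  case (Suc n)
  have "\<psi> x (2 ^ Suc n * a) \<le> C4 * \<psi> x (2 ^ n * a)"
    using psi_double[OF assms(1), of "2 ^ n * a"] assms by (simp add: mult.assoc)
  also have "\<dots> \<le> C4 * (C4 ^ n * \<psi> x a)" using Suc C4 by (intro mult_left_mono) auto
  finally show ?case by (simp add: mult.assoc)
qed simp

text \<open>Doubling is iterated up to a power of 2 above \<open>c\<close>. Any rescaling, by a
  Luxemburg parameter or by the bound of a cutoff, thereby becomes a constant factor.\<close>

lemma psi_dilate:
  assumes "c > 0"
  shows "\<exists>D\<ge>0. \<forall>x\<in>\<Omega>. \<forall>a\<ge>0. \<psi> x (c * a) \<le> D * \<psi> x a"
proof -
  obtain n where n: "c < 2 ^ n" using real_arch_pow[of 2 c] by auto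
  have "\<psi> x (c * a) \<le> C4 ^ n * \<psi> x a" if "x \<in> \<Omega>" "a \<ge> 0" for x a
    by (rule order_trans[OF psi_mono psi_power2]) (use that n assms in \<open>auto intro: mult_right_mono\<close>)
  then show ?thesis using C4 by (intro exI[of _ "C4 ^ n"]) auto
qed

text \<open>Convergence of energies needs a factor close to 1 before the main term, which
  \<open>psi_add\<close> does not give. The sum a + b is a convex combination of (1 + \<theta>) a
  and b / l with weights 1 - l and l, where (1 + \<theta>)(1 - l) = 1. Interpolating between a and 2
  a bounds \<psi>((1 + \<theta>) a), and \<open>psi_dilate\<close> bounds \<psi>(b / l).\<close>

lemma psi_add_eps:
  assumes "\<eta> > 0"
  shows "\<exists>D\<ge>0. \<forall>x\<in>\<Omega>. \<forall>a\<ge>0. \<forall>b\<ge>0. \<psi> x (a + b) \<le> (1 + \<eta>) * \<psi> x a + D * \<psi> x b"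
proof -
  \<comment> \<open>The bound 1/2 ensures \<theta> \<le> 1, so that (1 + \<theta>) a lies between a
    and 2 a; the bound \<eta> / C4 keeps the total factor 1 - l + l C4 below 1 + \<eta>.\<close>
  define l where "l = min (1/2) (\<eta> / C4)"
  have l: "l > 0" "l \<le> 1/2" "l * C4 \<le> \<eta>"
    using assms C4 by (auto simp: l_def min_def field_simps)
  define \<theta> where "\<theta> = l / (1 - l)"
  have \<theta>: "\<theta> \<ge> 0" "\<theta> \<le> 1" "(1 - l) * \<theta> = l" "1 + \<theta> = 1 / (1 - l)" using l by (auto simp: \<theta>_def field_simps)
  obtain D where D: "D \<ge> 0" "\<And>x a. x \<in> \<Omega> \<Longrightarrow> a \<ge> 0 \<Longrightarrow> \<psi> x (1 / l * a) \<le> D * \<psi> x a"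
    using psi_dilate[of "1 / l"] l(1) by auto
  have "\<psi> x (a + b) \<le> (1 + \<eta>) * \<psi> x a + D * \<psi> x b" if x: "x \<in> \<Omega>" and ab: "a \<ge> 0" "b \<ge> 0" for x a b
  proof -
    have pa: "\<psi> x a \<ge> 0" "\<psi> x b \<ge> 0" using psi_nonneg x ab by auto
    have 1: "\<psi> x ((1 + \<theta>) * a) \<le> (1 + \<theta> * C4) * \<psi> x a"
    proof -
      have "\<psi> x ((1 - \<theta>) *\<^sub>R a + \<theta> *\<^sub>R (2 * a)) \<le> (1 - \<theta>) * \<psi> x a + \<theta> * \<psi> x (2 * a)"
        using ab \<theta> by (intro convex_onD[OF psi_convex[OF x]]) auto
      also have "(1 - \<theta>) *\<^sub>R a + \<theta> *\<^sub>R (2 * a) = (1 + \<theta>) * a" by (simp add: algebra_simps)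
      also have "(1 - \<theta>) * \<psi> x a + \<theta> * \<psi> x (2 * a) \<le> 1 * \<psi> x a + \<theta> * (C4 * \<psi> x a)"
        using \<theta> pa psi_double[OF x ab(1)] by (intro add_mono mult_right_mono mult_left_mono) auto
      finally show ?thesis by (simp add: algebra_simps)
    qed
    have e1: "(1 - l) * ((1 + \<theta>) * a) = a" using \<theta>(4) l by simp
    have e2: "l * (1 / l * b) = b" using l by simp
    have "a + b = (1 - l) *\<^sub>R ((1 + \<theta>) * a) + l *\<^sub>R (1 / l * b)" by (simp only: real_scaleR_def e1 e2)
    also have "\<psi> x \<dots> \<le> (1 - l) * \<psi> x ((1 + \<theta>) * a) + l * \<psi> x (1 / l * b)"
      using ab \<theta> l by (intro convex_onD[OF psi_convex[OF x]]) auto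
    also have "\<dots> \<le> (1 - l) * ((1 + \<theta> * C4) * \<psi> x a) + 1 * (D * \<psi> x b)"
      using 1 D(2)[OF x ab(2)] D(1) l pa psi_nonneg[OF x, of "1 / l * b"] ab by (intro add_mono mult_left_mono mult_mono) auto
    also have "(1 - l) * ((1 + \<theta> * C4) * \<psi> x a) = (1 - l + l * C4) * \<psi> x a"
    proof -
      have "(1 - l) * ((1 + \<theta> * C4) * \<psi> x a) = ((1 - l) + ((1 - l) * \<theta>) * C4) * \<psi> x a" by (simp add: algebra_simps)
      then show ?thesis by (simp only: \<theta>(3))
    qed
    also have "\<dots> \<le> (1 + \<eta>) * \<psi> x a" using l pa by (intro mult_right_mono) auto
    finally show ?thesis by simp
  qed
  then show ?thesis using D(1) by blast
qed

text \<open>The linear growth constant of \<open>psi_linear_lower\<close>: \<xi>0 handles small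
  arguments, and 1 / C1 the range of p-growth.\<close>

definition A0 :: real where "A0 = max \<xi>0 (1 / C1)"

lemma A0_ge1: "A0 \<ge> 1" using \<xi>0 by (simp add: A0_def)

lemma psi_linear_lower:
  assumes "x \<in> \<Omega>" "a \<ge> 0"
  shows "a \<le> A0 * (\<psi> x a + 1)"
proof (cases "a \<ge> \<xi>0")
  case True
  have "a powr 1 \<le> a powr p" using True \<xi>0 p by (intro powr_mono) auto
  then have "a \<le> a powr p" using True \<xi>0 by simp
  also have "\<dots> \<le> (1 / C1) * \<psi> x a" using psi_lower[OF assms(1) True] C1 by (simp add: field_simps)
  also have "\<dots> \<le> A0 * \<psi> x a" using psi_nonneg[OF assms] by (intro mult_right_mono) (auto simp: A0_def)
  also have "\<dots> \<le> A0 * (\<psi> x a + 1)" using A0_ge1 by simp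
  finally show ?thesis .
next
  case False
  then have "a \<le> A0 * 1" by (simp add: A0_def)
  also have "\<dots> \<le> A0 * (\<psi> x a + 1)" using A0_ge1 psi_nonneg[OF assms] by (intro mult_left_mono) auto
  finally show ?thesis .
qed

lemma psi_powr_lower:
  assumes "x \<in> \<Omega>" "a \<ge> 0"
  shows "a powr p \<le> (1 / C1) * \<psi> x a + \<xi>0 powr p"
proof (cases "a \<ge> \<xi>0")
  case True
  have "a powr p \<le> (1 / C1) * \<psi> x a" using psi_lower[OF assms(1) True] C1 by (simp add: field_simps)
  then show ?thesis using powr_ge_zero[of \<xi>0 p] by linarith
next
  case False
  then have "a powr p \<le> \<xi>0 powr p" using assms p by (intro powr_mono2) auto
  moreover have "(1 / C1) * \<psi> x a \<ge> 0" using psi_nonneg[OF assms] C1 by simp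
  ultimately show ?thesis by linarith
qed

text \<open>b is a convex combination of a and b + 1 whose weight on b + 1 is at most b - a. This is
  a quantitative continuity from the left.\<close>

lemma psi_increment:
  assumes "x \<in> \<Omega>" "0 \<le> a" "a \<le> b"
  shows "\<psi> x b \<le> \<psi> x a + (b - a) * \<psi> x (b + 1)"
proof -
  define m where "m = (b - a) / (b + 1 - a)"
  have m: "0 \<le> m" "m \<le> 1" "m \<le> b - a" and e: "m * (b + 1 - a) = b - a"
    using assms by (auto simp: m_def divide_le_eq mult_left_mono[of 1 "b + 1 - a" "b - a", simplified])
  have "b = (1 - m) *\<^sub>R a + m *\<^sub>R (b + 1)" using e by (simp add: algebra_simps)
  also have "\<psi> x \<dots> \<le> (1 - m) * \<psi> x a + m * \<psi> x (b + 1)"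
    using assms m by (intro convex_onD[OF psi_convex]) auto
  also have "\<dots> \<le> 1 * \<psi> x a + (b - a) * \<psi> x (b + 1)"
    using assms m psi_nonneg[OF assms(1)] by (intro add_mono mult_right_mono) auto
  finally show ?thesis by simp
qed

text \<open>Measurability of \<open>\<psi>\<close> is assumed only for fixed second argument.
  Rounding f down to multiples of 1/(n + 1) leaves countably many such arguments, and
  \<open>psi_increment\<close> with monotonicity squeezes the limit.\<close>

lemma psi_measurable:
  assumes f: "f \<in> borel_measurable (lebesgue_on \<Omega>)" and f0: "\<And>x. f x \<ge> 0"
  shows "(\<lambda>x. \<psi> x (f x)) \<in> borel_measurable (lebesgue_on \<Omega>)"
proof (rule borel_measurable_LIMSEQ_real)
  define k where "k n x = nat \<lfloor>real (Suc n) * f x\<rfloor>" for n x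
  show "(\<lambda>x. \<psi> x (real (k n x) / real (Suc n))) \<in> borel_measurable (lebesgue_on \<Omega>)" for n
  proof (rule measurable_compose_countable[where f="\<lambda>i x. \<psi> x (real i / real (Suc n))"])
    show "(\<lambda>x. \<psi> x (real i / real (Suc n))) \<in> borel_measurable (lebesgue_on \<Omega>)" for i
      by (rule psi_measurable_const) simp
    show "k n \<in> measurable (lebesgue_on \<Omega>) (count_space UNIV)" unfolding k_def using f by measurable
  qed
  fix x assume "x \<in> space (lebesgue_on \<Omega>)"
  then have x: "x \<in> \<Omega>" by simp
  have kb: "real (k n x) / real (Suc n) \<le> f x" "f x - real (k n x) / real (Suc n) \<le> 1 / real (Suc n)" for n
  proof -
    have pos: "real (Suc n) * f x \<ge> 0" using f0[of x] by simp
    then have 1: "real (k n x) \<le> real (Suc n) * f x" "real (Suc n) * f x \<le> real (k n x) + 1"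
      unfolding k_def by linarith+
    have c: "real (Suc n) > 0" by simp
    show "real (k n x) / real (Suc n) \<le> f x"
      using 1(1) c by (simp add: pos_divide_le_eq mult.commute del: of_nat_Suc)
    have "f x - real (k n x) / real (Suc n) = (real (Suc n) * f x - real (k n x)) / real (Suc n)"
      using c by (simp add: diff_divide_distrib del: of_nat_Suc)
    also have "\<dots> \<le> 1 / real (Suc n)" using 1(2) c by (intro divide_right_mono) linarith+
    finally show "f x - real (k n x) / real (Suc n) \<le> 1 / real (Suc n)" .
  qed
  have lo: "\<psi> x (f x) - 1 / real (Suc n) * \<psi> x (f x + 1) \<le> \<psi> x (real (k n x) / real (Suc n))" for n
  proof -
    have "\<psi> x (f x) \<le> \<psi> x (real (k n x) / real (Suc n)) + (f x - real (k n x) / real (Suc n)) * \<psi> x (f x + 1)"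
      by (rule psi_increment[OF x _ kb(1)]) simp
    moreover have "(f x - real (k n x) / real (Suc n)) * \<psi> x (f x + 1) \<le> 1 / real (Suc n) * \<psi> x (f x + 1)"
      by (rule mult_right_mono[OF kb(2)]) (use psi_nonneg[OF x, of "f x + 1"] f0[of x] in auto)
    ultimately show ?thesis by linarith
  qed
  have up: "\<psi> x (real (k n x) / real (Suc n)) \<le> \<psi> x (f x)" for n
    by (rule psi_mono[OF x _ kb(1)]) simp
  have "(\<lambda>n. \<psi> x (f x) - 1 / real (Suc n) * \<psi> x (f x + 1)) \<longlonglongrightarrow> \<psi> x (f x) - 0 * \<psi> x (f x + 1)"
    by (intro tendsto_intros LIMSEQ_Suc[OF lim_1_over_n])
  then have "(\<lambda>n. \<psi> x (f x) - 1 / real (Suc n) * \<psi> x (f x + 1)) \<longlonglongrightarrow> \<psi> x (f x)" by simp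
  then show "(\<lambda>n. \<psi> x (real (k n x) / real (Suc n))) \<longlonglongrightarrow> \<psi> x (f x)"
    by (rule tendsto_sandwich[OF _ _ _ tendsto_const, rotated 2]) (use lo up in auto)
qed

text \<open>The exponent in (Cont). It is 1 for p at most d; for p > d it satisfies \<mu> p = d, the
  balance on which \<open>conv_dil_bound\<close> rests.\<close>

definition \<mu> :: real where "\<mu> = min 1 (real DIM('a) / p)"

lemma \<mu>_pos: "\<mu> > 0" using p by (simp add: \<mu>_def)

text \<open>The bound replaces the supporting line of \<open>\<psi> z\<close> at \<open>t\<close> by the line \<open>\<psi> z t * (2 * \<xi> / t - 1)\<close>, which takes the
  same value at \<open>t\<close> and is dominated by a multiple of \<open>\<psi> y\<close> for all arguments, also beyond the range
  of condition (Cont).\<close>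

lemma psi_line:
  assumes D: "D > 1"
  shows "\<exists>M\<ge>0. \<exists>N\<ge>0. \<forall>\<gamma>\<in>{0<..<1/2}. \<forall>x. \<forall>y\<in>cball x \<gamma> \<inter> \<Omega>. \<forall>z\<in>cball x \<gamma> \<inter> \<Omega>.
     \<forall>t \<xi>. 0 < t \<and> t \<le> D * \<gamma> powr (- \<mu>) \<and> \<xi> \<ge> 0 \<longrightarrow> \<psi> z t * (2 * \<xi> / t - 1) \<le> M * \<psi> y \<xi> + N"
proof -
  obtain M0 N0 where MN0: "\<And>\<gamma> x y z \<xi>. \<gamma> \<in> {0<..<1/2} \<Longrightarrow> y \<in> cball x \<gamma> \<inter> closure \<Omega> \<Longrightarrow> z \<in> cball x \<gamma> \<inter> closure \<Omega> \<Longrightarrow>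
      \<xi> \<in> {0..D * \<gamma> powr (- \<mu>)} \<Longrightarrow> \<psi> z \<xi> \<le> M0 * \<psi> y \<xi> + N0"
    using psi_Cont D unfolding cond_Cont_def \<mu>_def by meson
  define M N where "M = max 0 M0" and "N = max 0 N0"
  have MN: "M \<ge> 0" "N \<ge> 0" by (auto simp: M_def N_def)
  \<comment> \<open>The weight 2 + C4 serves the arguments inside the range of (Cont); the
    additional 2 * N * A0 pays for the term linear in \<xi> that appears beyond it.\<close>
  define M' where "M' = (2 + C4) * M + 2 * N * A0"
  define N' where "N' = (2 + C4) * N + 2 * N * A0"
  have M': "M' \<ge> 0" "N' \<ge> 0" using MN C4 A0_ge1 by (auto simp: M'_def N'_def)
  have main: "\<psi> z t * (2 * \<xi> / t - 1) \<le> M' * \<psi> y \<xi> + N'"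
    if g: "\<gamma> \<in> {0<..<1/2}" and y: "y \<in> cball x \<gamma>" "y \<in> \<Omega>" and z: "z \<in> cball x \<gamma>" "z \<in> \<Omega>" 
      and t: "0 < t" "t \<le> D * \<gamma> powr (- \<mu>)" and \<xi>: "\<xi> \<ge> 0" for \<gamma> x y z t \<xi>
  proof -
    define K where "K = D * \<gamma> powr (- \<mu>)"
    have "1 = \<gamma> powr 0" using g by simp
    also have "\<dots> \<le> \<gamma> powr (- \<mu>)" using g \<mu>_pos by (intro powr_mono') auto
    finally have K: "K \<ge> 1" "t \<le> K" using D t mult_mono[of 1 D 1 "\<gamma> powr (- \<mu>)"] by (auto simp: K_def)
    have c: "\<psi> z s \<le> M * \<psi> y s + N" if "0 \<le> s" "s \<le> K" for s
    proof -
      have "\<psi> z s \<le> M0 * \<psi> y s + N0"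
        by (rule MN0[OF g, of y x z]) (use y z that closure_subset[of \<Omega>] in \<open>auto simp: K_def\<close>)
      also have "\<dots> \<le> M * \<psi> y s + N"
        using psi_nonneg[OF y(2) that(1)] by (intro add_mono mult_right_mono) (auto simp: M_def N_def)
      finally show ?thesis .
    qed
    have py: "\<psi> y \<xi> \<ge> 0" by (rule psi_nonneg[OF y(2) \<xi>])
    have pt: "\<psi> z t \<ge> 0" using psi_nonneg[OF z(2)] t by simp
    have NA: "N * A0 \<ge> 0" using MN A0_ge1 by simp
    have rhs0: "0 \<le> M' * \<psi> y \<xi> + N'" using M' py by simp
    have big: "(2 + C4) * (M * \<psi> y \<xi> + N) \<le> M' * \<psi> y \<xi> + N'"
      using NA mult_nonneg_nonneg[OF NA py] by (simp add: M'_def N'_def algebra_simps)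
    \<comment> \<open>In these four ranges, in order: the line is not positive; the line is at most
      \<psi>(z,t), and doubling leads to \<psi>(z,\<xi>); monotone ratios lead to \<psi>(z,\<xi>),
      still within (Cont); the slope is moved to K, (Cont) is used there, the ratio of \<psi>(y,.)
      returns to \<xi>, and the remaining N \<xi> / K is absorbed by
      \<open>psi_linear_lower\<close>.\<close>
    consider "\<xi> \<le> t / 2" | "t / 2 < \<xi>" "\<xi> \<le> t" | "t < \<xi>" "\<xi> \<le> K" | "K < \<xi>" by linarith
    then show ?thesis
    proof cases
      case 1
      then have "2 * \<xi> / t - 1 \<le> 0" using t by (simp add: field_simps)
      then have "\<psi> z t * (2 * \<xi> / t - 1) \<le> 0" using pt by (rule mult_nonneg_nonpos[rotated])
      then show ?thesis using rhs0 by linarith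
    next
      case 2
      then have "2 * \<xi> / t - 1 \<le> 1" using t by (simp add: field_simps)
      then have "\<psi> z t * (2 * \<xi> / t - 1) \<le> \<psi> z t * 1" using pt by (rule mult_left_mono)
      also have "\<dots> \<le> \<psi> z (2 * \<xi>)" using 2 t psi_mono[OF z(2), of t "2 * \<xi>"] by simp
      also have "\<dots> \<le> C4 * \<psi> z \<xi>" by (rule psi_double[OF z(2) \<xi>])
      also have "\<dots> \<le> (2 + C4) * (M * \<psi> y \<xi> + N)"
        using c[OF \<xi>] 2 K C4 psi_nonneg[OF z(2) \<xi>] by (intro mult_mono) auto
      finally show ?thesis using big by linarith
    next
      case 3
      have "\<psi> z t * (2 * \<xi> / t - 1) \<le> 2 * \<xi> * (\<psi> z t / t)" using pt t by (simp add: field_simps)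
      also have "\<dots> \<le> 2 * \<xi> * (\<psi> z \<xi> / \<xi>)" using psi_ratio[OF z(2) t(1), of \<xi>] 3 \<xi> by (intro mult_left_mono) auto
      also have "\<dots> = 2 * \<psi> z \<xi>" using 3 t by simp
      also have "\<dots> \<le> (2 + C4) * (M * \<psi> y \<xi> + N)"
        using c[OF \<xi>] 3 C4 psi_nonneg[OF z(2) \<xi>] by (intro mult_mono) auto
      finally show ?thesis using big by linarith
    next
      case 4
      have x0: "\<xi> > 0" using 4 K by simp
      have "\<psi> z t * (2 * \<xi> / t - 1) \<le> 2 * \<xi> * (\<psi> z t / t)" using pt t by (simp add: field_simps)
      also have "\<dots> \<le> 2 * \<xi> * (\<psi> z K / K)" using psi_ratio[OF z(2) t(1) K(2)] \<xi> by (intro mult_left_mono) auto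
      also have "\<dots> \<le> 2 * \<xi> * ((M * \<psi> y K + N) / K)" using c[of K] K \<xi> by (intro mult_left_mono divide_right_mono) auto
      also have "\<dots> = 2 * M * (\<xi> * (\<psi> y K / K)) + 2 * (N * (\<xi> / K))" by (simp add: field_simps add_divide_distrib)
      also have "\<dots> \<le> 2 * M * (\<xi> * (\<psi> y \<xi> / \<xi>)) + 2 * (N * (\<xi> / 1))"
        using psi_ratio[OF y(2), of K \<xi>] K 4 \<xi> MN by (intro add_mono mult_left_mono divide_left_mono) auto
      also have "\<dots> = 2 * M * \<psi> y \<xi> + 2 * N * \<xi>" using x0 by simp
      also have "\<dots> \<le> 2 * M * \<psi> y \<xi> + 2 * N * (A0 * (\<psi> y \<xi> + 1))"
        using psi_linear_lower[OF y(2) \<xi>] MN by (intro add_left_mono mult_left_mono) auto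
      also have "\<dots> \<le> M' * \<psi> y \<xi> + N'"
        using MN C4 py mult_nonneg_nonneg[OF mult_nonneg_nonneg[OF _ MN(1)] py, of C4] mult_nonneg_nonneg[OF _ MN(2), of C4]
        by (simp add: M'_def N'_def algebra_simps)
      finally show ?thesis .
    qed
  qed
  show ?thesis
    by (intro exI[of _ M'] exI[of _ N'] conjI M' ballI allI impI) (elim conjE IntE, rule main, assumption+)
qed

end

lemma integrable_conv:
  fixes f :: "'a::euclidean_space \<Rightarrow> 'b::euclidean_space"
  assumes \<kappa>: "kernel e r \<kappa>" and f: "integrable lborel f"
  shows "integrable lborel (conv \<kappa> f)"
proof -
  have [measurable]: "\<kappa> \<in> borel_measurable borel" by (rule C1c_measurable(1)[OF kernel_C1c[OF \<kappa>]])
  have [measurable]: "f \<in> borel_measurable borel" using f by auto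
  have "(\<integral>\<^sup>+x. ennreal (norm (conv \<kappa> f x)) \<partial>lborel) \<le> (\<integral>\<^sup>+z. ennreal \<bar>\<kappa> z\<bar> \<partial>lborel) * (\<integral>\<^sup>+y. ennreal (norm (f y)) \<partial>lborel)"
    by (rule nn_integral_conv_le) measurable
  also have "\<dots> = (\<integral>\<^sup>+y. ennreal (norm (f y)) \<partial>lborel)" by (simp add: kernel_nn_integral[OF \<kappa>])
  also have "\<dots> < \<infinity>" using f unfolding integrable_iff_bounded by simp
  finally show ?thesis unfolding integrable_iff_bounded by simp
qed

lemma kernel_weighted:
  fixes f :: "'a::euclidean_space \<Rightarrow> 'b::euclidean_space"
  assumes \<kappa>: "kernel e r \<kappa>" and f: "integrable lborel f"
  shows "integrable lborel (\<lambda>y. \<kappa> (x - y) *\<^sub>R f y)" "integrable lborel (\<lambda>y. \<kappa> (x - y))" "(LINT y|lborel. \<kappa> (x - y)) = 1"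
proof -
  have [measurable]: "\<kappa> \<in> borel_measurable borel" by (rule C1c_measurable(1)[OF kernel_C1c[OF \<kappa>]])
  obtain B where B: "\<And>x. \<bar>\<kappa> x\<bar> \<le> B" using C1c_bounded[OF kernel_C1c[OF \<kappa>]] by metis
  show "integrable lborel (\<lambda>y. \<kappa> (x - y) *\<^sub>R f y)"
    by (rule integrable_bounded_mult[OF f _ B]) measurable
  show "integrable lborel (\<lambda>y. \<kappa> (x - y))"
    using C1c_integrable(1)[OF kernel_C1c[OF \<kappa>]] by (simp add: integrable_reflect_iff)
  show "(LINT y|lborel. \<kappa> (x - y)) = 1"
    using kernel_integral[OF \<kappa>] by (simp add: integral_reflect)
qed

lemma ennreal_tendsto_0I:
  fixes a :: "nat \<Rightarrow> ennreal"
  assumes "\<And>\<epsilon>. \<epsilon> > 0 \<Longrightarrow> eventually (\<lambda>n. a n < ennreal \<epsilon>) sequentially"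
  shows "a \<longlonglongrightarrow> 0"
proof (rule order_tendstoI)
  fix c :: ennreal assume "0 < c"
  then obtain b where b: "0 < b" "b < c" using dense by blast
  then have "b < top" by (meson less_le_trans top_greatest)
  then have "b = ennreal (enn2real b)" "enn2real b > 0" using b(1) by (auto simp: enn2real_positive_iff)
  then show "eventually (\<lambda>n. a n < c) sequentially"
    using assms[of "enn2real b"] b(2) by (auto elim!: eventually_mono)
qed simp

lemma mollify_dil_tendsto:
  fixes f :: "'a::euclidean_space \<Rightarrow> 'b::euclidean_space"
  assumes \<kappa>: "kernel e r \<kappa>" and f: "integrable lborel f"
    and \<gamma>: "\<And>n. \<gamma> n > 0" "\<gamma> \<longlonglongrightarrow> 0"
  shows "(\<lambda>n. L1d f (conv (dil (\<gamma> n) \<kappa>) f)) \<longlonglongrightarrow> 0"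
proof (rule ennreal_tendsto_0I)
  fix \<epsilon> :: real assume "\<epsilon> > 0"
  obtain \<delta> where \<delta>: "\<delta> > 0" "\<And>e s \<kappa>. kernel e s \<kappa> \<Longrightarrow> (\<And>z. \<kappa> z \<noteq> 0 \<Longrightarrow> norm z < \<delta>) \<Longrightarrow> L1d (conv \<kappa> f) f < ennreal \<epsilon>"
    using mollify_L1[OF f \<open>\<epsilon> > 0\<close>] by meson
  have "(\<lambda>n. \<gamma> n * (norm e + r)) \<longlonglongrightarrow> 0 * (norm e + r)" by (intro tendsto_intros \<gamma>)
  then have "eventually (\<lambda>n. \<gamma> n * (norm e + r) < \<delta>) sequentially"
    using \<delta>(1) by (intro order_tendstoD) auto
  then show "eventually (\<lambda>n. L1d f (conv (dil (\<gamma> n) \<kappa>) f) < ennreal \<epsilon>) sequentially"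
  proof (rule eventually_mono)
    fix n assume n: "\<gamma> n * (norm e + r) < \<delta>"
    note k = kernel_dil[OF \<kappa> \<gamma>(1)[of n]]
    have "norm z < \<delta>" if "dil (\<gamma> n) \<kappa> z \<noteq> 0" for z
    proof -
      have "z \<in> cball (\<gamma> n *\<^sub>R e) (\<gamma> n * r)" using kernel_support[OF k] that by blast
      then have "norm (z - \<gamma> n *\<^sub>R e) \<le> \<gamma> n * r" by (simp add: dist_norm norm_minus_commute)
      then have "norm z \<le> norm (\<gamma> n *\<^sub>R e) + \<gamma> n * r"
        using norm_triangle_ineq[of "\<gamma> n *\<^sub>R e" "z - \<gamma> n *\<^sub>R e"] by simp
      also have "\<dots> = \<gamma> n * (norm e + r)" using \<gamma>(1)[of n] by (simp add: algebra_simps)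
      finally show ?thesis using n by simp
    qed
    then have "L1d (conv (dil (\<gamma> n) \<kappa>) f) f < ennreal \<epsilon>" by (rule \<delta>(2)[OF k])
    then show "L1d f (conv (dil (\<gamma> n) \<kappa>) f) < ennreal \<epsilon>" by (subst L1d_commute)
  qed
qed

context integrand
begin

lemma borel_measurable_\<Omega>: "f \<in> borel_measurable borel \<Longrightarrow> f \<in> borel_measurable (lebesgue_on \<Omega>)"
  by (intro measurable_restrict_space1 measurable_completion) simp

lemma nn_integral_\<Omega>_eq: "(\<integral>\<^sup>+x. f x \<partial>lebesgue_on \<Omega>) = (\<integral>\<^sup>+x. f x * indicator \<Omega> x \<partial>lborel)"
  using \<Omega>_lebesgue by (simp add: nn_integral_restrict_space nn_integral_completion)

lemma nn_integral_\<Omega>_le: "(\<integral>\<^sup>+x. f x \<partial>lebesgue_on \<Omega>) \<le> (\<integral>\<^sup>+x. f x \<partial>lborel)"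
  unfolding nn_integral_\<Omega>_eq by (intro nn_integral_mono) (auto simp: indicator_def)

lemma AE_\<Omega>_iff: "(AE x in lebesgue_on \<Omega>. P x) \<longleftrightarrow> (AE x in lborel. x \<in> \<Omega> \<longrightarrow> P x)"
  using \<Omega>_lebesgue by (simp add: AE_restrict_space_iff AE_completion_iff)

text \<open>Approximation is measured by the modular because pointwise bounds and dominated
  convergence act on it directly; doubling converts the outcome to the norm in
  \<open>musielak_norm_small\<close>.\<close>

definition modular :: "('a \<Rightarrow> 'a) \<Rightarrow> ennreal" where
  "modular f = (\<integral>\<^sup>+x. ennreal (\<psi> x (norm (f x))) \<partial>lebesgue_on \<Omega>)"

lemma modular_cong: "AE x in lebesgue_on \<Omega>. f x = g x \<Longrightarrow> modular f = modular g"
  unfolding modular_def by (intro nn_integral_cong_AE) (auto elim!: eventually_mono)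

lemma psi_norm_measurable:
  fixes f :: "'a \<Rightarrow> 'a"
  assumes "f \<in> borel_measurable (lebesgue_on \<Omega>)"
  shows "(\<lambda>x. \<psi> x (norm (f x))) \<in> borel_measurable (lebesgue_on \<Omega>)"
  using assms by (intro psi_measurable) auto

lemma modular_mono:
  assumes "\<And>x. x \<in> \<Omega> \<Longrightarrow> norm (f x) \<le> norm (g x)"
  shows "modular f \<le> modular g"
  unfolding modular_def using assms by (intro nn_integral_mono ennreal_leI psi_mono) auto

lemma modular_add:
  assumes [measurable]: "f \<in> borel_measurable (lebesgue_on \<Omega>)" "g \<in> borel_measurable (lebesgue_on \<Omega>)"
  shows "modular (\<lambda>x. f x + g x) \<le> ennreal C4 * (modular f + modular g)"
proof -
  note m [measurable] = psi_norm_measurable[OF assms(1)] psi_norm_measurable[OF assms(2)]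
  have "modular (\<lambda>x. f x + g x) \<le> (\<integral>\<^sup>+x. ennreal C4 * (ennreal (\<psi> x (norm (f x))) + ennreal (\<psi> x (norm (g x)))) \<partial>lebesgue_on \<Omega>)"
    unfolding modular_def
  proof (rule nn_integral_mono)
    fix x assume "x \<in> space (lebesgue_on \<Omega>)"
    then have x: "x \<in> \<Omega>" by simp
    show "ennreal (\<psi> x (norm (f x + g x))) \<le> ennreal C4 * (ennreal (\<psi> x (norm (f x))) + ennreal (\<psi> x (norm (g x))))"
      using psi_norm_add[OF x, of "f x" "g x"] C4 psi_nonneg[OF x]
      by (simp add: ennreal_leI flip: ennreal_plus ennreal_mult)
  qed
  also have "\<dots> = ennreal C4 * (modular f + modular g)"
    unfolding modular_def by (simp add: nn_integral_cmult nn_integral_add)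
  finally show ?thesis .
qed

lemma modular_bounded_finite:
  assumes "\<And>x. x \<in> \<Omega> \<Longrightarrow> norm (f x) \<le> B"
  shows "modular f < \<infinity>"
proof -
  have "modular f \<le> (\<integral>\<^sup>+x. ennreal (C2 * (1 + \<bar>B\<bar> powr q)) \<partial>lebesgue_on \<Omega>)"
    unfolding modular_def
  proof (rule nn_integral_mono)
    fix x assume "x \<in> space (lebesgue_on \<Omega>)"
    then have x: "x \<in> \<Omega>" by simp
    have "\<psi> x (norm (f x)) \<le> \<psi> x \<bar>B\<bar>" using assms[OF x] by (intro psi_mono x) auto
    also have "\<dots> \<le> C2 * (1 + \<bar>B\<bar> powr q)" by (rule psi_upper[OF x]) simp
    finally show "ennreal (\<psi> x (norm (f x))) \<le> ennreal (C2 * (1 + \<bar>B\<bar> powr q))" by (rule ennreal_leI)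
  qed
  also have "\<dots> = ennreal (C2 * (1 + \<bar>B\<bar> powr q)) * emeasure lborel \<Omega>"
    unfolding nn_integral_\<Omega>_eq by (rule nn_integral_cmult_indicator) simp
  also have "\<dots> < \<infinity>" using emeasure_\<Omega> by (simp add: ennreal_mult_less_top)
  finally show ?thesis .
qed

text \<open>An integrable Borel version of the energy density on the whole space, so that it can be
  mollified with the same kernel as the gradient.\<close>

lemma modular_density:
  assumes g: "g \<in> borel_measurable borel" "modular g < \<infinity>"
  shows "\<exists>G. integrable lborel G \<and> (\<forall>y. G y \<ge> 0) \<and> (AE y in lborel. y \<in> \<Omega> \<longrightarrow> G y = \<psi> y (norm (g y)))"
proof -
  have m: "(\<lambda>x. \<psi> x (norm (g x))) \<in> borel_measurable (lebesgue_on \<Omega>)"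
    by (rule psi_norm_measurable[OF borel_measurable_\<Omega>[OF g(1)]])
  have "(\<integral>\<^sup>+x. ennreal (norm (\<psi> x (norm (g x)))) \<partial>lebesgue_on \<Omega>) = modular g"
    unfolding modular_def by (intro nn_integral_cong) (simp add: psi_nonneg)
  then have "integrable (lebesgue_on \<Omega>) (\<lambda>x. \<psi> x (norm (g x)))"
    using m g(2) unfolding integrable_iff_bounded by simp
  then obtain G where G: "integrable lborel G" "AE y in lborel. y \<in> \<Omega> \<longrightarrow> G y = \<psi> y (norm (g y))"
    using lebesgue_on_borel_representative[OF \<Omega>_borel, of "\<lambda>x. \<psi> x (norm (g x))"] by blast
  have "AE y in lborel. y \<in> \<Omega> \<longrightarrow> \<bar>G y\<bar> = \<psi> y (norm (g y))"
    using G(2) by (rule eventually_mono) (auto simp: psi_nonneg)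
  then show ?thesis using G(1) by (intro exI[of _ "\<lambda>y. \<bar>G y\<bar>"]) auto
qed

text \<open>Jensen's inequality with the line of \<open>psi_line\<close>. Put t = |conv \<kappa> g
  x| and let T be the \<kappa>-average of |g|. As t is at most T, the factor 2 T / t - 1 is at least
  1; and \<psi>(x,t) (2 T / t - 1) is the average of the line at |g y|, to which the pointwise
  comparison applies.\<close>

lemma psi_conv_le:
  fixes g :: "'a \<Rightarrow> 'a"
  assumes line: "\<forall>y\<in>cball x \<gamma> \<inter> \<Omega>. \<forall>z\<in>cball x \<gamma> \<inter> \<Omega>. \<forall>t \<xi>. 0 < t \<and> t \<le> K \<and> \<xi> \<ge> 0 \<longrightarrow> \<psi> z t * (2 * \<xi> / t - 1) \<le> M * \<psi> y \<xi> + N"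
    and MN: "M \<ge> 0" "N \<ge> 0" and x: "x \<in> \<Omega>" and \<gamma>: "\<gamma> > 0"
    and \<kappa>: "kernel e r \<kappa>" "\<And>z. \<kappa> z \<noteq> 0 \<Longrightarrow> norm z \<le> \<gamma>"
    and g: "integrable lborel g" "\<And>y. y \<notin> \<Omega> \<Longrightarrow> g y = 0"
    and G: "integrable lborel G" "\<And>y. G y \<ge> 0" "AE y in lborel. y \<in> \<Omega> \<longrightarrow> G y = \<psi> y (norm (g y))"
    and K: "norm (conv \<kappa> g x) \<le> K"
  shows "\<psi> x (norm (conv \<kappa> g x)) \<le> M * conv \<kappa> G x + N"
proof -
  note kn = kernel_nonneg[OF \<kappa>(1)]
  note ig = kernel_weighted[OF \<kappa>(1) g(1), of x]
  have in': "integrable lborel (\<lambda>y. \<kappa> (x - y) * norm (g y))"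
    using kernel_weighted(1)[OF \<kappa>(1) integrable_norm[OF g(1)], of x] by simp
  have iG: "integrable lborel (\<lambda>y. \<kappa> (x - y) * G y)"
    using kernel_weighted(1)[OF \<kappa>(1) G(1), of x] by simp
  have cG: "conv \<kappa> G x = (LINT y|lborel. \<kappa> (x - y) * G y)" by (simp add: conv_def)
  have cG0: "conv \<kappa> G x \<ge> 0" unfolding cG using kn G(2) by (intro Bochner_Integration.integral_nonneg) simp
  define t where "t = norm (conv \<kappa> g x)"
  show ?thesis
  proof (cases "t = 0")
    case True
    then show ?thesis using psi_0[OF x] MN cG0 by (simp add: t_def)
  next
    case False
    then have t: "t > 0" "t \<le> K" using K by (auto simp: t_def)
    define T where "T = (LINT y|lborel. \<kappa> (x - y) * norm (g y))"
    have "t \<le> (LINT y|lborel. norm (\<kappa> (x - y) *\<^sub>R g y))" unfolding t_def conv_def by (rule integral_norm_bound)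
    also have "\<dots> = T" unfolding T_def using kn by simp
    finally have tT: "t \<le> T" .
    have pt: "\<psi> x t \<ge> 0" using psi_nonneg[OF x] t by simp
    have "\<psi> x t * 1 \<le> \<psi> x t * (2 * T / t - 1)"
      using tT t pt by (intro mult_left_mono) (auto simp: field_simps)
    also have "\<dots> = (2 * \<psi> x t / t) * T - \<psi> x t * 1" using t by (simp add: field_simps)
    also have "\<dots> = (2 * \<psi> x t / t) * (LINT y|lborel. \<kappa> (x - y) * norm (g y)) - \<psi> x t * (LINT y|lborel. \<kappa> (x - y))"
      by (simp only: T_def ig(3))
    also have "\<dots> = (LINT y|lborel. (2 * \<psi> x t / t) * (\<kappa> (x - y) * norm (g y)) - \<psi> x t * \<kappa> (x - y))"
      using in' ig(2) by simp
    also have "\<dots> \<le> (LINT y|lborel. M * (\<kappa> (x - y) * G y) + N * \<kappa> (x - y))"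
    proof (rule integral_mono_AE)
      show "AE y in lborel. (2 * \<psi> x t / t) * (\<kappa> (x - y) * norm (g y)) - \<psi> x t * \<kappa> (x - y) \<le> M * (\<kappa> (x - y) * G y) + N * \<kappa> (x - y)"
        using G(3)
      proof (rule eventually_mono)
        fix y assume y: "y \<in> \<Omega> \<longrightarrow> G y = \<psi> y (norm (g y))"
        have *: "\<kappa> (x - y) * (\<psi> x t * (2 * norm (g y) / t - 1)) \<le> \<kappa> (x - y) * (M * G y + N)"
        proof (cases "\<kappa> (x - y) = 0")
          case nz: False
          have "\<psi> x t * (2 * norm (g y) / t - 1) \<le> M * G y + N"
          proof (cases "y \<in> \<Omega>")
            case True
            have "y \<in> cball x \<gamma> \<inter> \<Omega>" using \<kappa>(2)[OF nz] True by (simp add: dist_norm)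
            moreover have "x \<in> cball x \<gamma> \<inter> \<Omega>" using x \<gamma> by simp
            ultimately have "\<psi> x t * (2 * norm (g y) / t - 1) \<le> M * \<psi> y (norm (g y)) + N"
              using line t by simp
            then show ?thesis using y True by simp
          next
            \<comment> \<open>Outside \<Omega> no comparison is available, but there g = 0 and the
              line has the value - \<psi>(x,t).\<close>
            case False
            then have "\<psi> x t * (2 * norm (g y) / t - 1) \<le> 0" using g(2) pt by simp
            also have "0 \<le> M * G y + N" using MN G(2) by simp
            finally show ?thesis .
          qed
          then show ?thesis using kn by (intro mult_left_mono)
        qed simp
        then show "(2 * \<psi> x t / t) * (\<kappa> (x - y) * norm (g y)) - \<psi> x t * \<kappa> (x - y) \<le> M * (\<kappa> (x - y) * G y) + N * \<kappa> (x - y)"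
          by (simp add: algebra_simps)
      qed
    qed (use in' ig(2) iG in auto)
    also have "\<dots> = M * conv \<kappa> G x + N" using iG ig by (simp add: cG)
    finally show ?thesis by (simp add: t_def)
  qed
qed

text \<open>For p at most d the derivative is put on the kernel, whose gradient has L^1 norm A /
  \<gamma>, and |v| is at most B. For p > d the pointwise bound s \<le> a + a^(1-p) s^p is averaged:
  the kernel is at most b / \<gamma>^d and the p-th power of |g| is integrable. The bound is
  expressed in 2 \<gamma>, the radius at which (Cont) will be used.\<close>

lemma conv_dil_bound:
  fixes g :: "'a \<Rightarrow> 'a"
  assumes v: "approx_pair v g" and B: "\<And>x. \<bar>v x\<bar> \<le> B" and \<kappa>: "kernel e r \<kappa>"
    and fin: "modular g < \<infinity>" and g0: "\<And>y. y \<notin> \<Omega> \<Longrightarrow> g y = 0"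
  shows "\<exists>D>1. \<forall>\<gamma>>0. \<forall>x. norm (conv (dil \<gamma> \<kappa>) g x) \<le> D * (2 * \<gamma>) powr (- \<mu>)"
proof -
  have iv: "integrable lborel v" and ig: "integrable lborel g" using v by (auto simp: approx_pair_def)
  have [measurable]: "v \<in> borel_measurable borel" "g \<in> borel_measurable borel" using iv ig by auto
  have B0: "B \<ge> 0" using B[of 0] by linarith
  have "\<exists>D0\<ge>0. \<forall>\<gamma>>0. \<forall>x. norm (conv (dil \<gamma> \<kappa>) g x) \<le> D0 * \<gamma> powr (- \<mu>)"
  proof (cases "p \<le> real DIM('a)")
    case True
    then have \<mu>: "\<mu> = 1" using p by (simp add: \<mu>_def)
    define A where "A = (LINT z|lborel. norm (grad \<kappa> z))"
    have "norm (conv (dil \<gamma> \<kappa>) g x) \<le> (B * A) * \<gamma> powr (- \<mu>)" if \<gamma>: "\<gamma> > 0" for \<gamma> x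
    proof -
      note k = kernel_C1c[OF kernel_dil[OF \<kappa> \<gamma>]]
      note [measurable] = C1c_measurable[OF k]
      have int: "integrable lborel (\<lambda>y. norm (grad (dil \<gamma> \<kappa>) (x - y)))"
        using C1c_integrable(2)[OF k] by (intro integrable_norm) (simp add: integrable_reflect_iff)
      have "norm (conv (dil \<gamma> \<kappa>) g x) = norm (LINT y|lborel. v y *\<^sub>R grad (dil \<gamma> \<kappa>) (x - y))"
        using grad_conv[OF v k] gradI(2)[OF conv_has_derivative[OF k iv]] by metis
      also have "\<dots> \<le> (LINT y|lborel. norm (v y *\<^sub>R grad (dil \<gamma> \<kappa>) (x - y)))" by (rule integral_norm_bound)
      also have "\<dots> \<le> (LINT y|lborel. B * norm (grad (dil \<gamma> \<kappa>) (x - y)))"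
      proof (rule integral_mono')
        show "integrable lborel (\<lambda>y. B * norm (grad (dil \<gamma> \<kappa>) (x - y)))" using int by simp
        show "norm (v y *\<^sub>R grad (dil \<gamma> \<kappa>) (x - y)) \<le> B * norm (grad (dil \<gamma> \<kappa>) (x - y))" for y
          using B[of y] by (simp add: mult_right_mono)
        show "0 \<le> B * norm (grad (dil \<gamma> \<kappa>) (x - y))" for y using B0 by simp
      qed
      also have "\<dots> = B * (LINT y|lborel. norm (grad (dil \<gamma> \<kappa>) y))"
        using integral_reflect[of "\<lambda>y. norm (grad (dil \<gamma> \<kappa>) y)" x] by simp
      also have "\<dots> = B * ((1 / \<gamma>) * A)" unfolding A_def by (simp only: grad_dil_L1[OF kernel_C1c[OF \<kappa>] \<gamma>])
      also have "\<dots> = (B * A) * \<gamma> powr (- \<mu>)" using \<gamma> by (simp add: \<mu> powr_minus_divide)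
      finally show ?thesis .
    qed
    moreover have "B * A \<ge> 0" using B0 by (simp add: A_def)
    ultimately show ?thesis by blast
  next
    case False
    then have \<mu>: "\<mu> * p = real DIM('a)" using p by (simp add: \<mu>_def)
    obtain G where G: "integrable lborel G" "\<And>y. G y \<ge> 0" "AE y in lborel. y \<in> \<Omega> \<longrightarrow> G y = \<psi> y (norm (g y))"
      using modular_density[of g] fin by auto
    have igp: "integrable lborel (\<lambda>y. norm (g y) powr p)"
    proof (rule Bochner_Integration.integrable_bound)
      have "integrable lborel (indicator \<Omega> :: 'a \<Rightarrow> real)" using emeasure_\<Omega> by (intro integrable_real_indicator) auto
      then show "integrable lborel (\<lambda>y. (1 / C1) * G y + \<xi>0 powr p * indicator \<Omega> y)"
        using G(1) by (intro Bochner_Integration.integrable_add integrable_mult_right) auto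
      show "AE y in lborel. norm (norm (g y) powr p) \<le> norm ((1 / C1) * G y + \<xi>0 powr p * indicator \<Omega> y)"
        using G(3)
      proof (rule eventually_mono)
        fix y assume y: "y \<in> \<Omega> \<longrightarrow> G y = \<psi> y (norm (g y))"
        have nn: "(1 / C1) * G y + \<xi>0 powr p * indicator \<Omega> y \<ge> 0" using G(2)[of y] C1 by (intro add_nonneg_nonneg) auto
        have "norm (g y) powr p \<le> (1 / C1) * G y + \<xi>0 powr p * indicator \<Omega> y"
        proof (cases "y \<in> \<Omega>")
          case True
          then show ?thesis using psi_powr_lower[OF True, of "norm (g y)"] y by simp
        next
          case False
          then show ?thesis using nn g0 by simp
        qed
        then show "norm (norm (g y) powr p) \<le> norm ((1 / C1) * G y + \<xi>0 powr p * indicator \<Omega> y)" using nn by simp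
      qed
    qed measurable
    define P where "P = (LINT y|lborel. norm (g y) powr p)"
    have P: "P \<ge> 0" by (simp add: P_def)
    obtain b where b: "\<And>x. \<bar>\<kappa> x\<bar> \<le> b" using C1c_bounded[OF kernel_C1c[OF \<kappa>]] by metis
    have b0: "b \<ge> 0" using b[of 0] by linarith
    have "norm (conv (dil \<gamma> \<kappa>) g x) \<le> (1 + b * P) * \<gamma> powr (- \<mu>)" if \<gamma>: "\<gamma> > 0" for \<gamma> x
    proof -
      note k = kernel_dil[OF \<kappa> \<gamma>]
      \<comment> \<open>With this choice and \<mu> p = d, the factor a^(1-p) / \<gamma>^d is again
        a, so both terms have the same order.\<close>
      define a where "a = \<gamma> powr (- \<mu>)"
      have a: "a > 0" using \<gamma> by (simp add: a_def)
      have young: "s \<le> a + a powr (1 - p) * s powr p" if "s \<ge> 0" for s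
      proof (cases "s \<le> a")
        case True
        then show ?thesis using a by (smt (verit) mult_nonneg_nonneg powr_ge_zero)
      next
        case False
        have "s = s powr (1 - p) * s powr p" using False a by (simp flip: powr_add)
        also have "\<dots> \<le> a powr (1 - p) * s powr p"
          using False a p by (intro mult_right_mono powr_mono2') auto
        finally show ?thesis using a by linarith
      qed
      have kb: "dil \<gamma> \<kappa> z \<le> b / \<gamma> ^ DIM('a)" for z
        using b[of "(1/\<gamma>) *\<^sub>R z"] \<gamma> by (simp add: dil_def divide_right_mono)
      have ip: "integrable lborel (\<lambda>y. dil \<gamma> \<kappa> (x - y) * norm (g y) powr p)"
        using kernel_weighted(1)[OF k igp, of x] by simp
      have "norm (conv (dil \<gamma> \<kappa>) g x) \<le> (LINT y|lborel. norm (dil \<gamma> \<kappa> (x - y) *\<^sub>R g y))"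
        unfolding conv_def by (rule integral_norm_bound)
      also have "\<dots> \<le> (LINT y|lborel. a * dil \<gamma> \<kappa> (x - y) + a powr (1 - p) * (dil \<gamma> \<kappa> (x - y) * norm (g y) powr p))"
      proof (rule integral_mono)
        show "integrable lborel (\<lambda>y. norm (dil \<gamma> \<kappa> (x - y) *\<^sub>R g y))"
          by (rule integrable_norm[OF kernel_weighted(1)[OF k ig]])
        show "integrable lborel (\<lambda>y. a * dil \<gamma> \<kappa> (x - y) + a powr (1 - p) * (dil \<gamma> \<kappa> (x - y) * norm (g y) powr p))"
          using kernel_weighted(2)[OF k ig, of x] ip by simp
        show "norm (dil \<gamma> \<kappa> (x - y) *\<^sub>R g y) \<le> a * dil \<gamma> \<kappa> (x - y) + a powr (1 - p) * (dil \<gamma> \<kappa> (x - y) * norm (g y) powr p)" for y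
          using mult_left_mono[OF young[OF norm_ge_zero[of "g y"]] kernel_nonneg[OF k, of "x - y"]] kernel_nonneg[OF k, of "x - y"]
          by (simp add: algebra_simps)
      qed
      also have "\<dots> = a + a powr (1 - p) * (LINT y|lborel. dil \<gamma> \<kappa> (x - y) * norm (g y) powr p)"
        using kernel_weighted(2,3)[OF k ig, of x] ip by simp
      also have "\<dots> \<le> a + a powr (1 - p) * (LINT y|lborel. b / \<gamma> ^ DIM('a) * norm (g y) powr p)"
        using ip igp kb by (intro add_left_mono mult_left_mono integral_mono mult_right_mono) auto
      also have "\<dots> = a + (a powr (1 - p) / \<gamma> ^ DIM('a)) * (b * P)" by (simp add: P_def)
      also have "a powr (1 - p) / \<gamma> ^ DIM('a) = a"
      proof -
        have "a powr (1 - p) / \<gamma> ^ DIM('a) = \<gamma> powr (- \<mu> * (1 - p)) / \<gamma> powr real DIM('a)"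
          using \<gamma> by (simp add: a_def powr_powr powr_realpow)
        also have "\<dots> = \<gamma> powr (- \<mu> * (1 - p) - real DIM('a))" by (simp add: powr_diff)
        also have "- \<mu> * (1 - p) - real DIM('a) = - \<mu>" using \<mu> by (simp add: algebra_simps)
        finally show ?thesis by (simp add: a_def)
      qed
      finally show ?thesis by (simp add: a_def algebra_simps)
    qed
    moreover have "1 + b * P \<ge> 0" using b0 P by simp
    ultimately show ?thesis by blast
  qed
  then obtain D0 where D0: "D0 \<ge> 0" "\<And>\<gamma> x. \<gamma> > 0 \<Longrightarrow> norm (conv (dil \<gamma> \<kappa>) g x) \<le> D0 * \<gamma> powr (- \<mu>)" by blast
  show ?thesis
  \<comment> \<open>The factor 2 powr \<mu> comes from passing to the scale 2 \<gamma>; the summand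
    2 only secures D > 1, as (Cont) demands.\<close>
  proof (intro exI[of _ "D0 * 2 powr \<mu> + 2"] conjI allI impI)
    show "1 < D0 * 2 powr \<mu> + 2" using mult_nonneg_nonneg[OF D0(1) powr_ge_zero[of 2 \<mu>]] by linarith
    fix \<gamma> x assume \<gamma>: "\<gamma> > (0::real)"
    have "norm (conv (dil \<gamma> \<kappa>) g x) \<le> D0 * \<gamma> powr (- \<mu>)" by (rule D0(2)[OF \<gamma>])
    also have "\<gamma> powr (- \<mu>) = 2 powr \<mu> * (2 * \<gamma>) powr (- \<mu>)" using \<gamma> by (simp add: powr_mult powr_minus field_simps)
    also have "D0 * (2 powr \<mu> * (2 * \<gamma>) powr (- \<mu>)) \<le> (D0 * 2 powr \<mu> + 2) * (2 * \<gamma>) powr (- \<mu>)"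
      by (simp add: algebra_simps)
    finally show "norm (conv (dil \<gamma> \<kappa>) g x) \<le> (D0 * 2 powr \<mu> + 2) * (2 * \<gamma>) powr (- \<mu>)" .
  qed
qed

end

subsection \<open>Density of test functions\<close>

context integrand
begin

text \<open>No relation between v and g is built in, so that sums, limits and changes of g outside
  \<Omega> require estimates only.\<close>

definition modular_approx :: "('a \<Rightarrow> real) \<Rightarrow> ('a \<Rightarrow> 'a) \<Rightarrow> bool" where
  "modular_approx v g \<longleftrightarrow> v \<in> borel_measurable borel \<and> g \<in> borel_measurable borel \<and>
     (\<forall>\<epsilon>>0. \<exists>\<phi>\<in>Cc_infinity \<Omega>. L1d v \<phi> < ennreal \<epsilon> \<and> modular (\<lambda>x. g x - grad \<phi> x) < ennreal \<epsilon>)"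

text \<open>The support lies in the sum of \<open>cball x0 s \<inter> closure \<Omega>\<close> and
  the support ball of the dilated kernel. This sum of compact sets is compact, and
  \<open>inward\<close> places it inside the open set \<Omega>, even where v reaches the
  boundary.\<close>

lemma conv_dil_Cc:
  assumes chart: "inward \<Omega> x0 s e r \<gamma>0" and \<gamma>: "0 < \<gamma>" "\<gamma> < \<gamma>0" and \<kappa>: "kernel e r \<kappa>"
    and v: "integrable lborel v" "\<And>x. x \<notin> cball x0 s \<inter> \<Omega> \<Longrightarrow> v x = 0"
  shows "conv (dil \<gamma> \<kappa>) v \<in> Cc_infinity \<Omega>"
proof (rule Cc_infinityI)
  let ?A = "cball x0 s \<inter> closure \<Omega>" and ?B = "cball (\<gamma> *\<^sub>R e) (\<gamma> * r)"
  let ?K = "{y + z |y z. y \<in> ?A \<and> z \<in> ?B}"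
  note k = kernel_dil[OF \<kappa> \<gamma>(1)]
  show "cd j (conv (dil \<gamma> \<kappa>) v)" for j by (rule cd_conv[OF kernel_Cc[OF k] v(1)])
  show "compact ?K" by (intro compact_sums compact_cball compact_Int_closed closed_closure)
  show "?K \<subseteq> \<Omega>"
  proof
    fix x assume "x \<in> ?K"
    then obtain y z where yz: "x = y + z" "y \<in> ?A" "z \<in> ?B" by blast
    have "dist (\<gamma> *\<^sub>R e) (\<gamma> *\<^sub>R ((1/\<gamma>) *\<^sub>R z)) = \<gamma> * dist e ((1/\<gamma>) *\<^sub>R z)"
      by (simp only: dist_norm scaleR_diff_right[symmetric] norm_scaleR) (use \<gamma>(1) in simp)
    then have "(1/\<gamma>) *\<^sub>R z \<in> cball e r" using yz(3) \<gamma>(1) by simp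
    then have "y + \<gamma> *\<^sub>R ((1/\<gamma>) *\<^sub>R z) \<in> \<Omega>" using chart yz(2) \<gamma> unfolding inward_def by blast
    then show "x \<in> \<Omega>" using \<gamma>(1) yz(1) by simp
  qed
  fix x assume x: "x \<notin> ?K"
  show "conv (dil \<gamma> \<kappa>) v x = 0"
  proof (rule conv_zero)
    fix z assume "dil \<gamma> \<kappa> z \<noteq> 0"
    then have z: "z \<in> ?B" using kernel_support[OF k] by blast
    have "x - z \<notin> ?A"
    proof
      assume "x - z \<in> ?A"
      then have "(x - z) + z \<in> ?K" using z by blast
      then show False using x by simp
    qed
    then show "v (x - z) = 0" using closure_subset[of \<Omega>] by (intro v(2)) auto
  qed
qed

lemma local_modular_approx:
  assumes chart: "inward \<Omega> x0 s e r \<gamma>0" and v: "approx_pair v g" and B: "\<And>x. \<bar>v x\<bar> \<le> B"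
    and supp: "\<And>x. x \<notin> cball x0 s \<inter> \<Omega> \<Longrightarrow> v x = 0 \<and> g x = 0" and fin: "modular g < \<infinity>"
  shows "modular_approx v g"
proof -
  have iv: "integrable lborel v" and ig: "integrable lborel g" using v by (auto simp: approx_pair_def)
  have [measurable]: "v \<in> borel_measurable borel" "g \<in> borel_measurable borel" using iv ig by auto
  have r: "r > 0" "r \<le> 1" "norm e \<le> 1" "\<gamma>0 > 0" using chart by (auto simp: inward_def)
  obtain \<kappa> where \<kappa>: "kernel e r \<kappa>" using kernel_exists[OF r(1)] by blast
  have g0: "\<And>y. y \<notin> \<Omega> \<Longrightarrow> g y = 0" using supp by blast
  obtain G where G: "integrable lborel G" "\<And>y. G y \<ge> 0" "AE y in lborel. y \<in> \<Omega> \<longrightarrow> G y = \<psi> y (norm (g y))"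
    using modular_density[of g] fin by auto
  have [measurable]: "G \<in> borel_measurable borel" using G by auto
  obtain D where D: "D > 1" "\<And>\<gamma> x. \<gamma> > 0 \<Longrightarrow> norm (conv (dil \<gamma> \<kappa>) g x) \<le> D * (2 * \<gamma>) powr (- \<mu>)"
    using conv_dil_bound[OF v B \<kappa> fin g0] by auto
  from psi_line[OF D(1)] obtain M N where MN: "M \<ge> 0" "N \<ge> 0" and all: "\<forall>\<gamma>\<in>{0<..<1/2}. \<forall>x.
     \<forall>y\<in>cball x \<gamma> \<inter> \<Omega>. \<forall>z\<in>cball x \<gamma> \<inter> \<Omega>.
     \<forall>t \<xi>. 0 < t \<and> t \<le> D * \<gamma> powr (- \<mu>) \<and> \<xi> \<ge> 0 \<longrightarrow> \<psi> z t * (2 * \<xi> / t - 1) \<le> M * \<psi> y \<xi> + N"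
    by (elim exE conjE) (rule that)
  note line = spec[OF bspec[OF all]]
  \<comment> \<open>The divisor is at least 2, so the scales are strictly below both bounds:
    \<gamma>0 keeps the support in \<Omega>, and 1/4 makes 2 \<gamma> < 1/2 admissible in
    (Cont).\<close>
  define \<gamma>' where "\<gamma>' n = min (1/4) \<gamma>0 / real (n + 2)" for n
  have \<gamma>': "\<gamma>' n > 0" "\<gamma>' n < \<gamma>0" "\<gamma>' n < 1/4" for n
  proof -
    have m: "min (1/4) \<gamma>0 > 0" using r by simp
    show "\<gamma>' n > 0" using m by (simp add: \<gamma>'_def)
    have "a / real (n + 2) < a" if "a > 0" for a :: real
    proof -
      have "a * 1 < a * real (n + 2)" using that by (intro mult_strict_left_mono) auto
      then show ?thesis by (simp add: pos_divide_less_eq)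
    qed
    from this[OF m] have "\<gamma>' n < min (1/4) \<gamma>0" by (simp only: \<gamma>'_def)
    then show "\<gamma>' n < \<gamma>0" "\<gamma>' n < 1/4" by auto
  qed
  have \<gamma>0: "\<gamma>' \<longlonglongrightarrow> 0"
    unfolding \<gamma>'_def by (rule LIMSEQ_ignore_initial_segment[of "\<lambda>n. min (1/4) \<gamma>0 / real n" 0 2, OF lim_const_over_n])
  \<comment> \<open>L^1 convergence of the mollified gradients gives convergence almost everywhere
    only along a subsequence; all scales are restricted to it.\<close>
  obtain \<rho> :: "nat \<Rightarrow> nat" where \<rho>: "strict_mono \<rho>" "AE x in lborel. (\<lambda>n. conv (dil (\<gamma>' (\<rho> n)) \<kappa>) g x) \<longlonglongrightarrow> g x"
    using L1d_AE_subseq[OF ig integrable_conv[OF kernel_dil[OF \<kappa> \<gamma>'(1)] ig] mollify_dil_tendsto[OF \<kappa> ig \<gamma>'(1) \<gamma>0]] by blast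
  define \<gamma> where "\<gamma> n = \<gamma>' (\<rho> n)" for n
  have \<gamma>: "\<gamma> n > 0" "\<gamma> n < \<gamma>0" "\<gamma> n < 1/4" for n using \<gamma>' by (auto simp: \<gamma>_def)
  have \<gamma>lim: "\<gamma> \<longlonglongrightarrow> 0" using LIMSEQ_subseq_LIMSEQ[OF \<gamma>0 \<rho>(1)] by (simp add: \<gamma>_def[abs_def] o_def)
  note kd = kernel_dil[OF \<kappa> \<gamma>(1)]
  have [measurable]: "dil (\<gamma> n) \<kappa> \<in> borel_measurable borel" for n by (rule C1c_measurable(1)[OF kernel_C1c[OF kd]])
  define \<phi> where "\<phi> n = conv (dil (\<gamma> n) \<kappa>) v" for n
  have \<phi>: "\<phi> n \<in> Cc_infinity \<Omega>" for n
    unfolding \<phi>_def using supp by (intro conv_dil_Cc[OF chart \<gamma>(1,2) \<kappa> iv]) blast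
  have gr: "grad (\<phi> n) x = conv (dil (\<gamma> n) \<kappa>) g x" for n x
    unfolding \<phi>_def by (rule grad_conv[OF v kernel_C1c[OF kd]])
  define E where "E n x = norm (G x - conv (dil (\<gamma> n) \<kappa>) G x)" for n x
  have [measurable]: "E n \<in> borel_measurable borel" for n unfolding E_def by measurable
  have E: "(\<lambda>n. \<integral>\<^sup>+x. ennreal (E n x) \<partial>lborel) \<longlonglongrightarrow> 0"
    using mollify_dil_tendsto[OF \<kappa> G(1) \<gamma>(1) \<gamma>lim] by (simp add: E_def)
  have \<phi>lim: "(\<lambda>n. L1d v (\<phi> n)) \<longlonglongrightarrow> 0"
    unfolding \<phi>_def by (rule mollify_dil_tendsto[OF \<kappa> iv \<gamma>(1) \<gamma>lim])
  define h where "h n x = \<psi> x (norm (g x - grad (\<phi> n) x))" for n x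
  have hb: "h n x \<le> C4 * (1 + M) * \<psi> x (norm (g x)) + C4 * N + C4 * M * E n x" if x: "x \<in> \<Omega>" and Gx: "G x = \<psi> x (norm (g x))" for n x
  proof -
    have "\<psi> x (norm (conv (dil (\<gamma> n) \<kappa>) g x)) \<le> M * conv (dil (\<gamma> n) \<kappa>) G x + N"
    \<comment> \<open>The kernel is centred at \<gamma> e with radius \<gamma> r, and |e| and r are
      at most 1, so its support lies within 2 \<gamma> of the origin; hence the doubled
      radius.\<close>
    proof (rule psi_conv_le[OF line[of "2 * \<gamma> n"] MN x _ kd _ ig g0 G])
      show "2 * \<gamma> n \<in> {0<..<1/2}" "0 < 2 * \<gamma> n" using \<gamma>[of n] by auto
      show "norm (conv (dil (\<gamma> n) \<kappa>) g x) \<le> D * (2 * \<gamma> n) powr (- \<mu>)" by (rule D(2)[OF \<gamma>(1)])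
      fix z assume "dil (\<gamma> n) \<kappa> z \<noteq> 0"
      then have "z \<in> cball (\<gamma> n *\<^sub>R e) (\<gamma> n * r)" using kernel_support[OF kd] by blast
      then have "norm (z - \<gamma> n *\<^sub>R e) \<le> \<gamma> n * r" by (simp add: dist_norm norm_minus_commute)
      then have "norm z \<le> norm (\<gamma> n *\<^sub>R e) + \<gamma> n * r"
        using norm_triangle_ineq[of "\<gamma> n *\<^sub>R e" "z - \<gamma> n *\<^sub>R e"] by simp
      also have "\<dots> = \<gamma> n * norm e + \<gamma> n * r" using \<gamma>(1)[of n] by simp
      also have "\<dots> \<le> \<gamma> n * 1 + \<gamma> n * 1" using \<gamma>(1)[of n] r by (intro add_mono mult_left_mono) auto
      finally show "norm z \<le> 2 * \<gamma> n" by simp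
    qed
    also have "\<dots> \<le> M * (\<psi> x (norm (g x)) + E n x) + N"
      using MN unfolding E_def Gx by (intro add_right_mono mult_left_mono) auto
    finally have 1: "\<psi> x (norm (- grad (\<phi> n) x)) \<le> M * (\<psi> x (norm (g x)) + E n x) + N" by (simp add: gr)
    have "h n x \<le> C4 * (\<psi> x (norm (g x)) + \<psi> x (norm (- grad (\<phi> n) x)))"
      using psi_norm_add[OF x, of "g x" "- grad (\<phi> n) x"] by (simp add: h_def)
    also have "\<dots> \<le> C4 * (\<psi> x (norm (g x)) + (M * (\<psi> x (norm (g x)) + E n x) + N))"
      using 1 C4 by (intro mult_left_mono add_left_mono) auto
    also have "\<dots> = C4 * (1 + M) * \<psi> x (norm (g x)) + C4 * N + C4 * M * E n x" by (simp add: algebra_simps)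
    finally show ?thesis .
  qed
  have hm: "h n \<in> borel_measurable (lebesgue_on \<Omega>)" for n
    unfolding h_def using C1c_measurable(2)[OF Cc_infinity_C1c[OF \<phi>]]
    by (intro psi_norm_measurable borel_measurable_\<Omega> borel_measurable_diff) auto
  have h0: "h n x \<ge> 0" if "x \<in> \<Omega>" for n x using that by (simp add: h_def psi_nonneg)
  define w where "w x = C4 * (1 + M) * \<psi> x (norm (g x)) + C4 * N" for x
  have wm: "w \<in> borel_measurable (lebesgue_on \<Omega>)"
    unfolding w_def using psi_norm_measurable[OF borel_measurable_\<Omega>, of g] by measurable
  have Em: "E n \<in> borel_measurable (lebesgue_on \<Omega>)" for n by (rule borel_measurable_\<Omega>) measurable
  note [measurable] = hm wm Em
  have c: "C4 * (1 + M) \<ge> 0" "C4 * N \<ge> 0" "C4 * M \<ge> 0" using MN C4 by auto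
  have AEG: "AE x in lebesgue_on \<Omega>. x \<in> \<Omega> \<and> G x = \<psi> x (norm (g x))"
    unfolding AE_\<Omega>_iff using G(3) by (auto elim!: eventually_mono)
  have wfin: "(\<integral>\<^sup>+x. ennreal (w x) \<partial>lebesgue_on \<Omega>) < \<infinity>"
  proof -
    have [measurable]: "(\<lambda>x. \<psi> x (norm (g x))) \<in> borel_measurable (lebesgue_on \<Omega>)"
      by (rule psi_norm_measurable[OF borel_measurable_\<Omega>]) measurable
    have "(\<integral>\<^sup>+x. ennreal (w x) \<partial>lebesgue_on \<Omega>) = (\<integral>\<^sup>+x. ennreal (C4 * (1 + M)) * ennreal (\<psi> x (norm (g x))) + ennreal (C4 * N) \<partial>lebesgue_on \<Omega>)"
      unfolding w_def using c psi_nonneg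
      by (intro nn_integral_cong) (auto simp: ennreal_mult ennreal_plus)
    also have "\<dots> = ennreal (C4 * (1 + M)) * modular g + (\<integral>\<^sup>+x. ennreal (C4 * N) \<partial>lebesgue_on \<Omega>)"
      unfolding modular_def by (simp add: nn_integral_add nn_integral_cmult)
    also have "(\<integral>\<^sup>+x. ennreal (C4 * N) \<partial>lebesgue_on \<Omega>) = ennreal (C4 * N) * emeasure lborel \<Omega>"
      unfolding nn_integral_\<Omega>_eq by (rule nn_integral_cmult_indicator) simp
    finally show ?thesis using fin emeasure_\<Omega> by (simp add: ennreal_mult_less_top)
  qed
  \<comment> \<open>The bound on \<open>h n\<close> varies with \<open>n\<close> through \<open>E n\<close>, which tends to \<open>0\<close> in \<open>L\<^sup>1\<close>; after subtracting it, dominated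
     convergence applies with the fixed bound \<open>w\<close>.\<close>
  define k where "k n x = max 0 (h n x - C4 * M * E n x)" for n x
  have [measurable]: "k n \<in> borel_measurable (lebesgue_on \<Omega>)" for n unfolding k_def by measurable
  have klim: "(\<lambda>n. \<integral>\<^sup>+x. ennreal (norm (0 - k n x)) \<partial>lebesgue_on \<Omega>) \<longlonglongrightarrow> 0"
  proof (rule nn_integral_dominated_convergence_norm[where w=w, OF _ _ wm _ wfin])
    show "AE x in lebesgue_on \<Omega>. norm (k n x) \<le> w x" for n
      using AEG
    proof (rule eventually_mono)
      fix x assume x: "x \<in> \<Omega> \<and> G x = \<psi> x (norm (g x))"
      have "w x \<ge> 0" unfolding w_def using c mult_nonneg_nonneg[OF c(1) psi_nonneg[of x "norm (g x)"]] x by auto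
      then show "norm (k n x) \<le> w x" using hb[of x n] x by (auto simp: k_def w_def)
    qed
    have "AE x in lebesgue_on \<Omega>. (\<lambda>n. grad (\<phi> n) x) \<longlonglongrightarrow> g x"
      unfolding AE_\<Omega>_iff using \<rho>(2) by (auto elim!: eventually_mono simp: gr \<gamma>_def)
    then show "AE x in lebesgue_on \<Omega>. (\<lambda>n. k n x) \<longlonglongrightarrow> 0" using AEG
    proof eventually_elim
      case (elim x)
      have x: "x \<in> \<Omega>" using elim by simp
      have "(\<lambda>n. norm (g x - grad (\<phi> n) x)) \<longlonglongrightarrow> norm (g x - g x)" by (intro tendsto_intros elim)
      then have l: "(\<lambda>n. norm (g x - grad (\<phi> n) x)) \<longlonglongrightarrow> 0" by simp
      then have "eventually (\<lambda>n. norm (g x - grad (\<phi> n) x) < 1) sequentially" by (rule order_tendstoD) simp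
      \<comment> \<open>For arguments below 1, convexity and \<psi>(x,0) = 0 give \<psi>(x,s) \<le>
        s \<psi>(x,1), which yields convergence to 0 at fixed x.\<close>
      then have ev: "eventually (\<lambda>n. norm (k n x) \<le> norm (g x - grad (\<phi> n) x) * \<psi> x 1) sequentially"
      proof (rule eventually_mono)
        fix n assume n: "norm (g x - grad (\<phi> n) x) < 1"
        have E0: "C4 * M * E n x \<ge> 0" using c(3) by (auto simp: E_def intro: mult_nonneg_nonneg)
        have "h n x \<le> norm (g x - grad (\<phi> n) x) * \<psi> x 1"
          using psi_scale[OF x norm_ge_zero, of "g x - grad (\<phi> n) x" 1] n by (simp add: h_def)
        moreover have "norm (g x - grad (\<phi> n) x) * \<psi> x 1 \<ge> 0" using psi_nonneg[OF x, of 1] by simp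
        ultimately show "norm (k n x) \<le> norm (g x - grad (\<phi> n) x) * \<psi> x 1" using E0 by (simp add: k_def)
      qed
      have "(\<lambda>n. norm (g x - grad (\<phi> n) x) * \<psi> x 1) \<longlonglongrightarrow> 0 * \<psi> x 1" by (intro tendsto_mult l tendsto_const)
      then show ?case by (intro Lim_null_comparison[OF ev]) simp
    qed
  qed measurable
  have mle: "modular (\<lambda>x. g x - grad (\<phi> n) x) \<le> (\<integral>\<^sup>+x. ennreal (norm (0 - k n x)) \<partial>lebesgue_on \<Omega>) + ennreal (C4 * M) * (\<integral>\<^sup>+x. ennreal (E n x) \<partial>lborel)" for n
  proof -
    have "modular (\<lambda>x. g x - grad (\<phi> n) x) = (\<integral>\<^sup>+x. ennreal (h n x) \<partial>lebesgue_on \<Omega>)" by (simp add: modular_def h_def)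
    also have "\<dots> \<le> (\<integral>\<^sup>+x. ennreal (norm (0 - k n x)) + ennreal (C4 * M) * ennreal (E n x) \<partial>lebesgue_on \<Omega>)"
    proof (rule nn_integral_mono)
      fix x
      have E0: "E n x \<ge> 0" by (simp add: E_def)
      have "h n x \<le> k n x + C4 * M * E n x" by (simp add: k_def)
      also have "k n x = norm (0 - k n x)" by (simp add: k_def)
      finally have "ennreal (h n x) \<le> ennreal (norm (0 - k n x) + C4 * M * E n x)" by (rule ennreal_leI)
      also have "\<dots> = ennreal (norm (0 - k n x)) + ennreal (C4 * M * E n x)"
        by (rule ennreal_plus) (use mult_nonneg_nonneg[OF c(3) E0] in auto)
      also have "ennreal (C4 * M * E n x) = ennreal (C4 * M) * ennreal (E n x)" by (rule ennreal_mult[OF c(3) E0])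
      finally show "ennreal (h n x) \<le> ennreal (norm (0 - k n x)) + ennreal (C4 * M) * ennreal (E n x)" .
    qed
    also have "\<dots> = (\<integral>\<^sup>+x. ennreal (norm (0 - k n x)) \<partial>lebesgue_on \<Omega>) + ennreal (C4 * M) * (\<integral>\<^sup>+x. ennreal (E n x) \<partial>lebesgue_on \<Omega>)"
      by (simp add: nn_integral_add nn_integral_cmult)
    also have "\<dots> \<le> (\<integral>\<^sup>+x. ennreal (norm (0 - k n x)) \<partial>lebesgue_on \<Omega>) + ennreal (C4 * M) * (\<integral>\<^sup>+x. ennreal (E n x) \<partial>lborel)"
      by (intro add_left_mono mult_left_mono nn_integral_\<Omega>_le) simp
    finally show ?thesis .
  qed
  have "(\<lambda>n. (\<integral>\<^sup>+x. ennreal (norm (0 - k n x)) \<partial>lebesgue_on \<Omega>) + ennreal (C4 * M) * (\<integral>\<^sup>+x. ennreal (E n x) \<partial>lborel)) \<longlonglongrightarrow> 0"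
    using tendsto_add[OF klim ennreal_tendsto_cmult[OF _ E, of "ennreal (C4 * M)"]] by simp
  then have mlim: "(\<lambda>n. modular (\<lambda>x. g x - grad (\<phi> n) x)) \<longlonglongrightarrow> 0" by (rule ennreal_tendsto_0_le[OF _ mle])
  show ?thesis unfolding modular_approx_def
  proof (intro conjI allI impI)
    fix \<epsilon> :: real assume "\<epsilon> > 0"
    then have "eventually (\<lambda>n. L1d v (\<phi> n) < ennreal \<epsilon> \<and> modular (\<lambda>x. g x - grad (\<phi> n) x) < ennreal \<epsilon>) sequentially"
      by (intro eventually_conj order_tendstoD(2)[OF \<phi>lim] order_tendstoD(2)[OF mlim]) auto
    then obtain n where "L1d v (\<phi> n) < ennreal \<epsilon> \<and> modular (\<lambda>x. g x - grad (\<phi> n) x) < ennreal \<epsilon>"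
      unfolding eventually_sequentially by blast
    then show "\<exists>\<phi>\<in>Cc_infinity \<Omega>. L1d v \<phi> < ennreal \<epsilon> \<and> modular (\<lambda>x. g x - grad \<phi> x) < ennreal \<epsilon>"
      using \<phi> by blast
  qed measurable
qed

section \<open>Limits and sums of approximable pairs\<close>

lemma modular_approx_limit:
  assumes [measurable]: "v \<in> borel_measurable borel" "g \<in> borel_measurable borel"
    and ex: "\<And>\<epsilon>. \<epsilon> > 0 \<Longrightarrow> \<exists>v' g'. modular_approx v' g' \<and> L1d v v' < ennreal \<epsilon> \<and> modular (\<lambda>x. g x - g' x) < ennreal \<epsilon>"
  shows "modular_approx v g"
  unfolding modular_approx_def
proof (intro conjI allI impI)
  fix \<epsilon> :: real assume \<epsilon>: "\<epsilon> > 0"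
  \<comment> \<open>Two errors \<delta> occur, and the modular triangle inequality multiplies their
    sum by C4.\<close>
  define \<delta> where "\<delta> = \<epsilon> / (2 * C4)"
  have \<delta>: "\<delta> > 0" "\<delta> + \<delta> \<le> \<epsilon>" "C4 * (\<delta> + \<delta>) = \<epsilon>" using \<epsilon> C4 by (auto simp: \<delta>_def field_simps)
  obtain v' g' where a: "modular_approx v' g'" "L1d v v' < ennreal \<delta>" "modular (\<lambda>x. g x - g' x) < ennreal \<delta>"
    using ex[OF \<delta>(1)] by blast
  have [measurable]: "v' \<in> borel_measurable borel" "g' \<in> borel_measurable borel" using a(1) by (auto simp: modular_approx_def)
  obtain \<phi> where \<phi>: "\<phi> \<in> Cc_infinity \<Omega>" "L1d v' \<phi> < ennreal \<delta>" "modular (\<lambda>x. g' x - grad \<phi> x) < ennreal \<delta>"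
    using a(1) \<delta>(1) unfolding modular_approx_def by blast
  note [measurable] = C1c_measurable[OF Cc_infinity_C1c[OF \<phi>(1)]]
  have "L1d v \<phi> \<le> L1d v v' + L1d v' \<phi>" by (rule L1d_triangle) measurable
  also have "\<dots> < ennreal (\<delta> + \<delta>)" using \<delta>(1) by (intro ennreal_add_less a \<phi>) auto
  also have "\<dots> \<le> ennreal \<epsilon>" using \<delta>(2) by (rule ennreal_leI)
  finally have 1: "L1d v \<phi> < ennreal \<epsilon>" .
  have "modular (\<lambda>x. g x - grad \<phi> x) = modular (\<lambda>x. (g x - g' x) + (g' x - grad \<phi> x))" by simp
  also have "\<dots> \<le> ennreal C4 * (modular (\<lambda>x. g x - g' x) + modular (\<lambda>x. g' x - grad \<phi> x))"
    by (intro modular_add borel_measurable_\<Omega>) measurable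
  also have "\<dots> < ennreal C4 * ennreal (\<delta> + \<delta>)"
    using C4 \<delta>(1) by (intro ennreal_mult_strict_left_mono ennreal_add_less a \<phi>) auto
  also have "\<dots> = ennreal \<epsilon>" using \<delta> C4 by (simp flip: ennreal_mult' add: mult.commute)
  finally have 2: "modular (\<lambda>x. g x - grad \<phi> x) < ennreal \<epsilon>" .
  show "\<exists>\<phi>\<in>Cc_infinity \<Omega>. L1d v \<phi> < ennreal \<epsilon> \<and> modular (\<lambda>x. g x - grad \<phi> x) < ennreal \<epsilon>"
    using 1 2 \<phi>(1) by blast
qed measurable

lemma modular_approx_add:
  assumes a: "modular_approx v g" and b: "modular_approx w h"
  shows "modular_approx (\<lambda>x. v x + w x) (\<lambda>x. g x + h x)"
proof -
  have [measurable]: "v \<in> borel_measurable borel" "g \<in> borel_measurable borel" "w \<in> borel_measurable borel" "h \<in> borel_measurable borel"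
    using a b by (auto simp: modular_approx_def)
  show ?thesis unfolding modular_approx_def
  proof (intro conjI allI impI)
    fix \<epsilon> :: real assume \<epsilon>: "\<epsilon> > 0"
    define \<delta> where "\<delta> = \<epsilon> / (2 * C4)"
    have \<delta>: "\<delta> > 0" "\<delta> + \<delta> \<le> \<epsilon>" "C4 * (\<delta> + \<delta>) = \<epsilon>" using \<epsilon> C4 by (auto simp: \<delta>_def field_simps)
    obtain \<phi> where \<phi>: "\<phi> \<in> Cc_infinity \<Omega>" "L1d v \<phi> < ennreal \<delta>" "modular (\<lambda>x. g x - grad \<phi> x) < ennreal \<delta>"
      using a \<delta>(1) unfolding modular_approx_def by blast
    obtain \<theta> where \<theta>: "\<theta> \<in> Cc_infinity \<Omega>" "L1d w \<theta> < ennreal \<delta>" "modular (\<lambda>x. h x - grad \<theta> x) < ennreal \<delta>"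
      using b \<delta>(1) unfolding modular_approx_def by blast
    note C = Cc_infinity_C1c[OF \<phi>(1)] Cc_infinity_C1c[OF \<theta>(1)]
    note [measurable] = C1c_measurable[OF C(1)] C1c_measurable[OF C(2)]
    have "L1d (\<lambda>x. v x + w x) (\<lambda>x. \<phi> x + \<theta> x) \<le> (\<integral>\<^sup>+x. ennreal (norm (v x - \<phi> x)) + ennreal (norm (w x - \<theta> x)) \<partial>lborel)"
      by (intro nn_integral_mono) (simp add: abs_if flip: ennreal_plus)
    also have "\<dots> = L1d v \<phi> + L1d w \<theta>" by (rule nn_integral_add) measurable
    also have "\<dots> < ennreal (\<delta> + \<delta>)" using \<delta>(1) by (intro ennreal_add_less \<phi> \<theta>) auto
    also have "\<dots> \<le> ennreal \<epsilon>" using \<delta>(2) by (rule ennreal_leI)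
    finally have 1: "L1d (\<lambda>x. v x + w x) (\<lambda>x. \<phi> x + \<theta> x) < ennreal \<epsilon>" .
    have "modular (\<lambda>x. g x + h x - grad (\<lambda>x. \<phi> x + \<theta> x) x) = modular (\<lambda>x. (g x - grad \<phi> x) + (h x - grad \<theta> x))"
      by (simp add: C1c_add(2)[OF C] algebra_simps)
    also have "\<dots> \<le> ennreal C4 * (modular (\<lambda>x. g x - grad \<phi> x) + modular (\<lambda>x. h x - grad \<theta> x))"
      by (intro modular_add borel_measurable_\<Omega>) measurable
    also have "\<dots> < ennreal C4 * ennreal (\<delta> + \<delta>)"
      using C4 \<delta>(1) by (intro ennreal_mult_strict_left_mono ennreal_add_less \<phi> \<theta>) auto
    also have "\<dots> = ennreal \<epsilon>" using \<delta> C4 by (simp flip: ennreal_mult' add: mult.commute)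
    finally have 2: "modular (\<lambda>x. g x + h x - grad (\<lambda>x. \<phi> x + \<theta> x) x) < ennreal \<epsilon>" .
    show "\<exists>\<phi>\<in>Cc_infinity \<Omega>. L1d (\<lambda>x. v x + w x) \<phi> < ennreal \<epsilon> \<and> modular (\<lambda>x. g x + h x - grad \<phi> x) < ennreal \<epsilon>"
      by (intro bexI[of _ "\<lambda>x. \<phi> x + \<theta> x"] conjI 1 2 Cc_infinity_add[OF \<phi>(1) \<theta>(1)])
  qed measurable
qed

lemma modular_approx_zero: "modular_approx (\<lambda>x. 0) (\<lambda>x. 0)"
proof -
  have z: "(\<lambda>x. 0) \<in> Cc_infinity \<Omega>" by (rule Cc_infinityI[of _ "{}"]) auto
  have "modular (\<lambda>x. 0) = (\<integral>\<^sup>+x. 0 \<partial>lebesgue_on \<Omega>)"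
    unfolding modular_def by (intro nn_integral_cong) (simp add: psi_0)
  then show ?thesis unfolding modular_approx_def using z by (auto intro!: bexI[OF _ z])
qed

lemma modular_approx_sum:
  assumes "finite I" "\<And>i. i \<in> I \<Longrightarrow> modular_approx (v i) (g i)"
  shows "modular_approx (\<lambda>x. \<Sum>i\<in>I. v i x) (\<lambda>x. \<Sum>i\<in>I. g i x)"
  using assms
proof (induction I rule: finite_induct)
  case (insert i I)
  then show ?case using modular_approx_add[of "v i" "g i" "\<lambda>x. \<Sum>i\<in>I. v i x" "\<lambda>x. \<Sum>i\<in>I. g i x"] by simp
qed (simp add: modular_approx_zero)

lemma modular_approx_cong:
  assumes "modular_approx v g" "g' \<in> borel_measurable borel" "\<And>x. x \<in> \<Omega> \<Longrightarrow> g x = g' x"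
  shows "modular_approx v g'"
proof -
  have "modular (\<lambda>x. g x - grad \<phi> x) = modular (\<lambda>x. g' x - grad \<phi> x)" for \<phi>
    unfolding modular_def using assms(3) by (intro nn_integral_cong) simp
  then show ?thesis using assms(1,2) by (simp add: modular_approx_def)
qed

lemma modular_scale_finite:
  assumes "modular g < \<infinity>" "\<And>x. x \<in> \<Omega> \<Longrightarrow> \<bar>c x\<bar> \<le> b" and [measurable]: "g \<in> borel_measurable (lebesgue_on \<Omega>)"
  shows "modular (\<lambda>x. c x *\<^sub>R g x) < \<infinity>"
proof -
  obtain D where D: "D \<ge> 0" "\<And>x a. x \<in> \<Omega> \<Longrightarrow> a \<ge> 0 \<Longrightarrow> \<psi> x ((\<bar>b\<bar> + 1) * a) \<le> D * \<psi> x a"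
    using psi_dilate[of "\<bar>b\<bar> + 1"] by (auto simp: add_nonneg_pos)
  note [measurable] = psi_norm_measurable[OF assms(3)]
  have "modular (\<lambda>x. c x *\<^sub>R g x) \<le> (\<integral>\<^sup>+x. ennreal D * ennreal (\<psi> x (norm (g x))) \<partial>lebesgue_on \<Omega>)"
    unfolding modular_def
  proof (rule nn_integral_mono)
    fix x assume "x \<in> space (lebesgue_on \<Omega>)"
    then have x: "x \<in> \<Omega>" by simp
    have "\<psi> x (norm (c x *\<^sub>R g x)) \<le> \<psi> x ((\<bar>b\<bar> + 1) * norm (g x))"
      using assms(2)[OF x] by (intro psi_mono x) (auto intro!: mult_right_mono)
    also have "\<dots> \<le> D * \<psi> x (norm (g x))" by (rule D(2)[OF x]) simp
    finally show "ennreal (\<psi> x (norm (c x *\<^sub>R g x))) \<le> ennreal D * ennreal (\<psi> x (norm (g x)))"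
      using D(1) psi_nonneg[OF x] by (simp add: ennreal_leI flip: ennreal_mult)
  qed
  also have "\<dots> = ennreal D * modular g" unfolding modular_def by (simp add: nn_integral_cmult)
  also have "\<dots> < \<infinity>" using assms(1) by (simp add: ennreal_mult_less_top)
  finally show ?thesis .
qed

text \<open>The charts cover the compact closure, so interior and boundary points are treated alike.
  Boundedness of v is essential here: it bounds v grad \<eta>, and the upper growth in (A4) then
  makes its modular finite, whatever is known about v beyond its gradient.\<close>

lemma bounded_modular_approx:
  assumes v: "approx_pair v g" and B: "\<And>x. \<bar>v x\<bar> \<le> B"
    and supp: "\<And>x. x \<notin> \<Omega> \<Longrightarrow> v x = 0 \<and> g x = 0" and fin: "modular g < \<infinity>"
  shows "modular_approx v g"
proof -
  have iv: "integrable lborel v" and ig: "integrable lborel g" using v by (auto simp: approx_pair_def)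
  have [measurable]: "v \<in> borel_measurable borel" "g \<in> borel_measurable borel" using iv ig by auto
  have B0: "B \<ge> 0" using B[of 0] by linarith
  have "\<forall>x0\<in>closure \<Omega>. \<exists>s e r \<gamma>0. inward \<Omega> x0 s e r \<gamma>0" using inward_exists[OF lip] by blast
  then obtain s e r \<gamma>0 where chart: "\<And>x0. x0 \<in> closure \<Omega> \<Longrightarrow> inward \<Omega> x0 (s x0) (e x0) (r x0) (\<gamma>0 x0)" by metis
  have "compact (closure \<Omega>)" using bounded_\<Omega> by (simp add: compact_closure)
  moreover have "s x0 > 0" if "x0 \<in> closure \<Omega>" for x0 using chart[OF that] by (simp add: inward_def)
  ultimately obtain X \<eta> where X: "finite X" "X \<subseteq> closure \<Omega>" "\<And>x. x \<in> X \<Longrightarrow> C1c (\<eta> x)"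
    "\<And>x y. x \<in> X \<Longrightarrow> y \<notin> cball x (s x) \<Longrightarrow> \<eta> x y = 0" "\<And>y. y \<in> closure \<Omega> \<Longrightarrow> (\<Sum>x\<in>X. \<eta> x y) = (1::real)"
    using partition_of_unity[of "closure \<Omega>" s] by metis
  have loc: "modular_approx (\<lambda>y. \<eta> x y * v y) (\<lambda>y. \<eta> x y *\<^sub>R g y + v y *\<^sub>R grad (\<eta> x) y)" if x: "x \<in> X" for x
  proof -
    note [measurable] = C1c_measurable[OF X(3)[OF x]]
    obtain b where b: "b > 0" "\<And>y. \<bar>\<eta> x y\<bar> \<le> b" "\<And>y. norm (grad (\<eta> x) y) \<le> b" using C1c_bounded[OF X(3)[OF x]] by metis
    show ?thesis
    proof (rule local_modular_approx[OF chart approx_pair_mult[OF v X(3)[OF x]], where B="b * B"])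
      show "x \<in> closure \<Omega>" using x X(2) by blast
      show "\<bar>\<eta> x y * v y\<bar> \<le> b * B" for y unfolding abs_mult using b B by (intro mult_mono) auto
      show "\<eta> x y * v y = 0 \<and> \<eta> x y *\<^sub>R g y + v y *\<^sub>R grad (\<eta> x) y = 0" if "y \<notin> cball x (s x) \<inter> \<Omega>" for y
      proof (cases "y \<in> \<Omega>")
        case True
        then have y: "y \<notin> cball x (s x)" using that by blast
        have "grad (\<eta> x) y = 0" by (rule grad_zero_outside[OF closed_cball _ y]) (rule X(4)[OF x])
        then show ?thesis using X(4)[OF x y] by simp
      next
        case False
        then show ?thesis using supp by simp
      qed
      have "modular (\<lambda>y. \<eta> x y *\<^sub>R g y + v y *\<^sub>R grad (\<eta> x) y) \<le> ennreal C4 * (modular (\<lambda>y. \<eta> x y *\<^sub>R g y) + modular (\<lambda>y. v y *\<^sub>R grad (\<eta> x) y))"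
        by (intro modular_add borel_measurable_\<Omega>) measurable
      also have "\<dots> < \<infinity>"
      proof -
        have "modular (\<lambda>y. \<eta> x y *\<^sub>R g y) < \<infinity>"
          by (rule modular_scale_finite[OF fin b(2) borel_measurable_\<Omega>]) measurable
        moreover have "modular (\<lambda>y. v y *\<^sub>R grad (\<eta> x) y) < \<infinity>"
        proof (rule modular_bounded_finite)
          show "norm (v y *\<^sub>R grad (\<eta> x) y) \<le> B * b" for y using B b B0 by (simp add: mult_mono)
        qed
        ultimately show ?thesis by (simp add: ennreal_mult_less_top)
      qed
      finally show "modular (\<lambda>y. \<eta> x y *\<^sub>R g y + v y *\<^sub>R grad (\<eta> x) y) < \<infinity>" .
    qed
  qed
  have "modular_approx (\<lambda>y. \<Sum>x\<in>X. \<eta> x y * v y) (\<lambda>y. \<Sum>x\<in>X. \<eta> x y *\<^sub>R g y + v y *\<^sub>R grad (\<eta> x) y)"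
    by (rule modular_approx_sum[OF X(1) loc])
  also have "(\<lambda>y. \<Sum>x\<in>X. \<eta> x y * v y) = v"
  proof
    fix y
    show "(\<Sum>x\<in>X. \<eta> x y * v y) = v y"
    proof (cases "y \<in> \<Omega>")
      case True
      then have "(\<Sum>x\<in>X. \<eta> x y) = 1" using X(5) closure_subset by blast
      then show ?thesis by (simp flip: sum_distrib_right)
    qed (simp add: supp)
  qed
  finally show ?thesis
  proof (rule modular_approx_cong)
    fix y assume y: "y \<in> \<Omega>"
    have 1: "(\<Sum>x\<in>X. \<eta> x y) = 1" using X(5) y closure_subset by blast
    \<comment> \<open>The cutoffs sum to 1 on the open set \<Omega>, so their gradients sum to 0
      there and the product-rule terms cancel.\<close>
    have "grad (\<lambda>y. \<Sum>x\<in>X. \<eta> x y) y = grad (\<lambda>y. 1) y"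
      by (rule grad_eq_on_open[OF open_\<Omega> y]) (use X(5) closure_subset in blast)
    then have "(\<Sum>x\<in>X. grad (\<eta> x) y) = 0" using C1c_sum[OF X(1,3)] by simp
    then show "(\<Sum>x\<in>X. \<eta> x y *\<^sub>R g y + v y *\<^sub>R grad (\<eta> x) y) = g y"
      using 1 by (simp add: sum.distrib flip: scaleR_left.sum scaleR_right.sum)
  qed measurable
qed

text \<open>Truncation by \<open>t \<mapsto> k arctan (t/k)\<close>, a smooth substitute for cutting off at height \<open>k\<close>.\<close>

lemma arctan_truncation_tendsto: "(\<lambda>n. real (Suc n) * arctan (t / real (Suc n))) \<longlonglongrightarrow> t"
proof (cases "t = 0")
  case False
  have "((\<lambda>h. (arctan (0 + h) - arctan 0) / h) \<longlongrightarrow> inverse (1 + 0\<^sup>2)) (at 0)"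
    using DERIV_arctan[of 0] unfolding DERIV_def .
  then have l: "((\<lambda>h::real. arctan h / h) \<longlongrightarrow> 1) (at 0)" by simp
  have "filterlim (\<lambda>n. t / real (Suc n)) (at 0) sequentially"
    unfolding filterlim_at using False LIMSEQ_Suc[OF lim_const_over_n[of t]] by (auto intro!: always_eventually)
  then have "(\<lambda>n. arctan (t / real (Suc n)) / (t / real (Suc n))) \<longlonglongrightarrow> 1" by (rule filterlim_compose[OF l])
  then have "(\<lambda>n. t * (arctan (t / real (Suc n)) / (t / real (Suc n)))) \<longlonglongrightarrow> t * 1" by (intro tendsto_mult tendsto_const)
  moreover have "t * (arctan (t / real (Suc n)) / (t / real (Suc n))) = real (Suc n) * arctan (t / real (Suc n))" for n
    using False by (simp del: of_nat_Suc)
  ultimately show ?thesis by simp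
qed simp

text \<open>The truncated function has gradient \<tau>_n'(v) g with \<tau>_n' between 0 and 1, so
  its modular stays below that of g. By convexity \<psi>(x, |g - \<tau>_n'(v) g|) is at most (1 -
  \<tau>_n'(v)) \<psi>(x, |g|), which tends to 0 and is dominated by \<psi>(x, |g|).\<close>

lemma sobolev_modular_approx:
  assumes v: "approx_pair v g" and supp: "\<And>x. x \<notin> \<Omega> \<Longrightarrow> v x = 0 \<and> g x = 0" and fin: "modular g < \<infinity>"
  shows "modular_approx v g"
proof -
  have iv: "integrable lborel v" and ig: "integrable lborel g" using v by (auto simp: approx_pair_def)
  have [measurable]: "v \<in> borel_measurable borel" "g \<in> borel_measurable borel" using iv ig by auto
  define \<tau> where "\<tau> n t = real (Suc n) * arctan (t / real (Suc n))" for n t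
  define \<tau>' where "\<tau>' n t = inverse (1 + (t / real (Suc n))\<^sup>2)" for n t
  have d: "(\<tau> n has_real_derivative \<tau>' n t) (at t)" for n t
  proof -
    have 1: "((\<lambda>t. t / real (Suc n)) has_real_derivative 1 / real (Suc n)) (at t)" by (intro DERIV_cdivide DERIV_ident)
    have "(\<tau> n has_real_derivative real (Suc n) * (inverse (1 + (t / real (Suc n))\<^sup>2) * (1 / real (Suc n)))) (at t)"
      unfolding \<tau>_def[abs_def] by (rule DERIV_cmult[OF DERIV_chain2[OF DERIV_arctan 1]])
    then show ?thesis by (simp add: \<tau>'_def del: of_nat_Suc)
  qed
  have pos: "1 + (t / real (Suc n))\<^sup>2 \<ge> 1" for n t by simp
  have r: "0 \<le> \<tau>' n t" "\<tau>' n t \<le> 1" for n t using pos[of t n] unfolding \<tau>'_def by (auto simp: inverse_le_1_iff)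
  have c: "continuous_on UNIV (\<tau>' n)" for n
    unfolding \<tau>'_def
  proof (intro continuous_intros ballI)
    show "1 + (t / real (Suc n))\<^sup>2 \<noteq> 0" for t using pos[of t n] by linarith
  qed simp
  have [measurable]: "\<tau>' n \<in> borel_measurable borel" for n by (rule borel_measurable_continuous_onI[OF c])
  have "continuous_on UNIV (\<tau> n)" for n by (rule DERIV_continuous_on) (rule has_field_derivative_at_within[OF d])
  then have [measurable]: "\<tau> n \<in> borel_measurable borel" for n by (rule borel_measurable_continuous_onI)
  have bd: "\<bar>\<tau> n t\<bar> \<le> real (Suc n) * (pi / 2)" for n t
  proof -
    have "\<bar>arctan (t / real (Suc n))\<bar> \<le> pi / 2"
      using arctan_lbound[of "t / real (Suc n)"] arctan_ubound[of "t / real (Suc n)"] by linarith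
    then show ?thesis unfolding \<tau>_def by (simp only: abs_mult abs_of_nat) (rule mult_left_mono, auto)
  qed
  have t0: "\<tau> n 0 = 0" for n by (simp add: \<tau>_def)
  have lipt: "\<bar>\<tau> n a\<bar> \<le> \<bar>a\<bar>" for n a
    using field_differentiable_bound[of UNIV "\<tau> n" "\<tau>' n" 1 a 0] d r t0 by (simp add: has_field_derivative_at_within)
  define h where "h n x = \<psi> x (norm (g x - \<tau>' n (v x) *\<^sub>R g x))" for n x
  have n1: "norm (g x - \<tau>' n (v x) *\<^sub>R g x) = (1 - \<tau>' n (v x)) * norm (g x)" for n x
  proof -
    have "g x - \<tau>' n (v x) *\<^sub>R g x = (1 - \<tau>' n (v x)) *\<^sub>R g x" by (simp add: algebra_simps)
    then show ?thesis using r[of n "v x"] by simp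
  qed
  have hle: "h n x \<le> (1 - \<tau>' n (v x)) * \<psi> x (norm (g x))" if "x \<in> \<Omega>" for n x
    unfolding h_def n1 using r by (intro psi_scale that) auto
  have h0: "h n x \<ge> 0" if "x \<in> \<Omega>" for n x unfolding h_def using that by (intro psi_nonneg) auto
  have approx: "modular_approx (\<lambda>x. \<tau> n (v x)) (\<lambda>x. \<tau>' n (v x) *\<^sub>R g x)" for n
  proof (rule bounded_modular_approx[OF approx_pair_compose[OF v d c t0] bd])
    show "\<bar>\<tau>' n t\<bar> \<le> 1" for t using r[of n t] by simp
    show "\<tau> n (v x) = 0 \<and> \<tau>' n (v x) *\<^sub>R g x = 0" if "x \<notin> \<Omega>" for x using supp[OF that] t0 by simp
    have "modular (\<lambda>x. \<tau>' n (v x) *\<^sub>R g x) \<le> modular g"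
      using r by (intro modular_mono) (simp add: mult_left_le_one_le)
    then show "modular (\<lambda>x. \<tau>' n (v x) *\<^sub>R g x) < \<infinity>" using fin by simp
  qed
  have L: "(\<lambda>n. L1d v (\<lambda>x. \<tau> n (v x))) \<longlonglongrightarrow> 0"
  proof (rule nn_integral_dominated_convergence_norm[where w="\<lambda>x. \<bar>v x\<bar>"])
    show "AE x in lborel. norm (\<tau> n (v x)) \<le> \<bar>v x\<bar>" for n using lipt by simp
    show "(\<integral>\<^sup>+x. ennreal \<bar>v x\<bar> \<partial>lborel) < \<infinity>" using iv unfolding integrable_iff_bounded by simp
    show "AE x in lborel. (\<lambda>n. \<tau> n (v x)) \<longlonglongrightarrow> v x" unfolding \<tau>_def using arctan_truncation_tendsto by simp
  qed measurable
  have hm: "h n \<in> borel_measurable (lebesgue_on \<Omega>)" for n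
    unfolding h_def by (intro psi_norm_measurable borel_measurable_\<Omega>) measurable
  have gm: "(\<lambda>x. \<psi> x (norm (g x))) \<in> borel_measurable (lebesgue_on \<Omega>)"
    by (intro psi_norm_measurable borel_measurable_\<Omega>) measurable
  have "(\<lambda>n. \<integral>\<^sup>+x. ennreal (norm (0 - h n x)) \<partial>lebesgue_on \<Omega>) \<longlonglongrightarrow> 0"
  proof (rule nn_integral_dominated_convergence_norm[where w="\<lambda>x. \<psi> x (norm (g x))", OF hm _ gm])
    show "AE x in lebesgue_on \<Omega>. norm (h n x) \<le> \<psi> x (norm (g x))" for n
    proof (rule AE_I2)
      fix x assume "x \<in> space (lebesgue_on \<Omega>)"
      then have x: "x \<in> \<Omega>" by simp
      have "(1 - \<tau>' n (v x)) * \<psi> x (norm (g x)) \<le> 1 * \<psi> x (norm (g x))"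
        using r psi_nonneg[OF x] by (intro mult_right_mono) auto
      then show "norm (h n x) \<le> \<psi> x (norm (g x))" using hle[OF x, of n] h0[OF x, of n] by simp
    qed
    show "(\<integral>\<^sup>+x. ennreal (\<psi> x (norm (g x))) \<partial>lebesgue_on \<Omega>) < \<infinity>" using fin by (simp add: modular_def)
    show "AE x in lebesgue_on \<Omega>. (\<lambda>n. h n x) \<longlonglongrightarrow> 0"
    proof (rule AE_I2)
      fix x assume "x \<in> space (lebesgue_on \<Omega>)"
      then have x: "x \<in> \<Omega>" by simp
      have "(\<lambda>n. (1 - inverse (1 + (v x / real (Suc n))\<^sup>2)) * \<psi> x (norm (g x))) \<longlonglongrightarrow> (1 - inverse (1 + 0\<^sup>2)) * \<psi> x (norm (g x))"
        by (intro tendsto_intros LIMSEQ_Suc[OF lim_const_over_n]) auto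
      then have "(\<lambda>n. (1 - \<tau>' n (v x)) * \<psi> x (norm (g x))) \<longlonglongrightarrow> 0" by (simp add: \<tau>'_def)
      then show "(\<lambda>n. h n x) \<longlonglongrightarrow> 0"
        by (rule tendsto_sandwich[OF _ _ tendsto_const, rotated 2]) (use h0[OF x] hle[OF x] in auto)
    qed
  qed measurable
  moreover have "(\<integral>\<^sup>+x. ennreal (norm (0 - h n x)) \<partial>lebesgue_on \<Omega>) = modular (\<lambda>x. g x - \<tau>' n (v x) *\<^sub>R g x)" for n
    unfolding modular_def using h0 by (intro nn_integral_cong) (auto simp: h_def)
  ultimately have H: "(\<lambda>n. modular (\<lambda>x. g x - \<tau>' n (v x) *\<^sub>R g x)) \<longlonglongrightarrow> 0" by simp
  show ?thesis
  proof (rule modular_approx_limit)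
    fix \<epsilon> :: real assume "\<epsilon> > 0"
    then have "eventually (\<lambda>n. L1d v (\<lambda>x. \<tau> n (v x)) < ennreal \<epsilon> \<and> modular (\<lambda>x. g x - \<tau>' n (v x) *\<^sub>R g x) < ennreal \<epsilon>) sequentially"
      by (intro eventually_conj order_tendstoD(2)[OF L] order_tendstoD(2)[OF H]) auto
    then obtain n where "L1d v (\<lambda>x. \<tau> n (v x)) < ennreal \<epsilon> \<and> modular (\<lambda>x. g x - \<tau>' n (v x) *\<^sub>R g x) < ennreal \<epsilon>"
      unfolding eventually_sequentially by blast
    then show "\<exists>v' g'. modular_approx v' g' \<and> L1d v v' < ennreal \<epsilon> \<and> modular (\<lambda>x. g x - g' x) < ennreal \<epsilon>"
      using approx by blast
  qed measurable
qed

end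

subsection \<open>Lebesgue and Sobolev spaces on bounded domains\<close>

text \<open>Completeness of Lebesgue measure. It makes the chosen representative
  \<open>weak_gradient\<close>, known only up to null sets, measurable.\<close>

lemma borel_measurable_lebesgue_on_AE:
  fixes f :: "'a::euclidean_space \<Rightarrow> 'b::euclidean_space"
  assumes S: "S \<in> sets lebesgue" and f: "f \<in> borel_measurable (lebesgue_on S)"
    and ae: "AE x in lebesgue_on S. f x = g x"
  shows "g \<in> borel_measurable (lebesgue_on S)"
proof -
  have 1: "(\<lambda>x. indicator S x *\<^sub>R f x) \<in> borel_measurable lebesgue"
    using f S by (subst (asm) borel_measurable_restrict_space_iff) auto
  have "AE x in lebesgue. x \<in> S \<longrightarrow> f x = g x" using ae S by (simp add: AE_restrict_space_iff)
  then have "AE x in lebesgue. indicator S x *\<^sub>R f x = indicator S x *\<^sub>R g x"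
    by (rule eventually_mono) (auto simp: indicator_def)
  from borel_measurable_AE[OF 1 this] show ?thesis
    using S by (subst borel_measurable_restrict_space_iff) auto
qed

text \<open>Takes the place of Hoelder's inequality on a domain of finite measure: small a makes the
  constant term small, and the other term is then controlled by the higher power.\<close>

lemma powr_le_weighted:
  fixes a t r s :: real
  assumes "a > 0" "t \<ge> 0" "0 < r" "r \<le> s"
  shows "t powr r \<le> a powr r + a powr (r - s) * t powr s"
proof (cases "t \<le> a")
  case True
  then have "t powr r \<le> a powr r" using assms by (intro powr_mono2) auto
  moreover have "0 \<le> a powr (r - s) * t powr s" by simp
  ultimately show ?thesis by linarith
next
  case False
  have "t powr r = t powr (r - s) * t powr s" using False assms by (simp flip: powr_add)
  also have "\<dots> \<le> a powr (r - s) * t powr s"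
    using False assms by (intro mult_right_mono powr_mono2') auto
  also have "\<dots> \<le> a powr r + a powr (r - s) * t powr s" by simp
  finally show ?thesis .
qed

context
  fixes \<Omega> :: "'a::euclidean_space set"
  assumes open_dom: "open \<Omega>" and bounded_dom: "bounded \<Omega>"
begin

private lemma dom_sets: "\<Omega> \<in> sets lebesgue"
  using open_dom by (simp add: sets_completionI_sets)

private lemma finite_dom: "finite_measure (lebesgue_on \<Omega>)"
  using lmeasurable_open[OF bounded_dom open_dom] by (rule finite_measure_lebesgue_on)

section \<open>Lebesgue spaces on a bounded open set\<close>

lemma Lp_space_AE_cong:
  assumes f: "f \<in> Lp_space \<Omega> s" and ae: "AE x in lebesgue_on \<Omega>. f x = g x"
  shows "g \<in> Lp_space \<Omega> s" "Lp_norm \<Omega> s g = Lp_norm \<Omega> s f"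
proof -
  have fm [measurable]: "f \<in> borel_measurable (lebesgue_on \<Omega>)" and fi: "integrable (lebesgue_on \<Omega>) (\<lambda>x. norm (f x) powr s)"
    using f by (auto simp: Lp_space_def)
  have gm [measurable]: "g \<in> borel_measurable (lebesgue_on \<Omega>)"
    by (rule borel_measurable_lebesgue_on_AE[OF dom_sets fm ae])
  have ae': "AE x in lebesgue_on \<Omega>. norm (f x) powr s = norm (g x) powr s"
    using ae by (rule eventually_mono) simp
  have "integrable (lebesgue_on \<Omega>) (\<lambda>x. norm (g x) powr s)"
    by (rule integrable_cong_AE_imp[OF fi]) (measurable, use ae' in \<open>auto elim!: eventually_mono\<close>)
  then show "g \<in> Lp_space \<Omega> s" by (simp add: Lp_space_def)
  have "(LINT x|lebesgue_on \<Omega>. norm (g x) powr s) = (LINT x|lebesgue_on \<Omega>. norm (f x) powr s)"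
    by (rule integral_cong_AE) (measurable, use ae' in \<open>auto elim!: eventually_mono\<close>)
  then show "Lp_norm \<Omega> s g = Lp_norm \<Omega> s f" by (simp add: Lp_norm_def)
qed

lemma Lp_space_bounded:
  assumes f [measurable]: "f \<in> borel_measurable borel" and B: "\<And>x. norm (f x) \<le> B" and s: "s > 0"
  shows "f \<in> Lp_space \<Omega> s"
proof -
  have fm [measurable]: "f \<in> borel_measurable (lebesgue_on \<Omega>)"
    using f by (intro measurable_restrict_space1 measurable_completion) simp
  have "integrable (lebesgue_on \<Omega>) (\<lambda>x. norm (f x) powr s)"
  proof (rule finite_measure.integrable_const_bound[OF finite_dom, where B="B powr s"])
    show "AE x in lebesgue_on \<Omega>. norm (norm (f x) powr s) \<le> B powr s"
      using B s by (auto intro!: AE_I2 powr_mono2)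
  qed measurable
  then show ?thesis by (simp add: Lp_space_def)
qed

lemma Lp_space_diff:
  assumes f: "f \<in> Lp_space \<Omega> s" and g: "g \<in> Lp_space \<Omega> s" and s: "s > 0"
  shows "(\<lambda>x. f x - g x) \<in> Lp_space \<Omega> s"
proof -
  have [measurable]: "f \<in> borel_measurable (lebesgue_on \<Omega>)" "g \<in> borel_measurable (lebesgue_on \<Omega>)"
    and i: "integrable (lebesgue_on \<Omega>) (\<lambda>x. norm (f x) powr s)" "integrable (lebesgue_on \<Omega>) (\<lambda>x. norm (g x) powr s)"
    using f g by (auto simp: Lp_space_def)
  have "integrable (lebesgue_on \<Omega>) (\<lambda>x. norm (f x - g x) powr s)"
  proof (rule Bochner_Integration.integrable_bound)
    show "integrable (lebesgue_on \<Omega>) (\<lambda>x. 2 powr s * (norm (f x) powr s + norm (g x) powr s))" using i by simp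
    show "AE x in lebesgue_on \<Omega>. norm (norm (f x - g x) powr s) \<le> norm (2 powr s * (norm (f x) powr s + norm (g x) powr s))"
    proof (rule AE_I2)
      fix x
      have "norm (f x - g x) powr s \<le> (2 * max (norm (f x)) (norm (g x))) powr s"
        using norm_triangle_ineq4[of "f x" "g x"] s by (intro powr_mono2) auto
      also have "\<dots> = 2 powr s * (max (norm (f x)) (norm (g x))) powr s" by (simp add: powr_mult)
      also have "\<dots> \<le> 2 powr s * (norm (f x) powr s + norm (g x) powr s)"
        by (intro mult_left_mono) (auto simp: max_def)
      finally show "norm (norm (f x - g x) powr s) \<le> norm (2 powr s * (norm (f x) powr s + norm (g x) powr s))" by simp
    qed
  qed measurable
  then show ?thesis by (simp add: Lp_space_def)
qed

lemma Lp_space_mono: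
  assumes f: "f \<in> Lp_space \<Omega> s" and r: "0 < r" "r \<le> s"
  shows "f \<in> Lp_space \<Omega> r"
    and "a > 0 \<Longrightarrow> (LINT x|lebesgue_on \<Omega>. norm (f x) powr r) \<le>
      a powr r * measure lebesgue \<Omega> + a powr (r - s) * (LINT x|lebesgue_on \<Omega>. norm (f x) powr s)"
proof -
  have [measurable]: "f \<in> borel_measurable (lebesgue_on \<Omega>)"
    and i: "integrable (lebesgue_on \<Omega>) (\<lambda>x. norm (f x) powr s)"
    using f by (auto simp: Lp_space_def)
  interpret finite_measure "lebesgue_on \<Omega>" by (rule finite_dom)
  have j: "integrable (lebesgue_on \<Omega>) (\<lambda>x. a powr r + a powr (r - s) * norm (f x) powr s)" for a
    using i by simp
  have k: "integrable (lebesgue_on \<Omega>) (\<lambda>x. norm (f x) powr r)"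
  proof (rule Bochner_Integration.integrable_bound[OF j[of 1]])
    show "AE x in lebesgue_on \<Omega>. norm (norm (f x) powr r) \<le> norm (1 powr r + 1 powr (r - s) * norm (f x) powr s)"
      using powr_le_weighted[of 1 "norm (f _)" r s] r by (auto intro!: AE_I2 simp: abs_of_nonneg add_nonneg_nonneg)
  qed measurable
  then show "f \<in> Lp_space \<Omega> r" by (simp add: Lp_space_def)
  assume a: "a > 0"
  have "(LINT x|lebesgue_on \<Omega>. norm (f x) powr r) \<le> (LINT x|lebesgue_on \<Omega>. a powr r + a powr (r - s) * norm (f x) powr s)"
    using powr_le_weighted[OF a _ r] by (intro integral_mono k j) auto
  also have "\<dots> = a powr r * measure (lebesgue_on \<Omega>) (space (lebesgue_on \<Omega>)) + a powr (r - s) * (LINT x|lebesgue_on \<Omega>. norm (f x) powr s)"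
    using i by simp
  also have "measure (lebesgue_on \<Omega>) (space (lebesgue_on \<Omega>)) = measure lebesgue \<Omega>"
    using dom_sets by (simp add: measure_restrict_space)
  finally show "(LINT x|lebesgue_on \<Omega>. norm (f x) powr r) \<le> a powr r * measure lebesgue \<Omega> + a powr (r - s) * (LINT x|lebesgue_on \<Omega>. norm (f x) powr s)" .
qed

text \<open>Continuity at 0 of the inclusion of L^s in L^r, which is all that closures of test
  functions require. The integral of |f|^r is bounded by two halves of \<eta>^r.\<close>

lemma Lp_norm_small:
  assumes r: "0 < r" "r \<le> s" and \<eta>: "\<eta> > 0"
  shows "\<exists>\<delta>>0. \<forall>f::'a \<Rightarrow> 'b::euclidean_space. f \<in> Lp_space \<Omega> s \<and> Lp_norm \<Omega> s f < \<delta> \<longrightarrow> Lp_norm \<Omega> r f < \<eta>"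
proof -
  define m where "m = measure lebesgue \<Omega>"
  have m: "m \<ge> 0" by (simp add: m_def)
  \<comment> \<open>Makes a^r m at most \<eta>^r / 2; the summand 1 keeps the denominator positive
    when m = 0.\<close>
  define a where "a = (\<eta> powr r / (2 * (m + 1))) powr (1 / r)"
  have \<eta>r: "\<eta> powr r > 0" using \<eta> by simp
  have a: "a > 0" "a powr r = \<eta> powr r / (2 * (m + 1))"
    using m r \<eta>r by (auto simp: a_def powr_powr)
  \<comment> \<open>The bound on the integral of |f|^s under which the second term stays below
    \<eta>^r / 2.\<close>
  define c where "c = \<eta> powr r / 2 * a powr (s - r)"
  have c: "c > 0" using a \<eta>r by (simp add: c_def)
  show ?thesis
  proof (intro exI conjI allI impI)
    show "c powr (1 / s) > 0" using c by simp
    fix f :: "'a \<Rightarrow> 'b" assume f: "f \<in> Lp_space \<Omega> s \<and> Lp_norm \<Omega> s f < c powr (1 / s)"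
    define I where "I = (LINT x|lebesgue_on \<Omega>. norm (f x) powr s)"
    have I0: "I \<ge> 0" by (simp add: I_def)
    have "I < c"
    proof (rule ccontr)
      assume "\<not> I < c"
      then have "c powr (1 / s) \<le> I powr (1 / s)" using c r by (intro powr_mono2) auto
      then show False using f by (simp add: Lp_norm_def I_def)
    qed
    have "(LINT x|lebesgue_on \<Omega>. norm (f x) powr r) \<le> a powr r * m + a powr (r - s) * I"
      unfolding m_def I_def using f r a(1) by (intro Lp_space_mono(2)) auto
    also have "\<dots> < \<eta> powr r / 2 + \<eta> powr r / 2"
    proof (rule add_le_less_mono)
      show "a powr r * m \<le> \<eta> powr r / 2" unfolding a(2) using m \<eta>r by (simp add: field_simps)
      have "a powr (r - s) * I < a powr (r - s) * c" using \<open>I < c\<close> a by simp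
      also have "\<dots> = \<eta> powr r / 2 * (a powr (r - s) * a powr (s - r))" by (simp add: c_def)
      also have "a powr (r - s) * a powr (s - r) = 1" using a by (simp flip: powr_add)
      finally show "a powr (r - s) * I < \<eta> powr r / 2" by simp
    qed
    finally have lt: "(LINT x|lebesgue_on \<Omega>. norm (f x) powr r) < \<eta> powr r" by simp
    have "Lp_norm \<Omega> r f < (\<eta> powr r) powr (1 / r)"
      unfolding Lp_norm_def using lt r by (intro powr_less_mono2) auto
    also have "\<dots> = \<eta>" using r \<eta> by (simp add: powr_powr)
    finally show "Lp_norm \<Omega> r f < \<eta>" .
  qed
qed

section \<open>Sobolev spaces and zero boundary values\<close>

lemma W1pD:
  assumes "u \<in> W1p \<Omega> s"
  shows "u \<in> Lp_space \<Omega> s" "is_weak_gradient \<Omega> u (weak_gradient \<Omega> u)" "weak_gradient \<Omega> u \<in> Lp_space \<Omega> s"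
proof -
  show "u \<in> Lp_space \<Omega> s" using assms by (simp add: W1p_def)
  obtain g where g: "is_weak_gradient \<Omega> u g" "g \<in> Lp_space \<Omega> s" using assms by (auto simp: W1p_def)
  show "is_weak_gradient \<Omega> u (weak_gradient \<Omega> u)" by (rule weak_gradient_eq(1)[OF open_dom g(1)])
  have "AE x in lebesgue_on \<Omega>. g x = weak_gradient \<Omega> u x"
    using weak_gradient_eq(2)[OF open_dom g(1)] by (rule eventually_mono) simp
  then show "weak_gradient \<Omega> u \<in> Lp_space \<Omega> s" by (rule Lp_space_AE_cong(1)[OF g(2)])
qed

lemma Lp_norm_nonneg: "Lp_norm \<Omega> s f \<ge> 0"
  by (simp add: Lp_norm_def)

lemma Cc_infinity_Lp:
  assumes "\<phi> \<in> Cc_infinity \<Omega>" "s > 0"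
  shows "\<phi> \<in> Lp_space \<Omega> s" "grad \<phi> \<in> Lp_space \<Omega> s"
proof -
  note C = Cc_infinity_C1c[OF assms(1)]
  obtain B where B: "B > 0" "\<And>x. \<bar>\<phi> x\<bar> \<le> B" "\<And>x. norm (grad \<phi> x) \<le> B" using C1c_bounded[OF C] by metis
  show "\<phi> \<in> Lp_space \<Omega> s" using B by (intro Lp_space_bounded C1c_measurable C assms) auto
  show "grad \<phi> \<in> Lp_space \<Omega> s" using B by (intro Lp_space_bounded C1c_measurable C assms) auto
qed

lemma W1p_diff_Cc:
  assumes u: "u \<in> W1p \<Omega> s" and \<phi>: "\<phi> \<in> Cc_infinity \<Omega>" and s: "s > 0"
  shows "(\<lambda>x. u x - \<phi> x) \<in> W1p \<Omega> s"
    "AE x in lebesgue_on \<Omega>. weak_gradient \<Omega> (\<lambda>x. u x - \<phi> x) x = weak_gradient \<Omega> u x - grad \<phi> x"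
proof -
  have wg: "is_weak_gradient \<Omega> (\<lambda>x. u x - \<phi> x) (\<lambda>x. weak_gradient \<Omega> u x - grad \<phi> x)"
    by (rule is_weak_gradient_combine(2)[OF open_dom W1pD(2)[OF u] C1c_is_weak_gradient[OF open_dom Cc_infinity_C1c[OF \<phi>]]])
  show "AE x in lebesgue_on \<Omega>. weak_gradient \<Omega> (\<lambda>x. u x - \<phi> x) x = weak_gradient \<Omega> u x - grad \<phi> x"
    by (rule weak_gradient_eq(2)[OF open_dom wg])
  show "(\<lambda>x. u x - \<phi> x) \<in> W1p \<Omega> s"
    unfolding W1p_def using wg Lp_space_diff[OF W1pD(1)[OF u] Cc_infinity_Lp(1)[OF \<phi> s] s]
      Lp_space_diff[OF W1pD(3)[OF u] Cc_infinity_Lp(2)[OF \<phi> s] s] by blast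
qed

lemma W1p_mono:
  assumes "u \<in> W1p \<Omega> s" "0 < r" "r \<le> s"
  shows "u \<in> W1p \<Omega> r"
  unfolding W1p_def
  using W1pD(2)[OF assms(1)] Lp_space_mono(1)[OF W1pD(1)[OF assms(1)] assms(2,3)]
    Lp_space_mono(1)[OF W1pD(3)[OF assms(1)] assms(2,3)] by blast

text \<open>Approximation by test functions in the stronger norm also approximates in the weaker
  one: both summands of \<open>W1p_norm\<close> are nonnegative, so each is small, and
  \<open>Lp_norm_small\<close> is applied to the function and to its gradient separately.\<close>

lemma W1p0_mono:
  assumes u: "u \<in> W1p0 \<Omega> s" and r: "0 < r" "r \<le> s"
  shows "u \<in> W1p0 \<Omega> r"
  unfolding W1p0_def
proof (intro CollectI conjI allI impI)
  have us: "u \<in> W1p \<Omega> s" using u by (simp add: W1p0_def)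
  show "u \<in> W1p \<Omega> r" by (rule W1p_mono[OF us r])
  fix \<epsilon> :: real assume \<epsilon>: "\<epsilon> > 0"
  obtain \<delta>1 where \<delta>1: "\<delta>1 > 0" "\<And>f::'a \<Rightarrow> real. f \<in> Lp_space \<Omega> s \<Longrightarrow> Lp_norm \<Omega> s f < \<delta>1 \<Longrightarrow> Lp_norm \<Omega> r f < \<epsilon>/2"
    using Lp_norm_small[OF r, of "\<epsilon>/2"] \<epsilon> by auto
  obtain \<delta>2 where \<delta>2: "\<delta>2 > 0" "\<And>f::'a \<Rightarrow> 'a. f \<in> Lp_space \<Omega> s \<Longrightarrow> Lp_norm \<Omega> s f < \<delta>2 \<Longrightarrow> Lp_norm \<Omega> r f < \<epsilon>/2"
    using Lp_norm_small[OF r, of "\<epsilon>/2"] \<epsilon> by auto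
  obtain \<phi> where \<phi>: "\<phi> \<in> Cc_infinity \<Omega>" "W1p_norm \<Omega> s (\<lambda>x. u x - \<phi> x) < min \<delta>1 \<delta>2"
  proof -
    have "min \<delta>1 \<delta>2 > 0" using \<delta>1(1) \<delta>2(1) by simp
    then have "\<exists>\<phi>\<in>Cc_infinity \<Omega>. W1p_norm \<Omega> s (\<lambda>x. u x - \<phi> x) < min \<delta>1 \<delta>2"
      using u unfolding W1p0_def by blast
    then show ?thesis using that by blast
  qed
  have d: "(\<lambda>x. u x - \<phi> x) \<in> W1p \<Omega> s" using W1p_diff_Cc(1)[OF us \<phi>(1)] r by simp
  have 1: "Lp_norm \<Omega> s (\<lambda>x. u x - \<phi> x) < \<delta>1" "Lp_norm \<Omega> s (weak_gradient \<Omega> (\<lambda>x. u x - \<phi> x)) < \<delta>2"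
    using \<phi>(2) Lp_norm_nonneg[of s "\<lambda>x. u x - \<phi> x"] Lp_norm_nonneg[of s "weak_gradient \<Omega> (\<lambda>x. u x - \<phi> x)"]
    unfolding W1p_norm_def by linarith+
  have "W1p_norm \<Omega> r (\<lambda>x. u x - \<phi> x) < \<epsilon>"
    unfolding W1p_norm_def using \<delta>1(2)[OF W1pD(1)[OF d] 1(1)] \<delta>2(2)[OF W1pD(3)[OF d] 1(2)] by linarith
  then show "\<exists>\<phi>\<in>Cc_infinity \<Omega>. W1p_norm \<Omega> r (\<lambda>x. u x - \<phi> x) < \<epsilon>" using \<phi>(1) by blast
qed

lemma Cc_infinity_W1p0:
  assumes \<phi>: "\<phi> \<in> Cc_infinity \<Omega>" and s: "s > 0"
  shows "\<phi> \<in> W1p0 \<Omega> s"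
proof -
  have "\<phi> \<in> W1p \<Omega> s"
    unfolding W1p_def using Cc_infinity_Lp[OF \<phi> s] C1c_is_weak_gradient[OF open_dom Cc_infinity_C1c[OF \<phi>]] by blast
  moreover have "W1p_norm \<Omega> s (\<lambda>x. \<phi> x - \<phi> x) = 0"
  proof -
    \<comment> \<open>Even for the zero function \<open>weak_gradient\<close> is a chosen
      representative, equal to 0 only almost everywhere.\<close>
    have "is_weak_gradient \<Omega> (\<lambda>x. 0) (grad (\<lambda>x. 0))" by (rule C1c_is_weak_gradient[OF open_dom C1c_zero])
    from weak_gradient_eq(2)[OF open_dom this]
    have ae: "AE x in lebesgue_on \<Omega>. (\<lambda>x. 0) x = weak_gradient \<Omega> (\<lambda>x. 0) x" by (rule eventually_mono) simp
    have "(\<lambda>x. 0::'a) \<in> Lp_space \<Omega> s" using s by (intro Lp_space_bounded[of _ 0]) auto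
    then have "Lp_norm \<Omega> s (weak_gradient \<Omega> (\<lambda>x. 0)) = Lp_norm \<Omega> s (\<lambda>x. 0::'a)" by (rule Lp_space_AE_cong(2)[OF _ ae])
    then show ?thesis using s by (simp add: W1p_norm_def Lp_norm_def)
  qed
  ultimately show ?thesis unfolding W1p0_def using \<phi> by force
qed

lemma Lp_1_integrable:
  assumes "f \<in> Lp_space \<Omega> 1"
  shows "integrable (lebesgue_on \<Omega>) f" "ennreal (Lp_norm \<Omega> 1 f) = (\<integral>\<^sup>+x. ennreal (norm (f x)) \<partial>lebesgue_on \<Omega>)"
proof -
  have [measurable]: "f \<in> borel_measurable (lebesgue_on \<Omega>)" and n: "integrable (lebesgue_on \<Omega>) (\<lambda>x. norm (f x))"
    using assms by (auto simp: Lp_space_def)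
  show "integrable (lebesgue_on \<Omega>) f" using n by (rule integrable_norm_cancel) measurable
  show "ennreal (Lp_norm \<Omega> 1 f) = (\<integral>\<^sup>+x. ennreal (norm (f x)) \<partial>lebesgue_on \<Omega>)"
    using nn_integral_eq_integral[OF n] by (simp add: Lp_norm_def)
qed

lemma nn_integral_dom_eq_L1d:
  fixes f' h :: "'a \<Rightarrow> 'b::euclidean_space"
  assumes "AE x in lborel. x \<in> \<Omega> \<longrightarrow> f' x = f x" "\<And>x. x \<notin> \<Omega> \<Longrightarrow> f' x = h x"
  shows "(\<integral>\<^sup>+x. ennreal (norm (f x - h x)) \<partial>lebesgue_on \<Omega>) = L1d f' h"
proof -
  have "(\<integral>\<^sup>+x. ennreal (norm (f x - h x)) \<partial>lebesgue_on \<Omega>) = (\<integral>\<^sup>+x. ennreal (norm (f x - h x)) * indicator \<Omega> x \<partial>lborel)"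
    using dom_sets by (simp add: nn_integral_restrict_space nn_integral_completion)
  also have "\<dots> = L1d f' h"
    by (rule nn_integral_cong_AE, rule eventually_mono[OF assms(1)]) (auto simp: indicator_def assms(2))
  finally show ?thesis .
qed

text \<open>Zero boundary values enter here: test functions and their gradients vanish outside
  \<Omega>, so against the extensions by zero the L^1 distances on the whole space equal the norms
  over \<Omega>.\<close>

lemma W1p0_approx_pair:
  assumes u: "u \<in> W1p0 \<Omega> 1"
  shows "\<exists>v g. approx_pair v g \<and> (\<forall>x. x \<notin> \<Omega> \<longrightarrow> v x = 0 \<and> g x = 0) \<and>
    (AE x in lborel. x \<in> \<Omega> \<longrightarrow> v x = u x) \<and> (AE x in lborel. x \<in> \<Omega> \<longrightarrow> g x = weak_gradient \<Omega> u x)"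
proof -
  have u1: "u \<in> W1p \<Omega> 1" using u by (simp add: W1p0_def)
  have b: "\<Omega> \<in> sets borel" using open_dom by simp
  obtain v where v: "integrable lborel v" "\<And>x. x \<notin> \<Omega> \<Longrightarrow> v x = 0" "AE x in lborel. x \<in> \<Omega> \<longrightarrow> v x = u x"
    using lebesgue_on_borel_representative[OF b Lp_1_integrable(1)[OF W1pD(1)[OF u1]]] by blast
  obtain g where g: "integrable lborel g" "\<And>x. x \<notin> \<Omega> \<Longrightarrow> g x = 0" "AE x in lborel. x \<in> \<Omega> \<longrightarrow> g x = weak_gradient \<Omega> u x"
    using lebesgue_on_borel_representative[OF b Lp_1_integrable(1)[OF W1pD(3)[OF u1]]] by blast
  have "approx_pair v g"
    unfolding approx_pair_def
  proof (intro conjI allI impI)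
    fix \<epsilon> :: real assume \<epsilon>: "\<epsilon> > 0"
    obtain \<phi> where \<phi>: "\<phi> \<in> Cc_infinity \<Omega>" "W1p_norm \<Omega> 1 (\<lambda>x. u x - \<phi> x) < \<epsilon>"
      using u \<epsilon> by (auto simp: W1p0_def)
    note d = W1p_diff_Cc[OF u1 \<phi>(1) zero_less_one]
    have 1: "Lp_norm \<Omega> 1 (\<lambda>x. u x - \<phi> x) < \<epsilon>" "Lp_norm \<Omega> 1 (weak_gradient \<Omega> (\<lambda>x. u x - \<phi> x)) < \<epsilon>"
      using \<phi>(2) Lp_norm_nonneg[of 1 "\<lambda>x. u x - \<phi> x"] Lp_norm_nonneg[of 1 "weak_gradient \<Omega> (\<lambda>x. u x - \<phi> x)"]
      unfolding W1p_norm_def by linarith+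
    obtain K where K: "K \<subseteq> \<Omega>" "\<And>x. x \<notin> K \<Longrightarrow> \<phi> x = 0" "\<And>x. x \<notin> K \<Longrightarrow> grad \<phi> x = 0"
      using Cc_infinity_support[OF \<phi>(1)] by metis
    have out: "x \<notin> \<Omega> \<Longrightarrow> v x = \<phi> x" "x \<notin> \<Omega> \<Longrightarrow> g x = grad \<phi> x" for x using K v(2) g(2) by (auto simp: subset_iff)
    have "L1d v \<phi> = ennreal (Lp_norm \<Omega> 1 (\<lambda>x. u x - \<phi> x))"
      using nn_integral_dom_eq_L1d[OF v(3) out(1)] Lp_1_integrable(2)[OF W1pD(1)[OF d(1)]] by simp
    then have a: "L1d v \<phi> < ennreal \<epsilon>" using ennreal_lessI[OF \<epsilon> 1(1)] by simp
    have "L1d g (grad \<phi>) = (\<integral>\<^sup>+x. ennreal (norm (weak_gradient \<Omega> u x - grad \<phi> x)) \<partial>lebesgue_on \<Omega>)"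
      using nn_integral_dom_eq_L1d[OF g(3) out(2)] by simp
    also have "\<dots> = (\<integral>\<^sup>+x. ennreal (norm (weak_gradient \<Omega> (\<lambda>x. u x - \<phi> x) x)) \<partial>lebesgue_on \<Omega>)"
      by (rule nn_integral_cong_AE, rule eventually_mono[OF d(2)]) simp
    also have "\<dots> = ennreal (Lp_norm \<Omega> 1 (weak_gradient \<Omega> (\<lambda>x. u x - \<phi> x)))"
      using Lp_1_integrable(2)[OF W1pD(3)[OF d(1)]] by simp
    also have "\<dots> < ennreal \<epsilon>" by (rule ennreal_lessI[OF \<epsilon> 1(2)])
    finally show "\<exists>f. C1c f \<and> L1d v f < ennreal \<epsilon> \<and> L1d g (grad f) < ennreal \<epsilon>"
      using a Cc_infinity_C1c[OF \<phi>(1)] by blast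
  qed (fact v g)+
  then show ?thesis using v g by blast
qed

end

subsection \<open>Energies and norms\<close>

context integrand
begin

lemmas dom = open_\<Omega> bounded_\<Omega>

lemma energy_eq_modular: "energy \<Omega> \<psi> u = modular (weak_gradient \<Omega> u)"
  by (simp add: energy_def modular_def)

text \<open>The upper growth in (A4) on a set of finite measure. It gives boundary data in W^{1,q} a
  finite energy.\<close>

lemma modular_finite_Lp:
  assumes g: "g \<in> Lp_space \<Omega> q"
  shows "modular g < \<infinity>"
proof -
  have "finite_measure (lebesgue_on \<Omega>)"
    using lmeasurable_open[OF bounded_\<Omega> open_\<Omega>] by (rule finite_measure_lebesgue_on)
  then interpret finite_measure "lebesgue_on \<Omega>" .
  have i: "integrable (lebesgue_on \<Omega>) (\<lambda>x. C2 * (1 + norm (g x) powr q))"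
    using g by (simp add: Lp_space_def)
  have "modular g \<le> (\<integral>\<^sup>+x. ennreal (C2 * (1 + norm (g x) powr q)) \<partial>lebesgue_on \<Omega>)"
    unfolding modular_def by (intro nn_integral_mono ennreal_leI psi_upper) auto
  also have "\<dots> = ennreal (LINT x|lebesgue_on \<Omega>. C2 * (1 + norm (g x) powr q))"
    by (rule nn_integral_eq_integral[OF i]) (use C2 in \<open>auto intro!: AE_I2 mult_nonneg_nonneg add_nonneg_nonneg\<close>)
  also have "\<dots> < \<infinity>" by simp
  finally show ?thesis .
qed

lemma test_function_approx:
  assumes u: "u \<in> W1p0 \<Omega> 1" and fin: "modular (weak_gradient \<Omega> u) < \<infinity>" and \<epsilon>: "\<epsilon> > 0"
  shows "\<exists>\<phi>\<in>Cc_infinity \<Omega>. (\<integral>\<^sup>+x. ennreal (norm (u x - \<phi> x)) \<partial>lebesgue_on \<Omega>) < ennreal \<epsilon> \<and>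
    modular (\<lambda>x. weak_gradient \<Omega> u x - grad \<phi> x) < ennreal \<epsilon>"
proof -
  obtain v g where v: "approx_pair v g" "\<And>x. x \<notin> \<Omega> \<Longrightarrow> v x = 0 \<and> g x = 0"
    "AE x in lborel. x \<in> \<Omega> \<longrightarrow> v x = u x" and g: "AE x in lborel. x \<in> \<Omega> \<longrightarrow> g x = weak_gradient \<Omega> u x"
    using W1p0_approx_pair[OF dom u] by blast
  have ae: "AE x in lebesgue_on \<Omega>. g x = weak_gradient \<Omega> u x" using g by (simp add: AE_\<Omega>_iff)
  have "modular g < \<infinity>" using fin modular_cong[OF ae] by simp
  then have "modular_approx v g" using v(2) by (intro sobolev_modular_approx[OF v(1)]) auto
  then obtain \<phi> where \<phi>: "\<phi> \<in> Cc_infinity \<Omega>" "L1d v \<phi> < ennreal \<epsilon>" "modular (\<lambda>x. g x - grad \<phi> x) < ennreal \<epsilon>"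
    using \<epsilon> unfolding modular_approx_def by blast
  obtain K where K: "K \<subseteq> \<Omega>" "\<And>x. x \<notin> K \<Longrightarrow> \<phi> x = 0" using Cc_infinity_support[OF \<phi>(1)] by metis
  have out: "x \<notin> \<Omega> \<Longrightarrow> v x = \<phi> x" for x using K v(2) by (auto simp: subset_iff)
  have "(\<integral>\<^sup>+x. ennreal (norm (u x - \<phi> x)) \<partial>lebesgue_on \<Omega>) = L1d v \<phi>"
    by (rule nn_integral_dom_eq_L1d[OF dom v(3) out])
  moreover have "modular (\<lambda>x. g x - grad \<phi> x) = modular (\<lambda>x. weak_gradient \<Omega> u x - grad \<phi> x)"
    by (rule modular_cong) (use ae in \<open>rule eventually_mono, simp\<close>)
  ultimately show ?thesis using \<phi> by (intro bexI[OF _ \<phi>(1)]) simp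
qed

lemma modular_scale_norm:
  fixes f :: "'a \<Rightarrow> 'a"
  assumes f: "f \<in> borel_measurable (lebesgue_on \<Omega>)"
    and D: "\<And>x a. x \<in> \<Omega> \<Longrightarrow> a \<ge> 0 \<Longrightarrow> \<psi> x (c * a) \<le> D * \<psi> x a" "D \<ge> 0" "c > 0"
  shows "(\<integral>\<^sup>+x. ennreal (\<psi> x (c * norm (f x))) \<partial>lebesgue_on \<Omega>) \<le> ennreal D * modular f"
proof -
  have [measurable]: "(\<lambda>x. \<psi> x (norm (f x))) \<in> borel_measurable (lebesgue_on \<Omega>)" by (rule psi_norm_measurable[OF f])
  have "(\<integral>\<^sup>+x. ennreal (\<psi> x (c * norm (f x))) \<partial>lebesgue_on \<Omega>) \<le> (\<integral>\<^sup>+x. ennreal D * ennreal (\<psi> x (norm (f x))) \<partial>lebesgue_on \<Omega>)"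
    using D psi_nonneg by (intro nn_integral_mono) (auto simp: ennreal_leI simp flip: ennreal_mult)
  also have "\<dots> = ennreal D * modular f" unfolding modular_def by (rule nn_integral_cmult) measurable
  finally show ?thesis .
qed

lemma musielak_norm_le:
  assumes "l > 0" "(\<integral>\<^sup>+x. ennreal (\<psi> x (norm (f x) / l)) \<partial>lebesgue_on \<Omega>) \<le> 1"
  shows "musielak_norm \<Omega> \<psi> f \<le> ennreal l"
  unfolding musielak_norm_def using assms by (intro Inf_lower) blast

text \<open>By \<open>psi_dilate\<close> the modular of f / \<epsilon> is at most D times that of f.
  If the latter is below 1 / (D + 1), then \<epsilon> is admissible in the infimum defining the
  norm.\<close>

lemma musielak_norm_small:
  assumes \<epsilon>: "\<epsilon> > 0"
  shows "\<exists>\<delta>>0. \<forall>f::'a \<Rightarrow> 'a. f \<in> borel_measurable (lebesgue_on \<Omega>) \<and> modular f < ennreal \<delta> \<longrightarrow> musielak_norm \<Omega> \<psi> f \<le> ennreal \<epsilon>"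
proof -
  obtain D where D: "D \<ge> 0" "\<And>x a. x \<in> \<Omega> \<Longrightarrow> a \<ge> 0 \<Longrightarrow> \<psi> x (1 / \<epsilon> * a) \<le> D * \<psi> x a"
    using psi_dilate[of "1 / \<epsilon>"] \<epsilon> by auto
  show ?thesis
  proof (intro exI[of _ "1 / (D + 1)"] conjI allI impI)
    show "1 / (D + 1) > 0" using D by simp
    fix f :: "'a \<Rightarrow> 'a" assume f: "f \<in> borel_measurable (lebesgue_on \<Omega>) \<and> modular f < ennreal (1 / (D + 1))"
    have "(\<integral>\<^sup>+x. ennreal (\<psi> x (norm (f x) / \<epsilon>)) \<partial>lebesgue_on \<Omega>) = (\<integral>\<^sup>+x. ennreal (\<psi> x (1 / \<epsilon> * norm (f x))) \<partial>lebesgue_on \<Omega>)" by simp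
    also have "\<dots> \<le> ennreal D * modular f" using f D \<epsilon> by (intro modular_scale_norm) auto
    also have "\<dots> \<le> ennreal D * ennreal (1 / (D + 1))" using f by (intro mult_left_mono) auto
    also have "\<dots> = ennreal (D * (1 / (D + 1)))" using D by (intro ennreal_mult[symmetric]) auto
    also have "\<dots> \<le> ennreal 1" using D by (intro ennreal_leI) simp
    finally show "musielak_norm \<Omega> \<psi> f \<le> ennreal \<epsilon>" using \<epsilon> by (intro musielak_norm_le) simp_all
  qed
qed

text \<open>From norm to modular by doubling, with the admissible parameter l as factor. Conversely
  convexity suffices: dividing f by m + 1 brings a modular m below 1.\<close>

lemma musielak_norm_finite_iff:
  fixes f :: "'a \<Rightarrow> 'a"
  assumes f: "f \<in> borel_measurable (lebesgue_on \<Omega>)"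
  shows "musielak_norm \<Omega> \<psi> f < \<infinity> \<longleftrightarrow> modular f < \<infinity>"
proof
  assume "musielak_norm \<Omega> \<psi> f < \<infinity>"
  then obtain l where l: "l > 0" "(\<integral>\<^sup>+x. ennreal (\<psi> x (norm (f x) / l)) \<partial>lebesgue_on \<Omega>) \<le> 1"
    unfolding musielak_norm_def Inf_less_iff by blast
  obtain D where D: "D \<ge> 0" "\<And>x a. x \<in> \<Omega> \<Longrightarrow> a \<ge> 0 \<Longrightarrow> \<psi> x (l * a) \<le> D * \<psi> x a"
    using psi_dilate[OF l(1)] by auto
  have "modular f = (\<integral>\<^sup>+x. ennreal (\<psi> x (l * norm ((1 / l) *\<^sub>R f x))) \<partial>lebesgue_on \<Omega>)"
    unfolding modular_def using l(1) by simp
  also have "\<dots> \<le> ennreal D * modular (\<lambda>x. (1 / l) *\<^sub>R f x)"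
    using f D l(1) by (intro modular_scale_norm) auto
  also have "modular (\<lambda>x. (1 / l) *\<^sub>R f x) \<le> 1" using l by (simp add: modular_def)
  finally show "modular f < \<infinity>" by (simp add: mult_left_mono le_less_trans[OF _ ennreal_less_top])
next
  assume fin: "modular f < \<infinity>"
  define m where "m = enn2real (modular f)"
  have m: "modular f = ennreal m" "m \<ge> 0" using fin by (auto simp: m_def)
  have "(\<integral>\<^sup>+x. ennreal (\<psi> x (norm (f x) / (m + 1))) \<partial>lebesgue_on \<Omega>) = (\<integral>\<^sup>+x. ennreal (\<psi> x (1 / (m + 1) * norm (f x))) \<partial>lebesgue_on \<Omega>)" by simp
  also have "\<dots> \<le> ennreal (1 / (m + 1)) * modular f"
    using f m by (intro modular_scale_norm psi_scale) auto
  also have "\<dots> = ennreal (1 / (m + 1) * m)" unfolding m(1) using m(2) by (intro ennreal_mult[symmetric]) auto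
  also have "\<dots> \<le> ennreal 1" using m by (intro ennreal_leI) simp
  finally have "musielak_norm \<Omega> \<psi> f \<le> ennreal (m + 1)" using m by (intro musielak_norm_le) simp_all
  then show "musielak_norm \<Omega> \<psi> f < \<infinity>" using le_less_trans ennreal_less_top by fastforce
qed

lemma Lp_space_measurable: "f \<in> Lp_space \<Omega> s \<Longrightarrow> f \<in> borel_measurable (lebesgue_on \<Omega>)"
  by (simp add: Lp_space_def)

lemma W1psi_density:
  assumes w: "w \<in> W1psi0 \<Omega> \<psi>" and \<epsilon>: "\<epsilon> > 0"
  shows "\<exists>\<phi>\<in>Cc_infinity \<Omega>. W1psi_norm \<Omega> \<psi> (\<lambda>x. w x - \<phi> x) < ennreal \<epsilon>"
proof -
  have w0: "w \<in> W1p0 \<Omega> 1" and w1: "w \<in> W1p \<Omega> 1" and fin: "musielak_norm \<Omega> \<psi> (weak_gradient \<Omega> w) < \<infinity>"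
    using w by (auto simp: W1psi0_def W1psi_def)
  have "modular (weak_gradient \<Omega> w) < \<infinity>"
    using fin musielak_norm_finite_iff[OF Lp_space_measurable[OF W1pD(3)[OF dom w1]]] by simp
  note approx = test_function_approx[OF w0 this]
  \<comment> \<open>\<epsilon>/3 rather than \<epsilon>/2, since the norm estimate is not strict and
    a strict bound by \<epsilon>/2 is needed for the sum.\<close>
  obtain \<delta> where \<delta>: "\<delta> > 0" "\<And>f::'a \<Rightarrow> 'a. f \<in> borel_measurable (lebesgue_on \<Omega>) \<Longrightarrow> modular f < ennreal \<delta> \<Longrightarrow> musielak_norm \<Omega> \<psi> f \<le> ennreal (\<epsilon>/3)"
    using musielak_norm_small[of "\<epsilon>/3"] \<epsilon> by auto
  have "min \<delta> (\<epsilon>/2) > 0" using \<delta>(1) \<epsilon> by simp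
  from approx[OF this] obtain \<phi> where \<phi>: "\<phi> \<in> Cc_infinity \<Omega>"
    "(\<integral>\<^sup>+x. ennreal (norm (w x - \<phi> x)) \<partial>lebesgue_on \<Omega>) < ennreal (min \<delta> (\<epsilon>/2))"
    "modular (\<lambda>x. weak_gradient \<Omega> w x - grad \<phi> x) < ennreal (min \<delta> (\<epsilon>/2))" by blast
  note d = W1p_diff_Cc[OF dom w1 \<phi>(1) zero_less_one]
  have "ennreal (Lp_norm \<Omega> 1 (\<lambda>x. w x - \<phi> x)) < ennreal (\<epsilon>/2)"
    using Lp_1_integrable(2)[OF dom W1pD(1)[OF dom d(1)]] \<phi>(2) less_le_trans[OF _ ennreal_leI[of "min \<delta> (\<epsilon>/2)" "\<epsilon>/2"]] by simp
  moreover have "musielak_norm \<Omega> \<psi> (weak_gradient \<Omega> (\<lambda>x. w x - \<phi> x)) < ennreal (\<epsilon>/2)"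
  proof (rule le_less_trans)
    show "musielak_norm \<Omega> \<psi> (weak_gradient \<Omega> (\<lambda>x. w x - \<phi> x)) \<le> ennreal (\<epsilon>/3)"
    proof (rule \<delta>(2))
      show "weak_gradient \<Omega> (\<lambda>x. w x - \<phi> x) \<in> borel_measurable (lebesgue_on \<Omega>)"
        by (rule Lp_space_measurable[OF W1pD(3)[OF dom d(1)]])
      show "modular (weak_gradient \<Omega> (\<lambda>x. w x - \<phi> x)) < ennreal \<delta>"
        using modular_cong[OF d(2)] \<phi>(3) less_le_trans[OF _ ennreal_leI[of "min \<delta> (\<epsilon>/2)" \<delta>]] by simp
    qed
    show "ennreal (\<epsilon>/3) < ennreal (\<epsilon>/2)" using \<epsilon> by (intro ennreal_lessI) auto
  qed
  ultimately have "W1psi_norm \<Omega> \<psi> (\<lambda>x. w x - \<phi> x) < ennreal (\<epsilon>/2 + \<epsilon>/2)"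
    unfolding W1psi_norm_def using \<epsilon> by (intro ennreal_add_less) auto
  then show ?thesis using \<phi>(1) by (intro bexI[OF _ \<phi>(1)]) simp
qed

lemma Cc_infinity_W1psi0: "Cc_infinity \<Omega> \<subseteq> W1psi0 \<Omega> \<psi>"
proof
  fix \<phi> assume \<phi>: "\<phi> \<in> Cc_infinity \<Omega>"
  note C = Cc_infinity_C1c[OF \<phi>]
  have 0: "\<phi> \<in> W1p0 \<Omega> 1" by (rule Cc_infinity_W1p0[OF dom \<phi>]) simp
  then have 1: "\<phi> \<in> W1p \<Omega> 1" by (simp add: W1p0_def)
  obtain B where B: "B > 0" "\<And>x. \<bar>\<phi> x\<bar> \<le> B" "\<And>x. norm (grad \<phi> x) \<le> B" using C1c_bounded[OF C] by metis
  have "modular (weak_gradient \<Omega> \<phi>) = modular (grad \<phi>)"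
    by (rule modular_cong[OF weak_gradient_eq(2)[OF open_\<Omega> C1c_is_weak_gradient[OF open_\<Omega> C]]])
  also have "\<dots> < \<infinity>" by (rule modular_bounded_finite) (rule B(3))
  finally have "musielak_norm \<Omega> \<psi> (weak_gradient \<Omega> \<phi>) < \<infinity>"
    using musielak_norm_finite_iff[OF Lp_space_measurable[OF W1pD(3)[OF dom 1]]] by simp
  then show "\<phi> \<in> W1psi0 \<Omega> \<psi>" using 0 1 by (simp add: W1psi0_def W1psi_def)
qed

lemma weak_gradient_add:
  assumes "is_weak_gradient \<Omega> u (weak_gradient \<Omega> u)" "is_weak_gradient \<Omega> v h"
  shows "AE x in lebesgue_on \<Omega>. weak_gradient \<Omega> (\<lambda>x. u x + v x) x = weak_gradient \<Omega> u x + h x"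
  by (rule weak_gradient_eq(2)[OF open_\<Omega> is_weak_gradient_combine(1)[OF open_\<Omega> assms]])

text \<open>Finite energy of u0 + v transfers to v, because u0 has finite modular; so v has an
  approximation \<phi> in the modular. Then grad u0 + grad \<phi> is grad u0 + grad v minus a
  modularly small difference, and \<open>psi_add_eps\<close> keeps the factor of the energy at 1 +
  \<eta>.\<close>

lemma energy_approx:
  assumes u0: "u0 \<in> W1p \<Omega> q" and v: "v \<in> W1p0 \<Omega> p" and E: "energy \<Omega> \<psi> (\<lambda>x. u0 x + v x) < \<infinity>" and \<epsilon>: "\<epsilon> > 0"
  shows "\<exists>\<phi>\<in>Cc_infinity \<Omega>. energy \<Omega> \<psi> (\<lambda>x. u0 x + \<phi> x) \<le> energy \<Omega> \<psi> (\<lambda>x. u0 x + v x) + ennreal \<epsilon>"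
proof -
  have v1: "v \<in> W1p0 \<Omega> 1" using p by (intro W1p0_mono[OF dom v]) auto
  then have v1': "v \<in> W1p \<Omega> 1" by (simp add: W1p0_def)
  let ?g = "weak_gradient \<Omega> u0" and ?h = "weak_gradient \<Omega> v"
  note wu = W1pD(2)[OF dom u0]
  have gm [measurable]: "?g \<in> borel_measurable (lebesgue_on \<Omega>)" by (rule Lp_space_measurable[OF W1pD(3)[OF dom u0]])
  have hm [measurable]: "?h \<in> borel_measurable (lebesgue_on \<Omega>)" by (rule Lp_space_measurable[OF W1pD(3)[OF dom v1']])
  have e1: "energy \<Omega> \<psi> (\<lambda>x. u0 x + v x) = modular (\<lambda>x. ?g x + ?h x)"
    unfolding energy_eq_modular by (rule modular_cong[OF weak_gradient_add[OF wu W1pD(2)[OF dom v1']]])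
  have "modular ?h = modular (\<lambda>x. (?g x + ?h x) + (- ?g x))" by simp
  also have "\<dots> \<le> ennreal C4 * (modular (\<lambda>x. ?g x + ?h x) + modular (\<lambda>x. - ?g x))"
    by (rule modular_add) measurable
  also have "modular (\<lambda>x. - ?g x) = modular ?g" by (simp add: modular_def)
  also have "ennreal C4 * (modular (\<lambda>x. ?g x + ?h x) + modular ?g) < \<infinity>"
    using E e1 modular_finite_Lp[OF W1pD(3)[OF dom u0]] by (simp add: ennreal_mult_less_top)
  finally have hfin: "modular ?h < \<infinity>" .
  define e where "e = enn2real (modular (\<lambda>x. ?g x + ?h x))"
  have e: "modular (\<lambda>x. ?g x + ?h x) = ennreal e" "e \<ge> 0" using E e1 by (auto simp: e_def)
  \<comment> \<open>Half of \<epsilon> is spent on \<eta> times the energy e, the other half on D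
    times the modular error \<delta>; D depends on \<eta>, so \<delta> is fixed last.\<close>
  define \<eta> where "\<eta> = \<epsilon> / 2 / (e + 1)"
  have \<eta>: "\<eta> > 0" "\<eta> * e \<le> \<epsilon> / 2"
  proof -
    show "\<eta> > 0" using e \<epsilon> by (simp add: \<eta>_def)
    have "e + 1 \<noteq> 0" using e(2) by linarith
    then have "\<eta> * (e + 1) = \<epsilon> / 2"
      unfolding \<eta>_def by (metis nonzero_eq_divide_eq)
    then show "\<eta> * e \<le> \<epsilon> / 2" using \<open>\<eta> > 0\<close> by (simp add: algebra_simps)
  qed
  obtain D where D: "D \<ge> 0" "\<And>x a b. x \<in> \<Omega> \<Longrightarrow> a \<ge> 0 \<Longrightarrow> b \<ge> 0 \<Longrightarrow> \<psi> x (a + b) \<le> (1 + \<eta>) * \<psi> x a + D * \<psi> x b"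
    using psi_add_eps[OF \<eta>(1)] by auto
  define \<delta> where "\<delta> = \<epsilon> / 2 / (D + 1)"
  have \<delta>: "\<delta> > 0" "D * \<delta> \<le> \<epsilon> / 2"
  proof -
    show "\<delta> > 0" using D \<epsilon> by (simp add: \<delta>_def)
    have "D + 1 \<noteq> 0" using D(1) by linarith
    then have "\<delta> * (D + 1) = \<epsilon> / 2"
      unfolding \<delta>_def by (metis nonzero_eq_divide_eq)
    then show "D * \<delta> \<le> \<epsilon> / 2" using \<open>\<delta> > 0\<close> by (simp add: algebra_simps)
  qed
  obtain \<phi> where \<phi>: "\<phi> \<in> Cc_infinity \<Omega>" "modular (\<lambda>x. ?h x - grad \<phi> x) < ennreal \<delta>"
    using test_function_approx[OF v1 hfin \<delta>(1)] by blast
  note C = Cc_infinity_C1c[OF \<phi>(1)]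
  have gphi [measurable]: "grad \<phi> \<in> borel_measurable (lebesgue_on \<Omega>)" by (rule borel_measurable_\<Omega>[OF C1c_measurable(2)[OF C]])
  have m1 [measurable]: "(\<lambda>x. \<psi> x (norm (?g x + ?h x))) \<in> borel_measurable (lebesgue_on \<Omega>)"
    by (rule psi_norm_measurable) measurable
  have m2 [measurable]: "(\<lambda>x. \<psi> x (norm (?h x - grad \<phi> x))) \<in> borel_measurable (lebesgue_on \<Omega>)"
    by (rule psi_norm_measurable) measurable
  have "energy \<Omega> \<psi> (\<lambda>x. u0 x + \<phi> x) = modular (\<lambda>x. ?g x + grad \<phi> x)"
    unfolding energy_eq_modular by (rule modular_cong[OF weak_gradient_add[OF wu C1c_is_weak_gradient[OF open_\<Omega> C]]])
  also have "\<dots> \<le> (\<integral>\<^sup>+x. ennreal (1 + \<eta>) * ennreal (\<psi> x (norm (?g x + ?h x))) + ennreal D * ennreal (\<psi> x (norm (?h x - grad \<phi> x))) \<partial>lebesgue_on \<Omega>)"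
    unfolding modular_def
  proof (rule nn_integral_mono)
    fix x assume "x \<in> space (lebesgue_on \<Omega>)"
    then have x: "x \<in> \<Omega>" by simp
    have "norm (?g x + grad \<phi> x) \<le> norm (?g x + ?h x) + norm (?h x - grad \<phi> x)"
      using norm_triangle_ineq4[of "?g x + ?h x" "?h x - grad \<phi> x"] by simp
    then have "\<psi> x (norm (?g x + grad \<phi> x)) \<le> \<psi> x (norm (?g x + ?h x) + norm (?h x - grad \<phi> x))"
      by (intro psi_mono x) auto
    also have "\<dots> \<le> (1 + \<eta>) * \<psi> x (norm (?g x + ?h x)) + D * \<psi> x (norm (?h x - grad \<phi> x))"
      by (intro D(2) x) auto
    finally show "ennreal (\<psi> x (norm (?g x + grad \<phi> x))) \<le> ennreal (1 + \<eta>) * ennreal (\<psi> x (norm (?g x + ?h x))) + ennreal D * ennreal (\<psi> x (norm (?h x - grad \<phi> x)))"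
      using \<eta>(1) D(1) psi_nonneg[OF x] by (simp add: ennreal_leI flip: ennreal_mult ennreal_plus)
  qed
  also have "\<dots> = ennreal (1 + \<eta>) * modular (\<lambda>x. ?g x + ?h x) + ennreal D * modular (\<lambda>x. ?h x - grad \<phi> x)"
    unfolding modular_def by (simp add: nn_integral_add nn_integral_cmult)
  also have "\<dots> \<le> ennreal (1 + \<eta>) * ennreal e + ennreal D * ennreal \<delta>"
    using \<phi>(2) e by (intro add_mono mult_left_mono) auto
  also have "\<dots> = ennreal ((1 + \<eta>) * e + D * \<delta>)" using \<eta>(1) e D(1) \<delta>(1) by (simp add: ennreal_mult)
  also have "\<dots> \<le> ennreal (e + \<epsilon>)" using \<eta>(2) \<delta>(2) by (intro ennreal_leI) (simp add: algebra_simps)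
  also have "\<dots> = energy \<Omega> \<psi> (\<lambda>x. u0 x + v x) + ennreal \<epsilon>" using e \<epsilon> e1 by simp
  finally show ?thesis using \<phi>(1) by blast
qed

text \<open>The inclusions of the classes order the three infima, and \<open>energy_approx\<close>
  closes the cycle. Competitors of infinite energy need no approximation, because
  \<open>ennreal_le_epsilon\<close> asks only about finite bounds.\<close>

lemma no_gap:
  assumes pq: "p \<le> q" and u0: "u0 \<in> W1p \<Omega> q"
  shows "(INF v\<in>W1p0 \<Omega> p. energy \<Omega> \<psi> (\<lambda>x. u0 x + v x)) = (INF v\<in>W1p0 \<Omega> q. energy \<Omega> \<psi> (\<lambda>x. u0 x + v x))"
    "(INF v\<in>W1p0 \<Omega> q. energy \<Omega> \<psi> (\<lambda>x. u0 x + v x)) = (INF \<phi>\<in>Cc_infinity \<Omega>. energy \<Omega> \<psi> (\<lambda>x. u0 x + \<phi> x))"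
proof -
  let ?E = "\<lambda>v. energy \<Omega> \<psi> (\<lambda>x. u0 x + v x)"
  have "W1p0 \<Omega> q \<subseteq> W1p0 \<Omega> p" using W1p0_mono[OF dom _ _ pq] p by auto
  then have 1: "(INF v\<in>W1p0 \<Omega> p. ?E v) \<le> (INF v\<in>W1p0 \<Omega> q. ?E v)" by (rule INF_superset_mono) simp
  have "Cc_infinity \<Omega> \<subseteq> W1p0 \<Omega> q" using Cc_infinity_W1p0[OF dom _ q] by blast
  then have 2: "(INF v\<in>W1p0 \<Omega> q. ?E v) \<le> (INF v\<in>Cc_infinity \<Omega>. ?E v)" by (rule INF_superset_mono) simp
  have 3: "(INF v\<in>Cc_infinity \<Omega>. ?E v) \<le> (INF v\<in>W1p0 \<Omega> p. ?E v)"
  proof (rule INF_greatest)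
    fix v assume v: "v \<in> W1p0 \<Omega> p"
    show "(INF v\<in>Cc_infinity \<Omega>. ?E v) \<le> ?E v"
    proof (rule ennreal_le_epsilon)
      fix \<epsilon> :: real assume "?E v < top" "0 < \<epsilon>"
      then obtain \<phi> where "\<phi> \<in> Cc_infinity \<Omega>" "?E \<phi> \<le> ?E v + ennreal \<epsilon>"
        using energy_approx[OF u0 v] by auto
      then show "(INF v\<in>Cc_infinity \<Omega>. ?E v) \<le> ?E v + ennreal \<epsilon>" by (meson INF_lower order_trans)
    qed
  qed
  show "(INF v\<in>W1p0 \<Omega> p. ?E v) = (INF v\<in>W1p0 \<Omega> q. ?E v)" "(INF v\<in>W1p0 \<Omega> q. ?E v) = (INF \<phi>\<in>Cc_infinity \<Omega>. ?E \<phi>)"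
    using 1 2 3 by order+
qed

end

theorem theorem2p3:
  fixes \<Omega> :: "'a::euclidean_space set"
    and \<psi> :: "'a \<Rightarrow> real \<Rightarrow> real"
    and \<alpha> p q :: real
  assumes "bounded_lipschitz_domain \<Omega>"
    and "0 < \<alpha>" and "\<alpha> \<le> 1"
    and "1 < p" and "p < q"
    and "q \<le> p + \<alpha> * max 1 (p / real DIM('a))"
    and "admissible_integrand \<Omega> \<psi>"
    and "cond_A1 \<Omega> \<psi>" and "cond_A2 \<Omega> \<psi>" and "cond_A3 \<Omega> \<psi>"
    and "cond_A4 \<Omega> p q \<psi>" and "cond_A5 \<Omega> \<psi>"
    and "cond_Cont \<Omega> p \<psi>"
  shows "(\<forall>u0\<in>W1p \<Omega> q.
            (INF v\<in>W1p0 \<Omega> p. energy \<Omega> \<psi> (\<lambda>x. u0 x + v x)) =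
              (INF v\<in>W1p0 \<Omega> q. energy \<Omega> \<psi> (\<lambda>x. u0 x + v x)) \<and>
            (INF v\<in>W1p0 \<Omega> q. energy \<Omega> \<psi> (\<lambda>x. u0 x + v x)) =
              (INF \<phi>\<in>Cc_infinity \<Omega>. energy \<Omega> \<psi> (\<lambda>x. u0 x + \<phi> x))) \<and>
         Cc_infinity \<Omega> \<subseteq> W1psi0 \<Omega> \<psi> \<and>
         (\<forall>w\<in>W1psi0 \<Omega> \<psi>. \<forall>\<epsilon>>0. \<exists>\<phi>\<in>Cc_infinity \<Omega>.
            W1psi_norm \<Omega> \<psi> (\<lambda>x. w x - \<phi> x) < ennreal \<epsilon>)"
proof -
  have cl: "x \<in> \<Omega> \<Longrightarrow> x \<in> closure \<Omega>" for x using closure_subset by blast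
  obtain \<xi>0 C1 C2 where A4: "\<xi>0 \<ge> 1" "C1 > 0" "C2 > 0"
    "\<forall>x\<in>closure \<Omega>. (\<forall>\<xi>\<ge>\<xi>0. C1 * \<xi> powr p \<le> \<psi> x \<xi>) \<and> (\<forall>\<xi>\<ge>0. \<psi> x \<xi> \<le> C2 * (1 + \<xi> powr q))"
    using assms(11) unfolding cond_A4_def by blast
  obtain C4 where A5: "\<forall>x\<in>closure \<Omega>. \<forall>\<xi>\<ge>0. \<psi> x (2 * \<xi>) \<le> C4 * \<psi> x \<xi>"
    using assms(12) unfolding cond_A5_def by blast
  have nonneg: "\<psi> x \<xi> \<ge> 0" if "x \<in> \<Omega>" "\<xi> \<ge> 0" for x \<xi>
    using assms(7) that cl unfolding admissible_integrand_def by blast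
  \<comment> \<open>The given C4 carries no sign condition; since \<open>\<psi>\<close> is
    nonnegative, it can be replaced by its maximum with 2.\<close>
  interpret integrand \<Omega> \<psi> p q C1 C2 "max 2 C4" \<xi>0
  proof
    show "(\<lambda>x. \<psi> x \<xi>) \<in> borel_measurable (lebesgue_on \<Omega>)" if "\<xi> \<ge> 0" for \<xi>
    proof (rule measurable_restrict_mono[OF _ closure_subset])
      show "(\<lambda>x. \<psi> x \<xi>) \<in> borel_measurable (lebesgue_on (closure \<Omega>))"
        using assms(7) that unfolding admissible_integrand_def by blast
    qed
    show "\<psi> x 0 = 0" if "x \<in> \<Omega>" for x
      using assms(8) cl[OF that] unfolding cond_A1_def by simp
    show "convex_on {0..} (\<psi> x)" if "x \<in> \<Omega>" for x
      using assms(9) cl[OF that] unfolding cond_A2_def by blast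
    show "\<psi> x (2 * \<xi>) \<le> max 2 C4 * \<psi> x \<xi>" if "x \<in> \<Omega>" "\<xi> \<ge> 0" for x \<xi>
    proof -
      have "\<psi> x (2 * \<xi>) \<le> C4 * \<psi> x \<xi>" using A5 cl that by blast
      also have "\<dots> \<le> max 2 C4 * \<psi> x \<xi>" using nonneg[OF that] by (intro mult_right_mono) auto
      finally show ?thesis .
    qed
  qed (use assms A4 cl nonneg in auto)
  show ?thesis
    using no_gap assms(5) Cc_infinity_W1psi0 W1psi_density by simp
qed

end
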